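(* Let $X$ be an analytic subset of a complete metric space with metric $d$, let $(\Lambda,\mathcal P)$ be a probability space, let $k\ge 1$ be an integer, and let $\pi:\Lambda\times X\to\mathbb R^k$ be a measurable map such that for every $\lambda\in\Lambda$ the map $\pi_\lambda:X\to\mathbb R^k$, $\pi_\lambda(x)=\pi(\lambda,x)$, is continuous. Assume that there are positive real numbers $\alpha, C$ such that $$\mathcal P\big[\lambda\in\Lambda:\ |\pi_\lambda(x_1)-\pi_\lambda(x_2)|\le \delta\, d(x_1,x_2)^{\alpha}\big]\le C\delta^{k}$$ for all $\delta\in(0,1)$ and all $x_1,x_2\in X$ with $x_1\ne x_2$. Then: 1. If $HD(X)>\alpha k$, then $\mathrm{Leb}(\pi_\lambda(X))>0$ for almost every $\lambda\in\Lambda$. 2. If $HD(X)\le\alpha k$, then $HD(\pi_\lambda(X))\ge \frac{HD(X)}{\alpha}$ for almost every $\lambda\in\Lambda$.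
   Context: $HD$ denotes Hausdorff dimension. $\mathrm{Leb}$ denotes Lebesgue measure on $\mathbb R^k$ and $|\cdot|$ the Euclidean norm. "Almost every $\lambda$" is with respect to $\mathcal P$. *)

theory Defs
  imports "HOL-Probability.Probability"
begin

text \<open>
  A set is analytic if it is empty or a continuous image of the Baire space \<open>nat \<Rightarrow> nat\<close>
  (product of discrete topologies); equivalently, a continuous image of a Polish space.
\<close>

definition analytic_set :: "'a::topological_space set \<Rightarrow> bool" where
  "analytic_set A \<longleftrightarrow>
     A = {} \<or> (\<exists>f :: (nat \<Rightarrow> nat) \<Rightarrow> 'a. continuous_on UNIV f \<and> range f = A)"

text \<open>
  The summand \<open>(diam U)\<^sup>s\<close> for bounded \<open>U\<close>. The empty set always contributes \<open>0\<close>, and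
  nonempty sets contribute \<open>1\<close> when \<open>s = 0\<close>; this case is separate because
  \<open>0 powr 0 = 0\<close> in HOL.
\<close>

definition diam_pow :: "real \<Rightarrow> 'a::metric_space set \<Rightarrow> ennreal" where
  "diam_pow s U =
     (if U = {} then 0 else if s = 0 then 1 else ennreal (diameter U powr s))"

text \<open>
  Boundedness of the covering sets is required explicitly because the real-valued
  \<^const>\<open>diameter\<close> is meaningless on unbounded sets. If no admissible cover exists,
  the infimum is \<open>\<infinity>\<close>.
\<close>

definition hausdorff_content :: "real \<Rightarrow> real \<Rightarrow> 'a::metric_space set \<Rightarrow> ennreal" where
  "hausdorff_content s \<delta> A =
     (INF U \<in> {U :: nat \<Rightarrow> 'a set.
                 A \<subseteq> (\<Union>i. U i) \<and> (\<forall>i. bounded (U i) \<and> diameter (U i) \<le> \<delta>)}.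
        \<Sum>i. diam_pow s (U i))"

definition hausdorff_measure :: "real \<Rightarrow> 'a::metric_space set \<Rightarrow> ennreal" where
  "hausdorff_measure s A = (SUP \<delta> \<in> {0<..}. hausdorff_content s \<delta> A)"

definition hausdorff_dim :: "'a::metric_space set \<Rightarrow> ennreal" where
  "hausdorff_dim A = Inf {ennreal s | s. 0 \<le> s \<and> hausdorff_measure s A = 0}"

end

theory Submission
  imports Defs
begin

text \<open>
  No Frostman measure on \<open>X\<close> is constructed; an \<open>L\<^sup>2\<close> capacity carries the argument.
  For a class of functions \<open>F \<ge> 0\<close> on \<open>\<Lambda> \<times> \<real>\<^sup>k\<close> (part 1) or on \<open>\<nat> \<times> \<Lambda> \<times> \<real>\<^sup>k\<close>
  (part 2, one slice for each dyadic scale), let the capacity of a set be the infimum of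
  \<open>\<integral>F\<^sup>2\<close> over those \<open>F\<close> whose potential exceeds \<open>1\<close> on the set. By the parallelogram law
  near-minimizers form Cauchy sequences, so the capacity is continuous along increasing unions;
  since potentials are lower semicontinuous, Choquet's argument shows that the image of the Baire
  space has capacity \<open>0\<close> as soon as the images of all compact boxes do. If the \<open>\<pi>\<^sub>\<lambda>\<close>-images of the
  boxes are Lebesgue null (part 1) or null for the \<open>t\<close>-dimensional measure (part 2) for all \<open>\<lambda>\<close>
  in a set of positive probability, then finite covers of these compact images provide the \<open>F\<close> needed
  for the boxes.

  Conversely, capacity \<open>0\<close> forces \<open>X\<close> to be null. By the Cauchy-Schwarz inequality, \<open>F\<close> bounds from
  below the energy of every finitely supported probability on \<open>X\<close>, with respect to a kernel that
  transversality bounds by \<open>d(x,y)\<^bsup>-\<alpha>t\<^esup>\<close>, truncated at a scale depending on \<open>x\<close>. A near-minimizer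
  of the energy has a large potential, so every point sees a heavy ball at a scale above its
  truncation, and maximal separated sets turn these balls into covers with small sum. A compactness
  argument removes the dependence on a uniform lower bound of the truncation scales.
\<close>

section \<open>Hausdorff measures and boxes in the Baire space\<close>

text \<open>Duality is the source of the construction. The usual argument averages over \<lambda>
  the energies of the projections of a measure on \<open>X\<close>. Here the energy of a finite
  probability \<open>m\<close> is the squared norm of the sum of the \<open>m x * v x\<close> in an
  L2 space over \<Lambda> x R^k, with \<open>v x\<close> built from tubes around the graph of
  \<lambda> -> \<pi>(\<lambda>, x). A function \<open>F\<close> of small norm that pairs to at least
  1 with every \<open>v x\<close> forces all these energies to be large. So limits take place over
  \<Lambda> x R^k and the Baire space, and \<open>X\<close> carries finite sums only. The price is
  that each \<open>x\<close> gets some truncation scale, with no control in \<open>x\<close>. The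
  constants of the covering part must therefore be blind to these scales. Transversality is an upper
  bound and passes to restrictions of \<open>P\<close>, which is why the argument runs for measures
  of mass at most 1. Nullity of the boxes is an uncountable condition on \<lambda>, so it is
  replaced by a countable essential intersection. The losses t < t' < s / \<alpha> make geometric
  series converge and are harmless, as dimension is an infimum over exponents.\<close>

lemma diam_pow_pos: "0 < s \<Longrightarrow> diam_pow s U = ennreal (diameter U powr s)"
  by (auto simp: diam_pow_def diameter_empty)

text \<open>For a positive exponent the mesh condition is automatic: a single summand is at most the
  whole sum, so a total of at most \<open>\<delta> powr s\<close> keeps every diameter below
  \<delta>.\<close>

lemma hausdorff_measure_eq_0I:
  assumes s: "0 < s"
    and cov: "\<And>e. 0 < e \<Longrightarrow> \<exists>U :: nat \<Rightarrow> 'a::metric_space set. A \<subseteq> (\<Union>i. U i) \<and> (\<forall>i. bounded (U i)) \<and>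
                (\<Sum>i. diam_pow s (U i)) \<le> ennreal e"
  shows "hausdorff_measure s A = 0"
proof -
  have le: "hausdorff_content s \<delta> A \<le> 0 + ennreal e" if d: "0 < \<delta>" and e: "0 < e" for \<delta> e
  proof -
    have "0 < min e (\<delta> powr s)" using d e by simp
    from cov[OF this] obtain U where "A \<subseteq> (\<Union>i. U i) \<and> (\<forall>i. bounded (U i)) \<and>
      (\<Sum>i. diam_pow s (U i)) \<le> ennreal (min e (\<delta> powr s))" by (rule exE)
    then have U: "A \<subseteq> (\<Union>i. U i)" "\<And>i. bounded (U i)"
      and sU: "(\<Sum>i. diam_pow s (U i)) \<le> ennreal (min e (\<delta> powr s))" by simp_all
    have dU: "diameter (U i) \<le> \<delta>" for i
    proof -
      have "diam_pow s (U i) \<le> (\<Sum>i. diam_pow s (U i))"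
        by (rule sum_le_suminf[where I="{i}", simplified]) auto
      also note sU
      finally have "diameter (U i) powr s \<le> \<delta> powr s"
        using s d e by (auto simp: diam_pow_pos ennreal_le_iff)
      then show ?thesis
        using s d powr_less_mono2[of s \<delta> "diameter (U i)"] by force
    qed
    have "hausdorff_content s \<delta> A \<le> (\<Sum>i. diam_pow s (U i))"
      unfolding hausdorff_content_def by (rule INF_lower) (use U dU in auto)
    also have "\<dots> \<le> ennreal e" using sU by (rule order_trans) (simp add: ennreal_leI)
    finally show ?thesis by simp
  qed
  have "hausdorff_content s \<delta> A \<le> 0" if "0 < \<delta>" for \<delta>
    by (rule ennreal_le_epsilon) (rule le[OF that])
  then have "hausdorff_measure s A \<le> 0" unfolding hausdorff_measure_def
    by (intro SUP_least) simp
  then show ?thesis by simp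
qed

lemma hausdorff_measure_0_cover:
  fixes A :: "'a::metric_space set"
  assumes H: "hausdorff_measure s A = 0" and d: "0 < \<delta>" and e: "0 < (e::real)"
  shows "\<exists>U :: nat \<Rightarrow> 'a set. A \<subseteq> (\<Union>i. U i) \<and> (\<forall>i. bounded (U i) \<and> diameter (U i) \<le> \<delta>) \<and>
    (\<Sum>i. diam_pow s (U i)) < ennreal e"
proof -
  have "hausdorff_content s \<delta> A \<le> hausdorff_measure s A"
    unfolding hausdorff_measure_def by (rule SUP_upper) (use d in auto)
  with H e have "hausdorff_content s \<delta> A < ennreal e" by simp
  then show ?thesis
    unfolding hausdorff_content_def INF_less_iff Bex_def mem_Collect_eq by (simp only: conj_assoc)
qed

lemma hausdorff_measure_mono:
  assumes "A \<subseteq> B" shows "hausdorff_measure s A \<le> hausdorff_measure s B"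
proof -
  have "hausdorff_content s \<delta> A \<le> hausdorff_content s \<delta> B" for \<delta>
    unfolding hausdorff_content_def by (rule INF_superset_mono) (use assms in blast, rule order_refl)
  then show ?thesis unfolding hausdorff_measure_def by (rule SUP_mono')
qed

text \<open>With diameters at most 1, a larger exponent can only shrink each summand; for
  \<open>u = 0\<close> the comparison is with the value 1.\<close>

lemma hausdorff_measure_0_exponent_mono:
  fixes A :: "'a::metric_space set"
  assumes H: "hausdorff_measure u A = 0" and u: "0 \<le> u" "u < t"
  shows "hausdorff_measure t A = 0"
proof (rule hausdorff_measure_eq_0I)
  fix e :: real assume "0 < e"
  from hausdorff_measure_0_cover[OF H zero_less_one this]
  obtain U where *: "A \<subseteq> (\<Union>i. U i) \<and> (\<forall>i. bounded (U i) \<and> diameter (U i) \<le> 1) \<and>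
    (\<Sum>i. diam_pow u (U i)) < ennreal e"
    by (rule exE)
  then have U: "A \<subseteq> (\<Union>i. U i)" "\<And>i. bounded (U i)" "\<And>i. diameter (U i) \<le> 1"
    "(\<Sum>i. diam_pow u (U i)) < ennreal e" by simp_all
  have "diam_pow t (U i) \<le> diam_pow u (U i)" for i
  proof -
    have "0 \<le> diameter (U i)" "diameter (U i) \<le> 1" by (rule diameter_ge_0[OF U(2)], rule U(3))
    then have "diameter (U i) powr t \<le> 1" "diameter (U i) powr t \<le> diameter (U i) powr u"
      using u powr_le1[of t "diameter (U i)"] powr_mono'[of u t "diameter (U i)"] by simp_all
    then show ?thesis using u by (simp add: diam_pow_def ennreal_leI)
  qed
  then have "(\<Sum>i. diam_pow t (U i)) \<le> (\<Sum>i. diam_pow u (U i))"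
    by (rule suminf_le) (rule summableI)+
  also note U(4)
  finally show "\<exists>U. A \<subseteq> (\<Union>i. U i) \<and> (\<forall>i. bounded (U i)) \<and> (\<Sum>i. diam_pow t (U i)) \<le> ennreal e"
    by (intro exI[of _ U] conjI allI U(1,2) less_imp_le)
next
  show "0 < t" using u by linarith
qed

lemma hausdorff_dim_le: "0 \<le> s \<Longrightarrow> hausdorff_measure s A = 0 \<Longrightarrow> hausdorff_dim A \<le> ennreal s"
  unfolding hausdorff_dim_def by (rule Inf_lower) blast

lemma hausdorff_dim_ge:
  assumes "hausdorff_measure t A \<noteq> 0"
  shows "ennreal t \<le> hausdorff_dim A"
  unfolding hausdorff_dim_def
proof (rule Inf_greatest)
  fix v assume "v \<in> {ennreal s |s. 0 \<le> s \<and> hausdorff_measure s A = 0}"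
  then obtain u where u: "v = ennreal u" "0 \<le> u" "hausdorff_measure u A = 0" by blast
  then have "t \<le> u" using hausdorff_measure_0_exponent_mono[of u A t] assms by force
  then show "ennreal t \<le> v" using u(1) by (simp add: ennreal_leI)
qed

section \<open>Choquet's scheme on the Baire space: boxes and cylinders\<close>

definition baire_box :: "(nat \<Rightarrow> nat) \<Rightarrow> (nat \<Rightarrow> nat) set" where
  "baire_box b = {y. \<forall>i. y i \<le> b i}"

definition baire_cyl :: "(nat \<Rightarrow> nat) \<Rightarrow> nat \<Rightarrow> (nat \<Rightarrow> nat) set" where
  "baire_cyl b m = {y. \<forall>i<m. y i \<le> b i}"

text \<open>\<open>Q\<close> abstracts "the capacity exceeds a level", so that the scheme serves
  both the quadratic capacities and Lebesgue outer measure. A set is the increasing union of its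
  parts with bounded coordinate \<open>m\<close>, so bounds for one coordinate after another can be
  fixed without losing \<open>Q\<close>.\<close>

lemma baire_box_capacitable:
  assumes cont: "\<And>A :: nat \<Rightarrow> (nat \<Rightarrow> nat) set. incseq A \<Longrightarrow> Q (\<Union>n. A n) \<Longrightarrow> \<exists>n. Q (A n)"
    and UNIV: "Q UNIV"
  obtains b where "\<And>m. Q (baire_cyl b m)"
proof -
  have step: "\<exists>n. Q {y \<in> A. y m \<le> n}" if "Q A" for A and m :: nat
  proof (rule cont)
    show "incseq (\<lambda>n. {y \<in> A. y m \<le> n})" by (auto simp: incseq_def)
    have "(\<Union>n. {y \<in> A. y m \<le> n}) = A" by auto
    then show "Q (\<Union>n. {y \<in> A. y m \<le> n})" using that by simp
  qed
  define pick where "pick A m = (SOME n. Q {y \<in> A. y m \<le> n})" for A and m :: nat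
  define C where "C = rec_nat UNIV (\<lambda>m A. {y \<in> A. y m \<le> pick A m})"
  have C: "C 0 = UNIV" "\<And>m. C (Suc m) = {y \<in> C m. y m \<le> pick (C m) m}" by (simp_all add: C_def)
  have Q: "Q (C m)" for m
  proof (induction m)
    case (Suc m)
    from someI_ex[OF step[OF Suc, of m]] show ?case by (simp add: C pick_def)
  qed (simp add: C UNIV)
  have "C m = baire_cyl (\<lambda>m. pick (C m) m) m" for m
    by (induction m) (auto simp: C baire_cyl_def less_Suc_eq)
  with Q that show ?thesis by metis
qed

lemma compact_baire_box: "compact (baire_box b)"
proof -
  have "compactin (product_topology (\<lambda>_. euclidean) UNIV) (PiE UNIV (\<lambda>i. {..b i}))"
    by (subst compactin_PiE) (auto intro: finite_imp_compact)
  moreover have "PiE UNIV (\<lambda>i. {..b i}) = baire_box b"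
    by (auto simp: baire_box_def PiE_def Pi_def)
  ultimately show ?thesis
    by (simp add: euclidean_product_topology)
qed

lemma tendsto_fun_iff: "(f \<longlongrightarrow> l) F \<longleftrightarrow> (\<forall>i. ((\<lambda>j. f j i) \<longlongrightarrow> l i) F)"
  using limitin_componentwise[of "\<lambda>_. euclidean" UNIV f l F]
  by (simp add: euclidean_product_topology)

text \<open>The cylinders decrease to the compact box but are not compact themselves. Points of
  cylinders outside \<open>W\<close> are therefore moved into the box by changing late coordinates,
  which does not affect coordinatewise limits.\<close>

lemma baire_cyl_subset_open:
  assumes "open W" "baire_box b \<subseteq> W"
  obtains m where "baire_cyl b m \<subseteq> W"
proof (rule ccontr)
  assume "\<not> thesis"
  then have "\<forall>m. \<exists>y. y \<in> baire_cyl b m - W" using that by blast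
  then obtain y where y: "\<And>m. y m \<in> baire_cyl b m" "\<And>m. y m \<notin> W" by (metis DiffD1 DiffD2)
  define z where "z m i = (if i < m then y m i else 0)" for m i
  have "\<forall>m. z m \<in> baire_box b" using y(1) by (auto simp: z_def baire_box_def baire_cyl_def)
  then obtain l r where l: "l \<in> baire_box b" and r: "strict_mono r" and lim: "(z \<circ> r) \<longlonglongrightarrow> l"
    using seq_compactE[OF compact_imp_seq_compact[OF compact_baire_box]] by blast
  have "(\<lambda>j. y (r j)) \<longlonglongrightarrow> l"
    unfolding tendsto_fun_iff
  proof
    fix i
    have "(\<lambda>j. z (r j) i) \<longlonglongrightarrow> l i" using lim by (simp add: tendsto_fun_iff o_def)
    moreover have "\<forall>\<^sub>F j in sequentially. z (r j) i = y (r j) i"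
      unfolding eventually_sequentially
    proof (intro exI allI impI)
      fix j assume "Suc i \<le> j"
      with seq_suble[OF r, of j] show "z (r j) i = y (r j) i" by (simp add: z_def)
    qed
    ultimately show "(\<lambda>j. y (r j) i) \<longlonglongrightarrow> l i" by (rule Lim_transform_eventually)
  qed
  moreover have "l \<in> W" using l assms(2) by auto
  ultimately have "\<forall>\<^sub>F j in sequentially. y (r j) \<in> W"
    by (rule topological_tendstoD[OF _ assms(1)])
  then show False using y(2) by simp
qed

section \<open>Capacities with quadratic cost\<close>

text \<open>Subtraction of \<open>ennreal\<close> is truncated, so \<open>b - a\<close> is a
  positive part and the parallelogram identity becomes an inequality. Positive parts are enough
  later, since only upper envelopes are formed.\<close>

lemma ennreal_parallelogram_le: "(a + b)^2 + (b - a)^2 \<le> 2 * a^2 + 2 * (b::ennreal)^2"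
proof (cases a; cases b)
  fix r s :: real assume a: "a = ennreal r" "0 \<le> r" and b: "b = ennreal s" "0 \<le> s"
  have "(r + s)^2 + (max 0 (s - r))^2 \<le> 2 * r^2 + 2 * s^2"
  proof (cases "r \<le> s")
    case False
    then show ?thesis using zero_le_square[of "r - s"] by (simp add: power2_eq_square algebra_simps)
  qed (simp add: power2_eq_square algebra_simps)
  moreover have "b - a = ennreal (max 0 (s - r))"
    using a b by (simp add: ennreal_minus max_def ennreal_neg)
  ultimately show ?thesis using a b
    by (simp add: ennreal_power del: ennreal_max_0 ennreal_max_0' flip: ennreal_plus ennreal_numeral ennreal_mult)
qed (auto simp: ennreal_mult_top power2_eq_square ennreal_top_mult)

text \<open>Young's inequality with a weight on \<open>a\<close> as close to 1 as desired: the cost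
  of a slightly perturbed near-minimizer has to stay near the capacity, and the constant 2 would be
  too coarse.\<close>

lemma ennreal_add_power2_le:
  assumes "0 < \<theta>"
  shows "(a + b)^2 \<le> ennreal (1 + \<theta>) * a^2 + ennreal (1 + 1/\<theta>) * b^2"
proof (cases a; cases b)
  fix r s :: real assume a: "a = ennreal r" "0 \<le> r" and b: "b = ennreal s" "0 \<le> s"
  have "0 \<le> (\<theta> * r - s)^2 / \<theta>" using assms by simp
  also have "\<dots> = \<theta> * r^2 + (1/\<theta>) * s^2 - 2 * r * s"
    using assms by (simp add: power2_eq_square field_simps)
  finally have "(r + s)^2 \<le> (1 + \<theta>) * r^2 + (1 + 1/\<theta>) * s^2"
    by (simp add: power2_eq_square algebra_simps)
  then show ?thesis using a b assms
    by (simp add: ennreal_power flip: ennreal_plus ennreal_mult)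
qed (use assms in \<open>auto simp: power2_eq_square ennreal_mult_top ennreal_top_mult add_pos_pos\<close>)

lemma ennreal_half_power2: "4 * (x / 2)^2 = (x::ennreal)^2"
proof (cases x)
  case (real r)
  then have "x / 2 = ennreal (r / 2)" by (simp add: divide_ennreal flip: ennreal_numeral)
  then show ?thesis using real
    by (simp add: ennreal_power power_divide flip: ennreal_mult ennreal_numeral)
qed (simp add: ennreal_top_divide ennreal_mult_top)

lemma ennreal_power2_add_le: "(a + b)^2 \<le> 2 * a^2 + 2 * (b::ennreal)^2"
  by (rule order_trans[OF _ ennreal_parallelogram_le]) simp

text \<open>Geometric weights take the place of Minkowski's inequality; they are harmless when the
  squared norms of the terms decay like \<open>1/4^j\<close>.\<close>

lemma ennreal_power2_sum_le: "(\<Sum>j<n. D j)^2 \<le> (\<Sum>j<n. 2^(Suc j) * (D j :: ennreal)^2)"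
proof (induction n arbitrary: D)
  case (Suc n)
  have "(\<Sum>j<Suc n. D j)^2 = (D 0 + (\<Sum>j<n. D (Suc j)))^2" by (simp only: sum.lessThan_Suc_shift)
  also have "\<dots> \<le> 2 * (D 0)^2 + 2 * (\<Sum>j<n. D (Suc j))^2" by (rule ennreal_power2_add_le)
  also have "\<dots> \<le> 2 * (D 0)^2 + 2 * (\<Sum>j<n. 2^(Suc j) * (D (Suc j))^2)"
    by (intro add_left_mono mult_left_mono Suc) simp
  also have "\<dots> = (\<Sum>j<Suc n. 2^(Suc j) * (D j)^2)"
    by (subst sum.lessThan_Suc_shift) (simp add: sum_distrib_left mult.assoc)
  finally show ?case .
qed simp

lemma ennreal_power2_SUP_le:
  fixes H :: "nat \<Rightarrow> ennreal"
  assumes "incseq H"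
  shows "(SUP j. H j)^2 \<le> (SUP j. (H j)^2)"
proof -
  have "(SUP j. H j)^2 = (SUP i. SUP j. H i * H j)"
    unfolding power2_eq_square by (subst SUP_mult_right_ennreal, subst SUP_mult_left_ennreal) simp
  also have "\<dots> \<le> (SUP j. (H j)^2)"
  proof (intro SUP_least)
    fix i j
    have "H i \<le> H (max i j)" "H j \<le> H (max i j)" using assms by (auto simp: incseq_def)
    then have "H i * H j \<le> (H (max i j))^2" unfolding power2_eq_square by (intro mult_mono) auto
    also have "\<dots> \<le> (SUP j. (H j)^2)" by (rule SUP_upper) simp
    finally show "H i * H j \<le> (SUP j. (H j)^2)" .
  qed
  finally show ?thesis .
qed

text \<open>The axioms are what the parallelogram argument uses: half sums and countable suprema
  stay admissible. The threshold is strict because strict superlevel sets of lower semicontinuous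
  potentials are open.\<close>

locale l2_capacity =
  fixes M :: "'w measure" and L :: "('w \<Rightarrow> ennreal) set" and V :: "('w \<Rightarrow> ennreal) \<Rightarrow> 'y \<Rightarrow> ennreal"
  assumes measurable_L: "F \<in> L \<Longrightarrow> F \<in> borel_measurable M"
    and avg_L: "F \<in> L \<Longrightarrow> G \<in> L \<Longrightarrow> (\<lambda>w. (F w + G w) / 2) \<in> L"
    and SUP_L: "(\<And>n. H n \<in> L) \<Longrightarrow> (\<lambda>w. SUP n::nat. H n w) \<in> L"
    and V_mono: "F \<in> L \<Longrightarrow> G \<in> L \<Longrightarrow> (\<And>w. F w \<le> G w) \<Longrightarrow> V F y \<le> V G y"
    and V_avg: "F \<in> L \<Longrightarrow> G \<in> L \<Longrightarrow> 1 < V F y \<Longrightarrow> 1 < V G y \<Longrightarrow> 1 < V (\<lambda>w. (F w + G w) / 2) y"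
begin

definition cap :: "'y set \<Rightarrow> ennreal" where
  "cap A = (INF F \<in> {F \<in> L. \<forall>y\<in>A. 1 < V F y}. \<integral>\<^sup>+w. (F w)^2 \<partial>M)"

lemma cap_le: "F \<in> L \<Longrightarrow> (\<And>y. y \<in> A \<Longrightarrow> 1 < V F y) \<Longrightarrow> cap A \<le> (\<integral>\<^sup>+w. (F w)^2 \<partial>M)"
  unfolding cap_def by (rule INF_lower) blast

lemma cap_lessE:
  assumes "cap A < r"
  obtains F where "F \<in> L" "\<And>y. y \<in> A \<Longrightarrow> 1 < V F y" "(\<integral>\<^sup>+w. (F w)^2 \<partial>M) < r"
  using assms unfolding cap_def INF_less_iff by auto

lemma cap_mono: "A \<subseteq> B \<Longrightarrow> cap A \<le> cap B"
  unfolding cap_def by (rule INF_superset_mono) auto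

text \<open>The midpoint of two admissible functions is admissible, so its cost is at least
  \<open>cap A\<close>, and the parallelogram law leaves for the difference only the excess of the
  two costs. In the bound, \<open>4 * e\<close> comes from the costs and \<open>4 * e\<close> from
  \<open>c \<le> cap A + e\<close>.\<close>

lemma l2_dist_near_minimizers:
  assumes F: "F \<in> L" "\<And>y. y \<in> A \<Longrightarrow> 1 < V F y" "(\<integral>\<^sup>+w. (F w)^2 \<partial>M) \<le> c + e"
    and G: "G \<in> L" "\<And>y. y \<in> A \<Longrightarrow> 1 < V G y" "(\<integral>\<^sup>+w. (G w)^2 \<partial>M) \<le> c + e"
    and c: "c \<le> cap A + e" "c < \<top>"
  shows "(\<integral>\<^sup>+w. (G w - F w)^2 \<partial>M) \<le> 8 * e"
proof -
  note [measurable] = measurable_L[OF F(1)] measurable_L[OF G(1)]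
  have "cap A \<le> (\<integral>\<^sup>+w. ((F w + G w) / 2)^2 \<partial>M)"
    by (intro cap_le avg_L F(1) G(1) V_avg F(2) G(2))
  then have "4 * cap A \<le> 4 * (\<integral>\<^sup>+w. ((F w + G w) / 2)^2 \<partial>M)" by (rule mult_left_mono) simp
  also have "\<dots> = (\<integral>\<^sup>+w. 4 * ((F w + G w) / 2)^2 \<partial>M)" by (subst nn_integral_cmult) auto
  also have "\<dots> = (\<integral>\<^sup>+w. (F w + G w)^2 \<partial>M)" by (simp only: ennreal_half_power2)
  finally have A: "4 * cap A \<le> (\<integral>\<^sup>+w. (F w + G w)^2 \<partial>M)" .
  have "4 * c + (\<integral>\<^sup>+w. (G w - F w)^2 \<partial>M) \<le> 4 * (cap A + e) + (\<integral>\<^sup>+w. (G w - F w)^2 \<partial>M)"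
    by (intro add_mono mult_left_mono c) auto
  also have "\<dots> \<le> ((\<integral>\<^sup>+w. (F w + G w)^2 \<partial>M) + (\<integral>\<^sup>+w. (G w - F w)^2 \<partial>M)) + 4 * e"
    using A by (simp add: distrib_left add_ac add_left_mono)
  also have "(\<integral>\<^sup>+w. (F w + G w)^2 \<partial>M) + (\<integral>\<^sup>+w. (G w - F w)^2 \<partial>M) = (\<integral>\<^sup>+w. (F w + G w)^2 + (G w - F w)^2 \<partial>M)"
    by (subst nn_integral_add) auto
  also have "\<dots> \<le> (\<integral>\<^sup>+w. 2 * (F w)^2 + 2 * (G w)^2 \<partial>M)"
    by (intro nn_integral_mono ennreal_parallelogram_le)
  also have "\<dots> = 2 * (\<integral>\<^sup>+w. (F w)^2 \<partial>M) + 2 * (\<integral>\<^sup>+w. (G w)^2 \<partial>M)"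
    by (simp add: nn_integral_add nn_integral_cmult)
  also have "\<dots> \<le> 2 * (c + e) + 2 * (c + e)" by (intro add_mono mult_left_mono F G) auto
  also have "\<dots> + 4 * e = 4 * c + 8 * e"
  proof -
    have "2 * (c + e) + 2 * (c + e) + 4 * e = (2 + 2) * c + (2 + 2 + 4) * e"
      by (simp only: distrib_left distrib_right add_ac)
    then show ?thesis by simp
  qed
  finally have "4 * c + (\<integral>\<^sup>+w. (G w - F w)^2 \<partial>M) \<le> 4 * c + 8 * e" by (simp add: add_right_mono)
  then show ?thesis using c(2) by (auto simp: ennreal_add_left_cancel_le ennreal_mult_eq_top_iff)
qed


text \<open>The supremum of near-minimizers \<open>F j\<close> is admissible for the union. Its cost
  stays under control because it lies below \<open>F 0\<close> plus all positive increments, and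
  near-minimizers of nested sets with almost equal capacity differ little in L2.\<close>

lemma cap_incseq:
  assumes A: "incseq A" and bound: "\<And>n. cap (A n) \<le> ennreal d"
  shows "cap (\<Union>n. A n) \<le> ennreal d"
proof (rule ennreal_le_epsilon)
  fix \<epsilon> :: real assume eps: "0 < \<epsilon>"
  define c where "c = (SUP n. cap (A n))"
  have cd: "c \<le> ennreal d" unfolding c_def by (rule SUP_least) (rule bound)
  then have ctop: "c < \<top>" by (rule le_less_trans) simp
  then obtain r where r: "c = ennreal r" "0 \<le> r" by (cases c) auto
  \<comment> \<open>The error is split into thirds: the inflation of the cost of \<open>F 0\<close>
    by \<theta>, the excess \<open>\<delta> 0\<close>, and the increments multiplied by the large
    constant \<open>K\<close>.\<close>
  define \<theta> where "\<theta> = \<epsilon> / (3 * (r + 1))"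
  have th: "0 < \<theta>" using eps r(2) by (simp add: \<theta>_def)
  define K where "K = 1 + 1/\<theta>"
  have K: "0 < K" using th by (simp add: K_def add_pos_pos)
  define \<eta> where "\<eta> = min 1 (min (\<epsilon> / 3) (\<epsilon> / (3 * K)))"
  have eta: "0 < \<eta>" "\<eta> \<le> 1" "\<eta> \<le> \<epsilon>/3" "\<eta> \<le> \<epsilon> / (3 * K)" using eps K by (auto simp: \<eta>_def)
  have eta': "K * \<eta> \<le> \<epsilon> / 3"
    using eta(4) K by (simp add: field_simps)
  \<comment> \<open>Tuned so that
    \<open>2^(Suc j) * (8 * \<delta> j) = \<eta> / 2 * (1/2)^j\<close>: the weight of increment
    \<open>j\<close> times the bound for its squared norm.\<close>
  define \<delta> where "\<delta> j = \<eta> / 32 / 4^j" for j :: nat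
  have dpos: "0 < \<delta> j" for j using eta by (simp add: \<delta>_def)
  have dmono: "\<delta> (Suc j) \<le> \<delta> j" for j using eta(1) by (simp add: \<delta>_def field_simps)
  have ex: "\<exists>n F. j \<le> n \<and> (\<forall>m\<ge>n. c \<le> cap (A m) + ennreal (\<delta> j)) \<and> F \<in> L \<and> (\<forall>y\<in>A n. 1 < V F y) \<and>
      (\<integral>\<^sup>+w. (F w)^2 \<partial>M) \<le> c + ennreal (\<delta> j)" for j
  proof -
    obtain n0 where n0: "c \<le> cap (A n0) + ennreal (\<delta> j)"
    proof (cases "c = 0")
      case False
      then have "c - ennreal (\<delta> j) < c" using dpos[of j] ctop by (intro ennreal_between) (auto simp: zero_less_iff_neq_zero)
      then obtain n0 where "c - ennreal (\<delta> j) < cap (A n0)" unfolding c_def less_SUP_iff by auto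
      then have "c - ennreal (\<delta> j) \<le> cap (A n0)" by simp
      then have "c \<le> cap (A n0) + ennreal (\<delta> j)"
        using ctop by (subst (asm) ennreal_minus_le_iff) (auto simp: add.commute)
      then show ?thesis by (rule that)
    qed (use that in simp)
    define n where "n = max n0 j"
    have "cap (A n) < c + ennreal (\<delta> j)"
    proof -
      have "cap (A n) \<le> c" unfolding c_def by (rule SUP_upper) simp
      also have "c < c + ennreal (\<delta> j)" using ctop dpos[of j] r by (simp flip: ennreal_plus add: ennreal_less_iff)
      finally show ?thesis .
    qed
    then obtain F where "F \<in> L" "\<And>y. y \<in> A n \<Longrightarrow> 1 < V F y" "(\<integral>\<^sup>+w. (F w)^2 \<partial>M) < c + ennreal (\<delta> j)"
      by (rule cap_lessE) blast
    moreover have "c \<le> cap (A m) + ennreal (\<delta> j)" if "n \<le> m" for m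
    proof -
      have "cap (A n0) \<le> cap (A m)" using that A by (intro cap_mono) (auto simp: n_def incseq_def)
      with n0 show ?thesis by (meson add_right_mono order_trans)
    qed
    ultimately show ?thesis by (intro exI[of _ n] exI[of _ F]) (auto simp: n_def)
  qed
  from choice[OF allI[OF ex]] obtain N where "\<forall>j. \<exists>F. j \<le> N j \<and> (\<forall>m\<ge>N j. c \<le> cap (A m) + ennreal (\<delta> j)) \<and> F \<in> L \<and>
      (\<forall>y\<in>A (N j). 1 < V F y) \<and> (\<integral>\<^sup>+w. (F w)^2 \<partial>M) \<le> c + ennreal (\<delta> j)" by (rule exE)
  from choice[OF this] obtain F where NF: "\<forall>j. j \<le> N j \<and> (\<forall>m\<ge>N j. c \<le> cap (A m) + ennreal (\<delta> j)) \<and> F j \<in> L \<and>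
      (\<forall>y\<in>A (N j). 1 < V (F j) y) \<and> (\<integral>\<^sup>+w. (F j w)^2 \<partial>M) \<le> c + ennreal (\<delta> j)" by (rule exE)
  then have N: "\<And>j. j \<le> N j" "\<And>j m. N j \<le> m \<Longrightarrow> c \<le> cap (A m) + ennreal (\<delta> j)"
    and F: "\<And>j. F j \<in> L" "\<And>j y. y \<in> A (N j) \<Longrightarrow> 1 < V (F j) y"
      "\<And>j. (\<integral>\<^sup>+w. (F j w)^2 \<partial>M) \<le> c + ennreal (\<delta> j)"
    by simp_all
  have [measurable]: "F j \<in> borel_measurable M" for j by (rule measurable_L[OF F(1)])
  define D where "D j w = F (Suc j) w - F j w" for j w
  have [measurable]: "D j \<in> borel_measurable M" for j unfolding D_def by measurable
  have D: "(\<integral>\<^sup>+w. (D j w)^2 \<partial>M) \<le> 8 * ennreal (\<delta> j)" for j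
    unfolding D_def
  \<comment> \<open>\<open>N\<close> need not be monotone, so \<open>F j\<close> and
    \<open>F (Suc j)\<close> are compared on the smaller of their two sets.\<close>
  proof (rule l2_dist_near_minimizers[where A="A (min (N j) (N (Suc j)))" and c=c])
    have le: "ennreal (\<delta> (Suc j)) \<le> ennreal (\<delta> j)" using dmono by (rule ennreal_leI)
    show "1 < V (F j) y" "1 < V (F (Suc j)) y" if "y \<in> A (min (N j) (N (Suc j)))" for y
      using that A F(2)[of y j] F(2)[of y "Suc j"]
      by (auto simp: incseq_def) (meson min.cobounded1 min.cobounded2 subsetD)+
    show "(\<integral>\<^sup>+w. (F (Suc j) w)^2 \<partial>M) \<le> c + ennreal (\<delta> j)"
      using F(3)[of "Suc j"] le by (meson add_left_mono order_trans)
    show "c \<le> cap (A (min (N j) (N (Suc j)))) + ennreal (\<delta> j)"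
      using N(2)[of j "N j"] N(2)[of "Suc j" "N (Suc j)"] le
      by (auto simp: min_def intro: order_trans[OF _ add_left_mono])
  qed (use F ctop in auto)
  \<comment> \<open>Truncated differences telescope only as an upper bound; the outcome is an
    increasing majorant of the sequence \<open>F n\<close>, to which monotone convergence
    applies.\<close>
  define H where "H n w = F 0 w + (\<Sum>j<n. D j w)" for n w
  have [measurable]: "H n \<in> borel_measurable M" for n unfolding H_def by measurable
  have FH: "F n w \<le> H n w" for n w
  proof (induction n)
    case (Suc n)
    have "F (Suc n) w \<le> F n w + D n w" unfolding D_def
      by (cases "F n w \<le> F (Suc n) w") (auto simp: add_diff_inverse_ennreal intro: add_increasing2)
    also have "\<dots> \<le> H n w + D n w" using Suc by (rule add_right_mono)
    finally show ?case by (simp add: H_def add.assoc)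
  qed (simp add: H_def)
  have incH: "incseq (\<lambda>n. H n w)" for w
    by (rule incseq_SucI) (simp add: H_def add_left_mono)
  have H2: "(\<integral>\<^sup>+w. (H n w)^2 \<partial>M) \<le> c + ennreal \<epsilon>" for n
  proof -
    have "(\<integral>\<^sup>+w. (\<Sum>j<n. D j w)^2 \<partial>M) \<le> (\<integral>\<^sup>+w. (\<Sum>j<n. 2^(Suc j) * (D j w)^2) \<partial>M)"
      by (intro nn_integral_mono ennreal_power2_sum_le)
    also have "\<dots> = (\<Sum>j<n. 2^(Suc j) * (\<integral>\<^sup>+w. (D j w)^2 \<partial>M))"
      by (subst nn_integral_sum) (auto simp: nn_integral_cmult)
    also have "\<dots> \<le> (\<Sum>j<n. 2^(Suc j) * (8 * ennreal (\<delta> j)))"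
      by (intro sum_mono mult_left_mono D) auto
    also have "\<dots> = (\<Sum>j<n. ennreal (\<eta> / 2 * (1/2)^j))"
    proof (rule sum.cong)
      fix j
      have "2^(Suc j) * (8 * ennreal (\<delta> j)) = ennreal (2^(Suc j) * (8 * \<delta> j))"
        using dpos[of j] by (simp add: ennreal_mult ennreal_power del: power_Suc flip: ennreal_numeral)
      also have "2^(Suc j) * (8 * \<delta> j) = \<eta> / 2 * (1/2)^j"
        by (simp add: \<delta>_def power_divide field_simps) (simp add: power_mult_distrib[symmetric])
      finally show "2^(Suc j) * (8 * ennreal (\<delta> j)) = ennreal (\<eta> / 2 * (1/2)^j)" .
    qed simp
    also have "\<dots> = ennreal (\<Sum>j<n. \<eta> / 2 * (1/2)^j)" using eta(1) by (subst sum_ennreal) auto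
    also have "\<dots> \<le> ennreal \<eta>"
    proof (rule ennreal_leI)
      have "(\<Sum>j<n. \<eta> / 2 * (1/2)^j) = \<eta> / 2 * ((1 - (1/2)^n) / (1 - 1/2))"
        by (subst sum_distrib_left[symmetric]) (simp add: sum_gp_strict)
      also have "\<dots> = \<eta> * (1 - (1/2)^n)" by simp
      also have "\<dots> \<le> \<eta> * 1" using eta(1) by (intro mult_left_mono) auto
      finally show "(\<Sum>j<n. \<eta> / 2 * (1/2)^j) \<le> \<eta>" by simp
    qed
    finally have S: "(\<integral>\<^sup>+w. (\<Sum>j<n. D j w)^2 \<partial>M) \<le> ennreal \<eta>" .
    have "(\<integral>\<^sup>+w. (H n w)^2 \<partial>M) \<le>
        (\<integral>\<^sup>+w. ennreal (1 + \<theta>) * (F 0 w)^2 + ennreal K * (\<Sum>j<n. D j w)^2 \<partial>M)"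
      unfolding H_def K_def by (intro nn_integral_mono ennreal_add_power2_le th)
    also have "\<dots> = ennreal (1 + \<theta>) * (\<integral>\<^sup>+w. (F 0 w)^2 \<partial>M) + ennreal K * (\<integral>\<^sup>+w. (\<Sum>j<n. D j w)^2 \<partial>M)"
      by (simp add: nn_integral_add nn_integral_cmult)
    also have "\<dots> \<le> ennreal (1 + \<theta>) * (c + ennreal (\<delta> 0)) + ennreal K * ennreal \<eta>"
      by (intro add_mono mult_left_mono S F(3)) auto
    also have "\<dots> = ennreal ((1 + \<theta>) * (r + \<delta> 0) + K * \<eta>)"
      using r th K eta(1) dpos[of 0] by (simp add: ennreal_mult ennreal_plus)
    also have "\<dots> \<le> ennreal (r + \<epsilon>)"
    proof (rule ennreal_leI)
      have d0: "\<delta> 0 \<le> \<eta>" "\<delta> 0 \<le> 1" using eta by (auto simp: \<delta>_def)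
      have "(1 + \<theta>) * (r + \<delta> 0) = r + \<delta> 0 + \<theta> * (r + \<delta> 0)" by (simp add: algebra_simps)
      also have "\<theta> * (r + \<delta> 0) \<le> \<theta> * (r + 1)" using th d0 by (intro mult_left_mono) auto
      also have "\<theta> * (r + 1) = \<epsilon> / 3" using r(2) by (simp add: \<theta>_def field_simps)
      finally show "(1 + \<theta>) * (r + \<delta> 0) + K * \<eta> \<le> r + \<epsilon>"
        using eta' eta(3) d0 by linarith
    qed
    finally show ?thesis using r eps by simp
  qed
  define F' where "F' w = (SUP n. F n w)" for w
  have F': "F' \<in> L" unfolding F'_def by (rule SUP_L) (rule F)
  have "cap (\<Union>n. A n) \<le> (\<integral>\<^sup>+w. (F' w)^2 \<partial>M)"
  proof (rule cap_le[OF F'])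
    fix y assume "y \<in> (\<Union>n. A n)"
    then obtain n where "y \<in> A n" by blast
    then have "y \<in> A (N n)" using A N(1)[of n] by (auto simp: incseq_def)
    then have "1 < V (F n) y" by (rule F(2))
    also have "\<dots> \<le> V F' y" by (rule V_mono[OF F(1) F']) (unfold F'_def, rule SUP_upper, simp)
    finally show "1 < V F' y" .
  qed
  also have "\<dots> \<le> (\<integral>\<^sup>+w. (SUP n. (H n w)^2) \<partial>M)"
  proof (rule nn_integral_mono)
    fix w
    have "F' w \<le> (SUP n. H n w)" unfolding F'_def by (rule SUP_mono') (rule FH)
    then have "(F' w)^2 \<le> (SUP n. H n w)^2" by (rule power_mono) simp
    also have "\<dots> \<le> (SUP n. (H n w)^2)" by (rule ennreal_power2_SUP_le[OF incH])
    finally show "(F' w)^2 \<le> (SUP n. (H n w)^2)" .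
  qed
  also have "\<dots> = (SUP n. \<integral>\<^sup>+w. (H n w)^2 \<partial>M)"
    by (rule nn_integral_monotone_convergence_SUP)
       (use incH in \<open>auto simp: incseq_def le_fun_def intro!: power_mono\<close>)
  also have "\<dots> \<le> c + ennreal \<epsilon>" by (rule SUP_least) (rule H2)
  also have "\<dots> \<le> ennreal d + ennreal \<epsilon>" using cd by (rule add_right_mono)
  finally show "cap (\<Union>n. A n) \<le> ennreal d + ennreal \<epsilon>" .
qed

end

lemma l2_capacity_baire_null:
  fixes V :: "('w \<Rightarrow> ennreal) \<Rightarrow> (nat \<Rightarrow> nat) \<Rightarrow> ennreal"
  assumes "l2_capacity M L V"
    and op: "\<And>F. F \<in> L \<Longrightarrow> open {y. 1 < V F y}"
    and box: "\<And>b e. 0 < e \<Longrightarrow> \<exists>F\<in>L. (\<forall>y\<in>baire_box b. 1 < V F y) \<and> (\<integral>\<^sup>+w. (F w)^2 \<partial>M) \<le> ennreal e"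
    and e: "0 < e"
  shows "\<exists>F\<in>L. (\<forall>y. 1 < V F y) \<and> (\<integral>\<^sup>+w. (F w)^2 \<partial>M) < ennreal e"
proof (rule ccontr)
  interpret l2_capacity M L V by fact
  assume neg: "\<not> ?thesis"
  have "cap UNIV \<ge> ennreal e"
    using neg by (intro leI notI, elim cap_lessE) blast
  \<comment> \<open>Half of \<open>e\<close> is kept in reserve: the cylinders will have capacity
    above \<open>e/2\<close>, while the box admits a function of cost at most
    \<open>e/2\<close>.\<close>
  moreover have "ennreal (e/2) < ennreal e" using e by (simp add: ennreal_less_iff)
  ultimately have "ennreal (e/2) < cap UNIV" by (rule less_le_trans[rotated])
  moreover have "\<exists>n. ennreal (e/2) < cap (A n)"
    if "incseq A" "ennreal (e/2) < cap (\<Union>n. A n)" for A :: "nat \<Rightarrow> (nat \<Rightarrow> nat) set"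
    using cap_incseq[of A "e/2"] that by (meson not_le)
  ultimately obtain b where b: "\<And>m. ennreal (e/2) < cap (baire_cyl b m)"
    using baire_box_capacitable[of "\<lambda>A. ennreal (e/2) < cap A"] by metis
  from box[of "e/2" b] e obtain F where F: "F \<in> L" "\<forall>y\<in>baire_box b. 1 < V F y" "(\<integral>\<^sup>+w. (F w)^2 \<partial>M) \<le> ennreal (e/2)"
    by auto
  from F(2) have "baire_box b \<subseteq> {y. 1 < V F y}" by blast
  then obtain m where m: "baire_cyl b m \<subseteq> {y. 1 < V F y}"
    by (rule baire_cyl_subset_open[OF op[OF F(1)]])
  have "cap (baire_cyl b m) \<le> (\<integral>\<^sup>+w. (F w)^2 \<partial>M)" using m by (intro cap_le F) auto
  with F(3) b[of m] show False by (meson leD order_trans)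
qed

section \<open>Covers from lower bounds on energies\<close>

text \<open>First variation: shifting the fraction \<tau> of the mass of a near-minimizer to
  \<open>x\<close> changes its energy \<open>E\<close> to \<open>(1 - \<tau>)^2 * E + 2 * \<tau> *
  (1 - \<tau>) * P x + \<tau>^2 * \<phi> x x\<close>, where \<open>P\<close> is its potential. This
  cannot fall below the infimum, so \<open>P x\<close> is almost as large as the infimum. The
  infimum need not be attained; half of \<open>J\<close> pays for this and for the diagonal
  term.\<close>

lemma exists_potential_ge:
  fixes \<phi> :: "'a \<Rightarrow> 'a \<Rightarrow> real"
  assumes X: "X \<noteq> {}" and J: "0 < J"
    and sym: "\<And>x y. \<phi> x y = \<phi> y x" and nn: "\<And>x y. 0 \<le> \<phi> x y" and diag: "\<And>x. x \<in> X \<Longrightarrow> \<phi> x x \<le> D"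
    and energy: "\<And>S m. finite S \<Longrightarrow> S \<subseteq> X \<Longrightarrow> (\<And>x. 0 \<le> m x) \<Longrightarrow> (\<Sum>x\<in>S. m x) = 1 \<Longrightarrow>
       J \<le> (\<Sum>x\<in>S. \<Sum>y\<in>S. m x * m y * \<phi> x y)"
  shows "\<exists>S m. finite S \<and> S \<subseteq> X \<and> (\<forall>x. 0 \<le> m x) \<and> (\<Sum>x\<in>S. m x) = 1 \<and>
       (\<forall>x\<in>X. J / 2 \<le> (\<Sum>y\<in>S. m y * \<phi> x y))"
proof -
  define E where "E S m = (\<Sum>x\<in>S. \<Sum>y\<in>S. m x * m y * \<phi> x y)" for S and m :: "'a \<Rightarrow> real"
  define A where "A = {(S, m :: 'a \<Rightarrow> real). finite S \<and> S \<subseteq> X \<and> (\<forall>x. 0 \<le> m x) \<and> (\<forall>x. x \<notin> S \<longrightarrow> m x = 0) \<and> (\<Sum>x\<in>S. m x) = 1}"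
  define I where "I = (INF (S, m)\<in>A. E S m)"
  obtain x0 where x0: "x0 \<in> X" using X by blast
  have A0: "({x0}, \<lambda>x. if x = x0 then 1 else 0) \<in> A" using x0 by (auto simp: A_def)
  have EJ: "J \<le> E S m" if "(S, m) \<in> A" for S m
    using energy[of S m] that by (auto simp: A_def E_def)
  have bdd: "bdd_below ((\<lambda>(S, m). E S m) ` A)" using EJ by (intro bdd_belowI[of _ J]) auto
  have IJ: "J \<le> I" unfolding I_def using A0 EJ by (intro cINF_greatest) auto
  have D: "0 \<le> D" using diag[OF x0] nn[of x0 x0] by linarith
  \<comment> \<open>Small enough that the diagonal term is at most \<open>\<tau> * (J / 4)\<close>;
    the bound 1/2 keeps \<open>2 - \<tau>\<close> at least 3/2.\<close>
  define \<tau> where "\<tau> = min (1/2) (J / (4 * (D + 1)))"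
  have tau: "0 < \<tau>" using J D by (simp add: \<tau>_def)
  have tau_half: "\<tau> \<le> 1/2" unfolding \<tau>_def by (rule min.cobounded1)
  note tau = tau tau_half
  have "\<tau> \<le> J / (4 * (D + 1))" by (simp add: \<tau>_def)
  then have "\<tau> * (D + 1) \<le> J / 4" using D by (simp add: field_simps)
  then have tauD: "\<tau> * D \<le> J / 4" using tau by (simp add: algebra_simps)
  \<comment> \<open>The slack is proportional to \<tau>, so that only \<open>J / 4\<close> of it
    remains after division by \<tau>.\<close>
  have "I < I + \<tau> * J / 4" using tau J by simp
  then have "\<exists>x\<in>A. (case x of (S, m) \<Rightarrow> E S m) < I + \<tau> * J / 4"
    using cINF_less_iff[OF _ bdd, of "I + \<tau> * J / 4"] A0 unfolding I_def by blast
  then obtain S m where Sm: "(S, m) \<in> A" and EI: "E S m < I + \<tau> * J / 4" by auto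
  from Sm have S: "finite S" "S \<subseteq> X" "\<And>x. 0 \<le> m x" "\<And>x. x \<notin> S \<Longrightarrow> m x = 0" "(\<Sum>x\<in>S. m x) = 1"
    by (auto simp: A_def)
  have "J / 2 \<le> (\<Sum>y\<in>S. m y * \<phi> x y)" if x: "x \<in> X" for x
  proof -
    define S' where "S' = insert x S"
    define m' where "m' y = (1 - \<tau>) * m y + (if y = x then \<tau> else 0)" for y
    define P where "P z = (\<Sum>y\<in>S. m y * \<phi> z y)" for z
    have fin: "finite S'" using S by (simp add: S'_def)
    have sumS: "(\<Sum>y\<in>S'. m y * g y) = (\<Sum>y\<in>S. m y * g y)" for g
      using S by (intro sum.mono_neutral_right) (auto simp: S'_def)
    have sum': "(\<Sum>y\<in>S'. m' y * g y) = (1 - \<tau>) * (\<Sum>y\<in>S. m y * g y) + \<tau> * g x" for g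
    proof -
      have "(\<Sum>y\<in>S'. m' y * g y) = (\<Sum>y\<in>S'. (1 - \<tau>) * (m y * g y) + (if y = x then \<tau> * g y else 0))"
        by (intro sum.cong) (auto simp: m'_def algebra_simps)
      also have "\<dots> = (1 - \<tau>) * (\<Sum>y\<in>S'. m y * g y) + \<tau> * g x"
        using fin by (simp add: sum.distrib sum_distrib_left[symmetric] S'_def)
      finally show ?thesis by (simp add: sumS)
    qed
    have "(S', m') \<in> A"
      using S x tau sum'[of "\<lambda>_. 1"] by (auto simp: A_def S'_def m'_def)
    then have "I \<le> E S' m'" unfolding I_def using cINF_lower[OF bdd, of "(S', m')"] by simp
    also have "E S' m' = (\<Sum>z\<in>S'. m' z * (\<Sum>y\<in>S'. m' y * \<phi> z y))"
      by (simp add: E_def sum_distrib_left mult.assoc)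
    also have "\<dots> = (1 - \<tau>) * (\<Sum>z\<in>S. m z * ((1 - \<tau>) * P z + \<tau> * \<phi> z x)) + \<tau> * ((1 - \<tau>) * P x + \<tau> * \<phi> x x)"
      by (simp only: sum' P_def)
    also have "(\<Sum>z\<in>S. m z * ((1 - \<tau>) * P z + \<tau> * \<phi> z x)) = (1 - \<tau>) * (\<Sum>z\<in>S. m z * P z) + \<tau> * P x"
      by (simp add: P_def sum.distrib sum_distrib_left distrib_left mult_ac sym[of x])
    also have "(\<Sum>z\<in>S. m z * P z) = E S m"
      by (simp add: E_def P_def sum_distrib_left mult.assoc)
    finally have main: "I \<le> (1 - \<tau>)^2 * E S m + 2 * \<tau> * (1 - \<tau>) * P x + \<tau>^2 * \<phi> x x"
      by (simp add: power2_eq_square algebra_simps)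
    have P0: "0 \<le> P x" unfolding P_def using S nn by (intro sum_nonneg) auto
    have "(1 - \<tau>)^2 * E S m \<le> (1 - \<tau>)^2 * (I + \<tau> * J / 4)" using EI by (intro mult_left_mono) auto
    also have "\<dots> = (1 - \<tau>)^2 * I + (1 - \<tau>)^2 * (\<tau> * J / 4)" by (simp add: algebra_simps)
    also have "(1 - \<tau>)^2 * (\<tau> * J / 4) \<le> 1 * (\<tau> * J / 4)"
      using tau J by (intro mult_right_mono) (auto simp: power_le_one)
    finally have 1: "(1 - \<tau>)^2 * E S m \<le> (1 - \<tau>)^2 * I + \<tau> * J / 4" by simp
    have 2: "2 * \<tau> * (1 - \<tau>) * P x \<le> \<tau> * (2 * P x)" using tau P0 by (simp add: algebra_simps)
    have "\<tau>^2 * \<phi> x x \<le> \<tau>^2 * D" using diag[OF x] by (intro mult_left_mono) auto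
    also have "\<dots> \<le> \<tau> * (J / 4)" unfolding power2_eq_square mult.assoc using tau tauD by (intro mult_left_mono) auto
    finally have 3: "\<tau>^2 * \<phi> x x \<le> \<tau> * (J / 4)" .
    have "\<tau> * (2 - \<tau>) * J \<le> \<tau> * (2 - \<tau>) * I" using IJ tau by (intro mult_left_mono) auto
    also have "\<dots> = I - (1 - \<tau>)^2 * I" by (simp add: power2_eq_square algebra_simps)
    also have "\<dots> \<le> \<tau> * J / 4 + \<tau> * (2 * P x) + \<tau> * (J / 4)" using main 1 2 3 by linarith
    also have "\<dots> = \<tau> * (J / 2 + 2 * P x)" by (simp add: algebra_simps)
    finally have "(2 - \<tau>) * J \<le> J / 2 + 2 * P x" using tau by (simp add: mult.assoc)
    moreover have "(3/2) * J \<le> (2 - \<tau>) * J" using tau J by (intro mult_right_mono) auto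
    ultimately show ?thesis by (simp add: P_def)
  qed
  with S show ?thesis by blast
qed

text \<open>If the ball of every scale \<open>l\<close> had mass below
  \<open>\<kappa> * 2 powr (- t' * l)\<close>, the potential would be below \<open>B\<close> plus
  \<open>B * \<kappa>\<close> times a geometric series of ratio \<open>2 powr (t - t')\<close>. The
  constant \<kappa> makes the second term \<open>J / 4\<close>, and \<open>4 * B \<le> J\<close>
  bounds the first by the same amount.\<close>

lemma exists_heavy_ball:
  fixes S :: "'a::metric_space set" and t t' \<alpha> B J :: real and f m :: "'a \<Rightarrow> real"
  assumes t: "t < t'" and B: "0 < B" and J: "4 * B \<le> J" and m: "\<And>y. 0 \<le> m y" "finite S" "(\<Sum>y\<in>S. m y) = 1"
    and K: "\<And>y. y \<in> S \<Longrightarrow> f y \<le> B * (1 + (\<Sum>l\<le>N. 2 powr (t * l) * of_bool (dist x y powr \<alpha> \<le> 2 powr - real l)))"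
    and pot: "J / 2 \<le> (\<Sum>y\<in>S. m y * f y)"
  shows "\<exists>l\<le>N. J * (1 - 2 powr (t - t')) / (4 * B) * 2 powr (- t' * l) \<le> (\<Sum>y\<in>{y\<in>S. dist x y powr \<alpha> \<le> 2 powr - real l}. m y)"
proof (rule ccontr)
  define \<kappa> where "\<kappa> = J * (1 - 2 powr (t - t')) / (4 * B)"
  define Q where "Q l = (\<Sum>y\<in>{y\<in>S. dist x y powr \<alpha> \<le> 2 powr - real l}. m y)" for l :: nat
  have q: "0 < 2 powr (t - t')" "2 powr (t - t') < 1" using t by (auto simp: powr_less_one)
  have kpos: "0 < \<kappa>" using q B J by (simp add: \<kappa>_def)
  assume "\<not> ?thesis"
  then have less: "Q l < \<kappa> * 2 powr (- t' * l)" if "l \<le> N" for l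
    using that by (fastforce simp: \<kappa>_def Q_def)
  have "(\<Sum>y\<in>S. m y * f y) \<le> (\<Sum>y\<in>S. m y * (B * (1 + (\<Sum>l\<le>N. 2 powr (t * l) * of_bool (dist x y powr \<alpha> \<le> 2 powr - real l)))))"
    by (intro sum_mono mult_left_mono K m)
  also have "\<dots> = B * (\<Sum>y\<in>S. m y) + B * (\<Sum>y\<in>S. \<Sum>l\<le>N. 2 powr (t * l) * (m y * of_bool (dist x y powr \<alpha> \<le> 2 powr - real l)))"
    by (simp add: sum_distrib_left sum.distrib algebra_simps del: sum_mult_of_bool_eq sum_of_bool_mult_eq)
  also have "(\<Sum>y\<in>S. \<Sum>l\<le>N. 2 powr (t * l) * (m y * of_bool (dist x y powr \<alpha> \<le> 2 powr - real l))) = (\<Sum>l\<le>N. 2 powr (t * l) * Q l)"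
  proof (subst sum.swap, rule sum.cong[OF refl])
    fix l
    have "Q l = (\<Sum>y\<in>S. m y * of_bool (dist x y powr \<alpha> \<le> 2 powr - real l))"
      unfolding Q_def sum.inter_filter[OF m(2)] by (intro sum.cong) auto
    then show "(\<Sum>y\<in>S. 2 powr (t * l) * (m y * of_bool (dist x y powr \<alpha> \<le> 2 powr - real l))) = 2 powr (t * l) * Q l"
      by (simp only: sum_distrib_left)
  qed
  also have "(\<Sum>l\<le>N. 2 powr (t * l) * Q l) < (\<Sum>l\<le>N. \<kappa> * (2 powr (t - t'))^l)"
  proof (rule sum_strict_mono)
    fix l assume "l \<in> {..N}"
    then have "2 powr (t * l) * Q l < 2 powr (t * l) * (\<kappa> * 2 powr (- t' * l))" using less by (intro mult_strict_left_mono) auto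
    also have "\<dots> = \<kappa> * (2 powr (t - t'))^l"
      by (simp add: powr_realpow[symmetric] powr_powr powr_add[symmetric] algebra_simps)
    finally show "2 powr (t * l) * Q l < \<kappa> * (2 powr (t - t'))^l" .
  qed auto
  also have "(\<Sum>l\<le>N. \<kappa> * (2 powr (t - t'))^l) = \<kappa> * ((1 - (2 powr (t - t'))^(Suc N)) / (1 - 2 powr (t - t')))"
    using q t by (subst sum_distrib_left[symmetric]) (simp add: sum_gp0)
  also have "\<dots> \<le> \<kappa> * (1 / (1 - 2 powr (t - t')))"
    using q kpos by (intro mult_left_mono divide_right_mono) auto
  also have "\<dots> = J / (4 * B)" using q t by (simp add: \<kappa>_def)
  finally have "(\<Sum>y\<in>S. m y * f y) < B * (\<Sum>y\<in>S. m y) + B * (J / (4 * B))" using B by simp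
  also have "\<dots> = B + J / 4" using B m by simp
  finally show False using pot J by linarith
qed

text \<open>Vitali's argument: the \<open>r\<close>-balls around a \<open>2 * r\<close>-separated
  set are disjoint and heavy, so there are at most \<open>1/\<kappa>\<close> of them, and around a
  maximal such set the balls of radius \<open>2 * r\<close> cover \<open>T\<close>. The count
  depends on neither \<open>S\<close> nor \<open>m\<close>, which will vary from stage to
  stage.\<close>

lemma separated_cover:
  fixes T :: "'a::metric_space set" and m :: "'a \<Rightarrow> real" and \<kappa> r :: real
  assumes k: "0 < \<kappa>" and m: "\<And>y. 0 \<le> m y" "finite S" "(\<Sum>y\<in>S. m y) = 1" and r: "0 \<le> r"
    and heavy: "\<And>x. x \<in> T \<Longrightarrow> \<kappa> \<le> (\<Sum>y\<in>{y\<in>S. dist x y \<le> r}. m y)"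
  shows "\<exists>U :: nat \<Rightarrow> 'a set. T \<subseteq> (\<Union>j<nat \<lfloor>1/\<kappa>\<rfloor>. U j) \<and> (\<forall>j. \<forall>x\<in>U j. \<forall>y\<in>U j. dist x y \<le> 4 * r)"
proof -
  define sep where "sep P \<longleftrightarrow> finite P \<and> P \<subseteq> T \<and> (\<forall>x\<in>P. \<forall>y\<in>P. x \<noteq> y \<longrightarrow> 2 * r < dist x y)" for P
  have card: "card P \<le> nat \<lfloor>1/\<kappa>\<rfloor>" if "sep P" for P
  proof -
    have P: "finite P" "P \<subseteq> T" "\<And>x y. x \<in> P \<Longrightarrow> y \<in> P \<Longrightarrow> x \<noteq> y \<Longrightarrow> 2 * r < dist x y"
      using that by (auto simp: sep_def)
    have "card P * \<kappa> = (\<Sum>x\<in>P. \<kappa>)" by simp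
    also have "\<dots> \<le> (\<Sum>x\<in>P. \<Sum>y\<in>{y\<in>S. dist x y \<le> r}. m y)" using P heavy by (intro sum_mono) auto
    also have "\<dots> = (\<Sum>y\<in>(\<Union>x\<in>P. {y\<in>S. dist x y \<le> r}). m y)"
    proof (rule sum.UNION_disjoint[symmetric])
      have "x = z" if "x \<in> P" "z \<in> P" "dist x y \<le> r" "dist z y \<le> r" for x y z
      proof (rule ccontr)
        assume "x \<noteq> z"
        with P(3) that have "2 * r < dist x z" by blast
        then show False using that dist_triangle2[of x z y] by linarith
      qed
      then show "\<forall>i\<in>P. \<forall>j\<in>P. i \<noteq> j \<longrightarrow> {y \<in> S. dist i y \<le> r} \<inter> {y \<in> S. dist j y \<le> r} = {}" by blast
    qed (use P m in auto)
    also have "\<dots> \<le> (\<Sum>y\<in>S. m y)" using m by (intro sum_mono2) auto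
    finally have "real (card P) \<le> 1 / \<kappa>" using m k by (simp add: field_simps)
    then show ?thesis by (simp add: le_nat_floor)
  qed
  have "sep {}" by (simp add: sep_def)
  then obtain P where P: "sep P" and max: "\<And>Q. sep Q \<Longrightarrow> card Q \<le> card P"
    using ex_has_greatest_nat[of sep "{}" card "Suc (nat \<lfloor>1/\<kappa>\<rfloor>)"] card by (metis less_Suc_eq_le)
  have fP: "finite P" using P by (simp add: sep_def)
  then obtain h where h: "bij_betw h {..<card P} P" by (metis ex_bij_betw_nat_finite atLeast0LessThan)
  \<comment> \<open>Padding with empty sets makes the index range independent of the cardinality of
    \<open>P\<close>.\<close>
  define U where "U j = (if j < card P then cball (h j) (2 * r) else {})" for j
  have "T \<subseteq> (\<Union>j<nat \<lfloor>1/\<kappa>\<rfloor>. U j)"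
  proof
    fix x assume x: "x \<in> T"
    have "\<exists>p\<in>P. dist p x \<le> 2 * r"
    proof (rule ccontr)
      assume "\<not> ?thesis"
      then have far: "\<And>p. p \<in> P \<Longrightarrow> 2 * r < dist p x" by (meson not_le)
      then have "x \<notin> P" using r by fastforce
      moreover have "sep (insert x P)" using P far x by (auto simp: sep_def dist_commute)
      ultimately show False using max[of "insert x P"] fP by simp
    qed
    then obtain p where p: "p \<in> P" "dist p x \<le> 2 * r" by blast
    have "p \<in> h ` {..<card P}" using h p by (simp add: bij_betw_def)
    then obtain j where j: "j < card P" "h j = p" by fastforce
    then have "x \<in> U j" using p by (simp add: U_def)
    with j card[OF P] show "x \<in> (\<Union>j<nat \<lfloor>1/\<kappa>\<rfloor>. U j)" by force
  qed
  moreover have "dist x y \<le> 4 * r" if "x \<in> U j" "y \<in> U j" for x y j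
    using that dist_triangle3[of x y "h j"] by (auto simp: U_def split: if_splits)
  ultimately show ?thesis by blast
qed

text \<open>
  Each \<open>c n x\<close> takes finitely many values, so Tychonoff's theorem gives a cluster point \<open>d\<close>;
  agreement at pairs of points is what transfers diameter bounds to the limit cover.
\<close>

lemma diagonal_limit:
  fixes c :: "nat \<Rightarrow> 'a \<Rightarrow> nat"
  assumes fin: "\<And>x. finite (F x)" and c: "\<And>x n. N x \<le> n \<Longrightarrow> c n x \<in> F x"
  shows "\<exists>d. \<forall>x y. \<exists>n. N x \<le> n \<and> N y \<le> n \<and> c n x = d x \<and> c n y = d y"
proof -
  \<comment> \<open>The finitely many values before \<open>N x\<close> are added, so that the entire
    sequence lies in one compact product.\<close>
  define F' where "F' x = F x \<union> (\<lambda>n. c n x) ` {..<N x}" for x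
  have "finite (F' x)" for x using fin by (simp add: F'_def)
  then have "compactin (product_topology (\<lambda>_. euclidean) UNIV) (PiE UNIV F')"
    by (subst compactin_PiE) (auto intro: finite_imp_compact)
  then have comp: "compact (PiE UNIV F')"
    by (simp add: euclidean_product_topology)
  have cF: "c n x \<in> F' x" for n x
    using c[of x n] by (cases "N x \<le> n") (auto simp: F'_def)
  then have ev: "eventually (\<lambda>f. f \<in> PiE UNIV F') (filtermap c sequentially)"
    by (simp add: eventually_filtermap PiE_def Pi_def)
  have "filtermap c sequentially \<noteq> bot" by (simp add: filtermap_bot_iff)
  with comp ev have "\<exists>d\<in>PiE UNIV F'. inf (nhds d) (filtermap c sequentially) \<noteq> bot"
    unfolding compact_filter by simp
  then obtain d where d: "inf (nhds d) (filtermap c sequentially) \<noteq> bot" by (rule bexE)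
  have "\<exists>n. N x \<le> n \<and> N y \<le> n \<and> c n x = d x \<and> c n y = d y" for x y
  proof (rule ccontr)
    assume neg: "\<not> ?thesis"
    have "continuous_on UNIV (\<lambda>f :: 'a \<Rightarrow> nat. f z)" for z
      by (rule continuous_on_product_then_coordinatewise) (rule continuous_on_id)
    then have "open ((\<lambda>f :: 'a \<Rightarrow> nat. f z) -` {d z})" for z
      by (intro open_vimage) (auto simp: Topological_Spaces.open_discrete)
    then have "eventually (\<lambda>f. f \<in> (\<lambda>f. f z) -` {d z}) (nhds d)" for z
      by (rule eventually_nhds_in_open) simp
    then have 1: "eventually (\<lambda>f. f x = d x \<and> f y = d y) (nhds d)"
      by (simp add: eventually_conj)
    have "eventually (\<lambda>n. N x \<le> n \<and> N y \<le> n) sequentially"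
      by (intro eventually_conj eventually_ge_at_top)
    then have 2: "eventually (\<lambda>f. \<not> (f x = d x \<and> f y = d y)) (filtermap c sequentially)"
      unfolding eventually_filtermap by eventually_elim (use neg in blast)
    have "eventually (\<lambda>f. False) (inf (nhds d) (filtermap c sequentially))"
      unfolding eventually_inf using 1 2 by blast
    then show False using d by (simp add: trivial_limit_def)
  qed
  then show ?thesis by blast
qed


text \<open>The bound \<open>k\<close> makes the diagonal of \<phi> bounded, as the variational
  argument requires. It enters neither \<kappa> nor the number and size of the covering sets, and
  this uniformity allows \<open>k\<close> to tend to infinity afterwards.\<close>

lemma heavy_ball_cover:
  fixes X :: "'a::metric_space set" and n :: "'a \<Rightarrow> nat" and \<phi> :: "'a \<Rightarrow> 'a \<Rightarrow> real"
    and \<alpha> t t' B J :: real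
  assumes \<alpha>: "0 < \<alpha>" and t: "0 < t" "t < t'" and B: "0 < B" and J: "4 * B \<le> J"
    and sym: "\<And>x y. \<phi> x y = \<phi> y x" and nn: "\<And>x y. 0 \<le> \<phi> x y"
    and K: "\<And>x y. x \<in> X \<Longrightarrow> y \<in> X \<Longrightarrow>
        \<phi> x y \<le> B * (1 + (\<Sum>l\<le>n x. 2 powr (t * l) * of_bool (dist x y powr \<alpha> \<le> 2 powr - real l)))"
    and energy: "\<And>S m. finite S \<Longrightarrow> S \<subseteq> X \<Longrightarrow> (\<And>x. 0 \<le> m x) \<Longrightarrow> (\<Sum>x\<in>S. m x) = 1 \<Longrightarrow>
       J \<le> (\<Sum>x\<in>S. \<Sum>y\<in>S. m x * m y * \<phi> x y)"
    and nX: "\<And>x. x \<in> X \<Longrightarrow> n x \<le> k"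
  defines "\<kappa> \<equiv> J * (1 - 2 powr (t - t')) / (4 * B)"
  shows "\<exists>U :: nat \<Rightarrow> nat \<Rightarrow> 'a set. (\<forall>x\<in>X. \<exists>l\<le>n x. \<exists>j<nat \<lfloor>2 powr (t' * l) / \<kappa>\<rfloor>. x \<in> U l j) \<and>
     (\<forall>l j. \<forall>x\<in>U l j. \<forall>y\<in>U l j. dist x y \<le> 4 * 2 powr (- real l / \<alpha>))"
proof (cases "X = {}")
  case False
  have q: "0 < 2 powr (t - t')" "2 powr (t - t') < 1" using t by (auto simp: powr_less_one)
  have kpos: "0 < \<kappa>" using q B J by (simp add: \<kappa>_def)
  have Jpos: "0 < J" using B J by linarith
  have diag: "\<phi> x x \<le> B * (1 + (\<Sum>l\<le>k. 2 powr (t * l)))" if "x \<in> X" for x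
  proof -
    have "\<phi> x x \<le> B * (1 + (\<Sum>l\<le>n x. 2 powr (t * l) * of_bool (dist x x powr \<alpha> \<le> 2 powr - real l)))"
      by (rule K) (use that in auto)
    also have "\<dots> \<le> B * (1 + (\<Sum>l\<le>n x. 2 powr (t * l)))"
      using B by (intro mult_left_mono add_left_mono sum_mono) auto
    also have "\<dots> \<le> B * (1 + (\<Sum>l\<le>k. 2 powr (t * l)))"
      using B nX[OF that] by (intro mult_left_mono add_left_mono sum_mono2) auto
    finally show ?thesis .
  qed
  obtain S m where S: "finite S" "S \<subseteq> X" and m: "\<forall>x. 0 \<le> m x" "(\<Sum>x\<in>S. m x) = 1"
    and pot: "\<forall>x\<in>X. J / 2 \<le> (\<Sum>y\<in>S. m y * \<phi> x y)"
    using exists_potential_ge[OF False Jpos sym nn diag energy] by blast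
  define T where "T l = {x \<in> X. \<kappa> * 2 powr (- t' * l) \<le> (\<Sum>y\<in>{y\<in>S. dist x y \<le> 2 powr (- real l / \<alpha>)}. m y)}" for l :: nat
  have le_iff: "dist x y powr \<alpha> \<le> 2 powr - real l \<longleftrightarrow> dist x y \<le> 2 powr (- real l / \<alpha>)" for x y :: 'a and l :: nat
  proof -
    have "2 powr - real l = (2 powr (- real l / \<alpha>)) powr \<alpha>" using \<alpha> by (simp add: powr_powr)
    then show ?thesis using \<alpha> by (metis (no_types) not_le powr_less_mono2 powr_mono2 less_imp_le powr_ge_zero zero_le_dist)
  qed
  have cov: "\<exists>l\<le>n x. x \<in> T l" if x: "x \<in> X" for x
  proof -
    have "\<exists>l\<le>n x. \<kappa> * 2 powr (- t' * l) \<le> (\<Sum>y\<in>{y\<in>S. dist x y powr \<alpha> \<le> 2 powr - real l}. m y)"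
      unfolding \<kappa>_def
      by (rule exists_heavy_ball[where f="\<phi> x"]) (use t B J m S pot x K in auto)
    then show ?thesis using x by (auto simp: T_def le_iff)
  qed
  have "\<exists>U :: nat \<Rightarrow> 'a set. T l \<subseteq> (\<Union>j<nat \<lfloor>1 / (\<kappa> * 2 powr (- t' * l))\<rfloor>. U j) \<and>
      (\<forall>j. \<forall>x\<in>U j. \<forall>y\<in>U j. dist x y \<le> 4 * 2 powr (- real l / \<alpha>))" for l :: nat
    by (rule separated_cover[where m=m and S=S]) (use kpos m S in \<open>auto simp: T_def\<close>)
  then have "\<forall>l. \<exists>U :: nat \<Rightarrow> 'a set. T l \<subseteq> (\<Union>j<nat \<lfloor>1 / (\<kappa> * 2 powr (- t' * l))\<rfloor>. U j) \<and>
      (\<forall>j. \<forall>x\<in>U j. \<forall>y\<in>U j. dist x y \<le> 4 * 2 powr (- real l / \<alpha>))" by blast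
  from choice[OF this] obtain U :: "nat \<Rightarrow> nat \<Rightarrow> 'a set" where U: "\<forall>l. T l \<subseteq> (\<Union>j<nat \<lfloor>1 / (\<kappa> * 2 powr (- t' * real l))\<rfloor>. U l j) \<and>
      (\<forall>j. \<forall>x\<in>U l j. \<forall>y\<in>U l j. dist x y \<le> 4 * 2 powr (- real l / \<alpha>))" by (rule exE)
  have "1 / (\<kappa> * 2 powr (- t' * l)) = 2 powr (t' * l) / \<kappa>" for l :: nat
    by (simp add: powr_minus field_simps)
  then have *: "T l \<subseteq> (\<Union>j<nat \<lfloor>2 powr (t' * l) / \<kappa>\<rfloor>. U l j)" for l using U by metis
  have "\<exists>l\<le>n x. \<exists>j<nat \<lfloor>2 powr (t' * l) / \<kappa>\<rfloor>. x \<in> U l j" if x: "x \<in> X" for x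
    using cov[OF x] * by blast
  then show ?thesis using U by (intro exI[of _ U]) simp
next
  case True
  then show ?thesis by (intro exI[of _ "\<lambda>_ _. {}"]) simp
qed

lemma diam_pow_le:
  fixes V :: "'a::metric_space set"
  assumes s: "0 < s" and r: "0 \<le> r" and V: "\<And>x y. x \<in> V \<Longrightarrow> y \<in> V \<Longrightarrow> dist x y \<le> r"
  shows "bounded V" "diam_pow s V \<le> ennreal (r powr s)"
proof -
  show "bounded V" using V unfolding bounded_def by (cases "V = {}") blast+
  have "diameter V \<le> r"
  proof (cases "V = {}")
    case False
    then show ?thesis unfolding diameter_def using V by (auto intro!: cSUP_least)
  qed (use r in simp)
  then show "diam_pow s V \<le> ennreal (r powr s)"
    using s \<open>bounded V\<close> by (auto simp: diam_pow_pos intro!: ennreal_leI powr_mono2 diameter_ge_0)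
qed

text \<open>The covers of \<open>{x\<in>X. n x \<le> k}\<close> obey, for every \<open>k\<close>,
  the same bounds on number and diameter at each scale. Recording for each point which set contains
  it, and passing to a limit of these records, gives one cover of \<open>X\<close> with the same
  bounds. Its total is a multiple of \<open>1 / J\<close>, where \<open>J\<close> is arbitrary while
  \<open>B\<close> is fixed in advance.\<close>

lemma hausdorff_measure_eq_0_of_energy:
  fixes X :: "'a::metric_space set" and \<alpha> t s B :: real
  assumes \<alpha>: "0 < \<alpha>" and t: "0 < t" and s: "\<alpha> * t < s" and B: "0 < B"
    and ex: "\<And>J. 0 < J \<Longrightarrow> \<exists>(n :: 'a \<Rightarrow> nat) \<phi>. (\<forall>x y. \<phi> x y = \<phi> y x) \<and> (\<forall>x y. 0 \<le> \<phi> x y) \<and>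
        (\<forall>x\<in>X. \<forall>y\<in>X. \<phi> x y \<le> B * (1 + (\<Sum>l\<le>n x. 2 powr (t * l) * of_bool (dist x y powr \<alpha> \<le> 2 powr - real l)))) \<and>
        (\<forall>S m. finite S \<longrightarrow> S \<subseteq> X \<longrightarrow> (\<forall>x. 0 \<le> m x) \<longrightarrow> (\<Sum>x\<in>S. m x) = 1 \<longrightarrow>
           J \<le> (\<Sum>x\<in>S. \<Sum>y\<in>S. m x * m y * \<phi> x y))"
  shows "hausdorff_measure s X = 0"
proof (rule hausdorff_measure_eq_0I)
  have "0 < \<alpha> * t" using \<alpha> t by simp
  with s show spos: "0 < s" by linarith
  fix e :: real assume e: "0 < e"
  define u where "u = s / \<alpha>"
  have ts: "t < u" using s \<alpha> by (simp add: u_def field_simps)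
  define t' where "t' = (t + u) / 2"
  have t': "t < t'" unfolding t'_def using ts by simp
  have t'': "t' < s / \<alpha>" unfolding u_def[symmetric] t'_def using ts by simp
  define q where "q = 2 powr (t' - s / \<alpha>)"
  have q: "0 < q" "q < 1" using t'' by (auto simp: q_def powr_less_one)
  define p where "p = 1 - 2 powr (t - t')"
  have p: "0 < p" using t' by (simp add: p_def powr_less_one)
  \<comment> \<open>The first bound is the one required for heavy balls; the second makes the total
    \<open>4 powr s / (1 - q) / \<kappa>\<close> of the cover at most \<open>e\<close>.\<close>
  define J where "J = max (4 * B) (4 * B / p * (4 powr s / (1 - q)) / e)"
  have J: "4 * B \<le> J" "4 * B / p * (4 powr s / (1 - q)) / e \<le> J" by (auto simp: J_def)
  then have Jpos: "0 < J" using B by linarith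
  define \<kappa> where "\<kappa> = J * p / (4 * B)"
  have kpos: "0 < \<kappa>" using B Jpos p by (simp add: \<kappa>_def)
  have ke: "4 powr s / (1 - q) / \<kappa> \<le> e"
    using J(2) e B p Jpos q by (simp add: \<kappa>_def field_simps)
  define kernel where "kernel n \<phi> \<longleftrightarrow> (\<forall>x y. \<phi> x y = \<phi> y x) \<and> (\<forall>x y. 0 \<le> \<phi> x y) \<and>
        (\<forall>x\<in>X. \<forall>y\<in>X. \<phi> x y \<le> B * (1 + (\<Sum>l\<le>n x. 2 powr (t * l) * of_bool (dist x y powr \<alpha> \<le> 2 powr - real l)))) \<and>
        (\<forall>S m. finite S \<longrightarrow> S \<subseteq> X \<longrightarrow> (\<forall>x. 0 \<le> m x) \<longrightarrow> (\<Sum>x\<in>S. m x) = 1 \<longrightarrow>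
           J \<le> (\<Sum>x\<in>S. \<Sum>y\<in>S. m x * m y * \<phi> x y))" for n :: "'a \<Rightarrow> nat" and \<phi>
  from ex[OF Jpos] obtain n \<phi> where ker: "kernel n \<phi>" unfolding kernel_def by (elim exE)
  have sym: "\<And>x y. \<phi> x y = \<phi> y x" and nn: "\<And>x y. 0 \<le> \<phi> x y"
    and K: "\<And>x y. x \<in> X \<Longrightarrow> y \<in> X \<Longrightarrow>
        \<phi> x y \<le> B * (1 + (\<Sum>l\<le>n x. 2 powr (t * l) * of_bool (dist x y powr \<alpha> \<le> 2 powr - real l)))"
    and energy: "\<And>S m. finite S \<Longrightarrow> S \<subseteq> X \<Longrightarrow> (\<And>x. 0 \<le> m x) \<Longrightarrow> (\<Sum>x\<in>S. m x) = 1 \<Longrightarrow>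
       J \<le> (\<Sum>x\<in>S. \<Sum>y\<in>S. m x * m y * \<phi> x y)"
    by (rule ker[unfolded kernel_def, THEN conjunct1, rule_format]
        ker[unfolded kernel_def, THEN conjunct2, THEN conjunct1, rule_format]
        ker[unfolded kernel_def, THEN conjunct2, THEN conjunct2, THEN conjunct1, rule_format]
        ker[unfolded kernel_def, THEN conjunct2, THEN conjunct2, THEN conjunct2, rule_format]; assumption)+
  define N where "N l = nat \<lfloor>2 powr (t' * real l) / \<kappa>\<rfloor>" for l :: nat
  define \<rho> where "\<rho> l = 4 * 2 powr (- real l / \<alpha>)" for l :: nat
  have "\<exists>U :: nat \<Rightarrow> nat \<Rightarrow> 'a set. (\<forall>x\<in>{x\<in>X. n x \<le> k}. \<exists>l\<le>n x. \<exists>j<N l. x \<in> U l j) \<and>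
     (\<forall>l j. \<forall>x\<in>U l j. \<forall>y\<in>U l j. dist x y \<le> \<rho> l)" for k
    unfolding N_def \<rho>_def \<kappa>_def p_def
  proof (rule heavy_ball_cover[OF \<alpha> t t' B J(1) sym nn K])
    show "J \<le> (\<Sum>x\<in>S. \<Sum>y\<in>S. m x * m y * \<phi> x y)"
      if "finite S" "S \<subseteq> {x \<in> X. n x \<le> k}" "\<And>x. 0 \<le> m x" "(\<Sum>x\<in>S. m x) = 1" for S m
      by (rule energy) (use that in auto)
  qed auto
  then have "\<forall>k. \<exists>U :: nat \<Rightarrow> nat \<Rightarrow> 'a set. (\<forall>x\<in>{x\<in>X. n x \<le> k}. \<exists>l\<le>n x. \<exists>j<N l. x \<in> U l j) \<and>
     (\<forall>l j. \<forall>x\<in>U l j. \<forall>y\<in>U l j. dist x y \<le> \<rho> l)" by blast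
  from choice[OF this] obtain U :: "nat \<Rightarrow> nat \<Rightarrow> nat \<Rightarrow> 'a set" where
    U: "\<forall>k. (\<forall>x\<in>{x\<in>X. n x \<le> k}. \<exists>l\<le>n x. \<exists>j<N l. x \<in> U k l j) \<and>
     (\<forall>l j. \<forall>x\<in>U k l j. \<forall>y\<in>U k l j. dist x y \<le> \<rho> l)" by (rule exE)
  \<comment> \<open>A point is recorded only at scales \<open>l \<le> n x\<close>, so its possible
    codes form a finite set that is the same for all stages \<open>k\<close>.\<close>
  define F where "F x = prod_encode ` (SIGMA l:{..n x}. {..<N l})" for x
  have "\<exists>i. (x \<in> X \<longrightarrow> n x \<le> k \<longrightarrow> i \<in> F x \<and> x \<in> case_prod (U k) (prod_decode i))" for k x
  proof (cases "x \<in> X \<and> n x \<le> k")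
    case True
    then obtain l j where "l \<le> n x" "j < N l" "x \<in> U k l j" using U by blast
    then show ?thesis by (intro exI[of _ "prod_encode (l, j)"]) (auto simp: F_def)
  qed auto
  then have "\<forall>k. \<exists>f. \<forall>x. (x \<in> X \<longrightarrow> n x \<le> k \<longrightarrow> f x \<in> F x \<and> x \<in> case_prod (U k) (prod_decode (f x)))"
    by (intro allI choice) blast
  from choice[OF this] obtain c where c: "\<forall>k x. x \<in> X \<longrightarrow> n x \<le> k \<longrightarrow> c k x \<in> F x \<and> x \<in> case_prod (U k) (prod_decode (c k x))"
    by (rule exE)
  \<comment> \<open>The default 0 outside \<open>X\<close> allows the limit to be taken over the
    whole type.\<close>
  define c' where "c' k x = (if x \<in> X then c k x else 0)" for k x
  have "\<exists>d. \<forall>x y. \<exists>k. n x \<le> k \<and> n y \<le> k \<and> c' k x = d x \<and> c' k y = d y"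
    by (rule diagonal_limit[where F="\<lambda>x. insert 0 (F x)"]) (use c in \<open>auto simp: F_def c'_def\<close>)
  then obtain d where "\<forall>x y. \<exists>k. n x \<le> k \<and> n y \<le> k \<and> c' k x = d x \<and> c' k y = d y" by (rule exE)
  then have d: "\<exists>k. n x \<le> k \<and> n y \<le> k \<and> c k x = d x \<and> c k y = d y" if "x \<in> X" "y \<in> X" for x y
    using \<open>\<forall>x y. \<exists>k. n x \<le> k \<and> n y \<le> k \<and> c' k x = d x \<and> c' k y = d y\<close>[rule_format, of x y] that
    by (simp add: c'_def)
  \<comment> \<open>The limit cover consists of the fibres of the limiting code. Any two points of a
    fibre share a covering set at some finite stage, which bounds their distance, although the stage
    varies with the pair.\<close>
  define V where "V i = {x\<in>X. d x = i}" for i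
  have V_dist: "dist x y \<le> \<rho> l" if "x \<in> V (prod_encode (l, j))" "y \<in> V (prod_encode (l, j))" for x y l j
  proof -
    have xy: "x \<in> X" "y \<in> X" "d x = prod_encode (l, j)" "d y = prod_encode (l, j)" using that by (auto simp: V_def)
    obtain k where k: "n x \<le> k" "n y \<le> k" "c k x = d x" "c k y = d y" using d[OF xy(1,2)] by blast
    have "x \<in> U k l j" "y \<in> U k l j" using c xy k by force+
    then show ?thesis using U by blast
  qed
  have V_empty: "V (prod_encode (l, j)) = {}" if "N l \<le> j" for l j
  proof (rule equals0I)
    fix x assume "x \<in> V (prod_encode (l, j))"
    then have x: "x \<in> X" "d x = prod_encode (l, j)" by (auto simp: V_def)
    with d[OF x(1) x(1)] c have "prod_encode (l, j) \<in> F x" by metis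
    then show False using that by (auto simp: F_def)
  qed
  have rho: "0 \<le> \<rho> l" for l by (simp add: \<rho>_def)
  have "bounded (V i)" for i
  proof -
    obtain l j where "i = prod_encode (l, j)" by (metis prod_decode_inverse surj_pair)
    then show ?thesis using diam_pow_le(1)[OF spos rho V_dist] by simp
  qed
  moreover have "X \<subseteq> (\<Union>i. V i)" by (auto simp: V_def)
  moreover have "(\<Sum>i. diam_pow s (V i)) \<le> ennreal e"
  proof -
    have "(\<Sum>i. diam_pow s (V i)) = (\<Sum>l. \<Sum>j. diam_pow s (V (prod_encode (l, j))))"
      using suminf_ennreal_2dimen[of "\<lambda>l. \<Sum>j. diam_pow s (V (prod_encode (l, j)))" "\<lambda>(l,j). diam_pow s (V (prod_encode (l, j)))"]
      by (simp add: o_def case_prod_unfold)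
    also have "\<dots> \<le> (\<Sum>l. ennreal (4 powr s / \<kappa> * q ^ l))"
    proof (rule suminf_le)
      fix l
      have "(\<Sum>j. diam_pow s (V (prod_encode (l, j)))) = (\<Sum>j<N l. diam_pow s (V (prod_encode (l, j))))"
        by (rule suminf_finite) (auto simp: V_empty diam_pow_def)
      also have "\<dots> \<le> (\<Sum>j<N l. ennreal (\<rho> l powr s))"
        by (intro sum_mono diam_pow_le(2) spos rho V_dist)
      also have "\<dots> = ennreal (real (N l) * \<rho> l powr s)"
        by (simp add: ennreal_mult ennreal_of_nat_eq_real_of_nat)
      also have "\<dots> \<le> ennreal (2 powr (t' * l) / \<kappa> * \<rho> l powr s)"
        using kpos by (intro ennreal_leI mult_right_mono) (auto simp: N_def)
      \<comment> \<open>The number of sets grows like \<open>2 powr (t' * l)\<close> and each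
        contribution decays like \<open>2 powr (- l * s / \<alpha>)\<close>; as
        \<open>t' < s / \<alpha>\<close>, the product is geometric with ratio
        \<open>q < 1\<close>.\<close>
      also have "2 powr (t' * l) / \<kappa> * \<rho> l powr s = 4 powr s / \<kappa> * q ^ l"
      proof -
        have "\<rho> l powr s = 4 powr s * 2 powr (- real l / \<alpha> * s)" by (simp add: \<rho>_def powr_mult powr_powr)
        moreover have "q ^ l = 2 powr (t' * l) * 2 powr (- real l / \<alpha> * s)"
          by (simp add: q_def powr_realpow[symmetric] powr_powr powr_add[symmetric] algebra_simps)
        ultimately show ?thesis by simp
      qed
      finally show "(\<Sum>j. diam_pow s (V (prod_encode (l, j)))) \<le> ennreal (4 powr s / \<kappa> * q ^ l)" .
    qed auto
    also have "\<dots> = ennreal (4 powr s / \<kappa> * (1 / (1 - q)))"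
      by (intro suminf_ennreal_eq sums_mult geometric_sums) (use q kpos in auto)
    also have "\<dots> \<le> ennreal e" using ke by (intro ennreal_leI) (simp add: field_simps)
    finally show ?thesis .
  qed
  ultimately show "\<exists>U. X \<subseteq> (\<Union>i. U i) \<and> (\<forall>i. bounded (U i)) \<and> (\<Sum>i. diam_pow s (U i)) \<le> ennreal e"
    by (intro exI[of _ V] conjI allI)
qed

section \<open>Potentials and images of the Baire space\<close>

text \<open>Cauchy-Schwarz for \<open>F\<close> against the mixture \<open>u\<close> of the
  \<open>v x\<close> with weights \<open>m x\<close>: the pairing is at least 1, and the squared
  norm of \<open>u\<close> is the energy, because \<phi> is the Gram kernel of the
  \<open>v x\<close>.\<close>

lemma energy_ge_of_l2:
  assumes F: "F \<in> borel_measurable M" "(\<integral>\<^sup>+w. (F w)^2 \<partial>M) \<le> ennreal e" and e: "0 < e"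
    and S: "finite S" and m: "\<And>x. 0 \<le> m x" "(\<Sum>x\<in>S. m x) = 1"
    and v: "\<And>x. x \<in> S \<Longrightarrow> v x \<in> borel_measurable M" "\<And>x. x \<in> S \<Longrightarrow> 1 \<le> (\<integral>\<^sup>+w. F w * v x w \<partial>M)"
    and \<phi>: "\<And>x y. x \<in> S \<Longrightarrow> y \<in> S \<Longrightarrow> (\<integral>\<^sup>+w. v x w * v y w \<partial>M) = ennreal (\<phi> x y)" "\<And>x y. 0 \<le> \<phi> x y"
  shows "1 / e \<le> (\<Sum>x\<in>S. \<Sum>y\<in>S. m x * m y * \<phi> x y)"
proof -
  note [measurable] = F(1) v(1)
  define u where "u w = (\<Sum>x\<in>S. ennreal (m x) * v x w)" for w
  have [measurable]: "u \<in> borel_measurable M"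
    unfolding u_def by (intro borel_measurable_sum borel_measurable_times v(1)) auto
  have "1 = (\<Sum>x\<in>S. ennreal (m x))" using m by (subst sum_ennreal) auto
  also have "\<dots> \<le> (\<Sum>x\<in>S. ennreal (m x) * (\<integral>\<^sup>+w. F w * v x w \<partial>M))"
  proof (rule sum_mono)
    fix x assume "x \<in> S"
    then have "ennreal (m x) * 1 \<le> ennreal (m x) * (\<integral>\<^sup>+w. F w * v x w \<partial>M)" by (intro mult_left_mono v(2)) simp_all
    then show "ennreal (m x) \<le> ennreal (m x) * (\<integral>\<^sup>+w. F w * v x w \<partial>M)" by simp
  qed
  also have "\<dots> = (\<integral>\<^sup>+w. F w * u w \<partial>M)"
    unfolding u_def sum_distrib_left
    by (subst nn_integral_sum) (auto simp: nn_integral_cmult[symmetric] mult_ac intro!: sum.cong)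
  finally have "1^2 \<le> (\<integral>\<^sup>+w. F w * u w \<partial>M)^2" by (rule power_mono) simp
  also have "\<dots> \<le> (\<integral>\<^sup>+w. (F w)^2 \<partial>M) * (\<integral>\<^sup>+w. (u w)^2 \<partial>M)"
    by (rule Cauchy_Schwarz_nn_integral) measurable
  also have "(\<integral>\<^sup>+w. (u w)^2 \<partial>M) = (\<integral>\<^sup>+w. (\<Sum>x\<in>S. \<Sum>y\<in>S. ennreal (m x) * ennreal (m y) * (v x w * v y w)) \<partial>M)"
    unfolding u_def power2_eq_square sum_product by (intro nn_integral_cong sum.cong) (auto simp: mult_ac)
  also have "\<dots> = (\<Sum>x\<in>S. \<Sum>y\<in>S. ennreal (m x) * ennreal (m y) * (\<integral>\<^sup>+w. v x w * v y w \<partial>M))"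
    by (subst nn_integral_sum, simp, rule sum.cong[OF refl], subst nn_integral_sum) (auto simp: nn_integral_cmult intro!: sum.cong)
  also have "\<dots> = (\<Sum>x\<in>S. \<Sum>y\<in>S. ennreal (m x * m y * \<phi> x y))"
    using m \<phi> by (intro sum.cong refl) (simp add: ennreal_mult)
  also have "\<dots> = ennreal (\<Sum>x\<in>S. \<Sum>y\<in>S. m x * m y * \<phi> x y)"
    using m \<phi>(2) by (simp add: sum_ennreal sum_nonneg)
  also have "(\<integral>\<^sup>+w. (F w)^2 \<partial>M) * \<dots> \<le> ennreal e * \<dots>" using F(2) by (rule mult_right_mono) simp
  also have "\<dots> = ennreal (e * (\<Sum>x\<in>S. \<Sum>y\<in>S. m x * m y * \<phi> x y))"
    using e m \<phi>(2) by (intro ennreal_mult[symmetric] sum_nonneg) auto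
  finally have "1 \<le> e * (\<Sum>x\<in>S. \<Sum>y\<in>S. m x * m y * \<phi> x y)" by simp
  then show ?thesis using e by (simp add: field_simps)
qed

text \<open>\<open>p\<close> stands for the probability that two projections are closer than
  \<open>2 / 2^n\<close>, and \<open>D\<close> for \<open>dist x y powr \<alpha>\<close>.
  Transversality applies only when its \<delta> is below 1. The sum over dyadic scales dominates the
  minimum of 1 and the transversality bound in all ranges of \<open>D\<close>, in a form that can
  later be weighted and summed over \<open>n\<close>; the last term serves
  \<open>D > 1\<close>.\<close>

lemma dyadic_min_bound:
  fixes p C D :: real and k n :: nat
  assumes p: "p \<le> 1" and D: "0 \<le> D" and C: "0 < C"
    and small: "2 / 2^n < D \<Longrightarrow> p \<le> C * (2 / 2^n / D)^k"
  shows "p \<le> 2^k * max 1 C * (of_bool (D \<le> 1/2^n) + (\<Sum>l<n. (2^(l+1) / 2^n)^k * of_bool (D \<le> 1/2^l)) + (1/2^n)^k)"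
    (is "p \<le> ?C * (?a + ?b + ?c)")
proof -
  have C1: "1 \<le> ?C" using mult_mono[of 1 "2^k" 1 "max 1 C"] by (simp add: one_le_power)
  have CC: "C * 2^k \<le> ?C" by (simp add: mult.commute)
  have nn: "0 \<le> ?a" "0 \<le> ?b" "0 \<le> ?c" by (auto intro!: sum_nonneg)
  consider "D \<le> 1/2^n" | "1/2^n < D" "D \<le> 1" | "1 < D" by linarith
  then show ?thesis
  proof cases
    case 1
    have "p \<le> 1 * 1" using p by simp
    also have "\<dots> \<le> ?C * (?a + ?b + ?c)" using C1 nn 1 by (intro mult_mono) auto
    finally show ?thesis .
  next
    case 2
    define P where "P l \<longleftrightarrow> D \<le> 1/2^l" for l :: nat
    have bound: "l \<le> n" if "P l" for l
    proof (rule ccontr)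
      assume "\<not> l \<le> n"
      then have "(1::real)/2^l \<le> 1/2^n" by (intro divide_left_mono power_increasing) auto
      then show False using that 2(1) unfolding P_def by linarith
    qed
    have "P 0" using 2(2) by (simp add: P_def)
    then obtain l where l: "P l" and lmax: "\<And>j. P j \<Longrightarrow> j \<le> l"
      using ex_has_greatest_nat[of P 0 "\<lambda>x. x" "Suc n"] bound by (metis le_imp_less_Suc)
    have "l \<noteq> n" using l 2(1) by (auto simp: P_def)
    then have ln: "l < n" using bound[OF l] by simp
    have "\<not> P (l+1)" using lmax[of "l+1"] by auto
    then have Dl: "1/2^(l+1) < D" unfolding P_def by (rule not_le_imp_less)
    have D0: "0 < D" by (rule less_trans[OF _ Dl]) simp
    have main: "p \<le> ?C * (2^(l+1) / 2^n)^k"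
    proof (cases "2 / 2^n < D")
      case True
      have "2 / 2^n / D \<le> 2 / 2^n * 2^(l+1)"
        using Dl D0 by (simp add: field_simps)
      then have "(2 / 2^n / D)^k \<le> (2 / 2^n * 2^(l+1))^k" using D0 by (intro power_mono) auto
      also have "\<dots> = 2^k * (2^(l+1) / 2^n)^k" by (simp add: power_mult_distrib[symmetric])
      finally have "C * (2 / 2^n / D)^k \<le> C * (2^k * (2^(l+1) / 2^n)^k)" using C by (intro mult_left_mono) auto
      also have "\<dots> \<le> ?C * (2^(l+1) / 2^n)^k" unfolding mult.assoc[symmetric] using CC by (intro mult_right_mono) auto
      finally show ?thesis using small[OF True] by linarith
    next
      \<comment> \<open>Here \<open>D\<close> lies between \<open>1/2^n\<close> and
        \<open>2/2^n\<close>, so \<open>l\<close> is the last scale \<open>n - 1\<close>, whose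
        coefficient is 1.\<close>
      case False
      obtain n' where n': "n = Suc n'" using ln by (cases n) auto
      have "D \<le> 2 / 2^n" using False by simp
      also have "\<dots> = 1 / 2^n'" by (simp add: n')
      finally have "n' \<le> l" using lmax[of n'] by (simp add: P_def)
      then have "n = Suc l" using ln n' by simp
      then show ?thesis using p C1 by simp
    qed
    have eq: "of_bool (D \<le> 1/2^l) = (1::real)" using l by (simp add: P_def)
    have "(2^(l+1) / 2^n)^k * of_bool (D \<le> 1/2^l) \<le> ?b"
      by (rule member_le_sum[of l "{..<n}" "\<lambda>l. (2^(l+1) / 2^n)^k * of_bool (D \<le> 1/2^l)"]) (use ln in auto)
    then have "(2^(l+1) / 2^n)^k \<le> ?b" unfolding eq mult_1_right .
    then have "(2^(l+1) / 2^n)^k \<le> ?a + ?b + ?c" using nn by linarith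
    then have "?C * (2^(l+1) / 2^n)^k \<le> ?C * (?a + ?b + ?c)" using C1 by (intro mult_left_mono) auto
    with main show ?thesis by linarith
  next
    case 3
    have main: "p \<le> ?C * ?c"
    proof (cases "2 / 2^n < D")
      case True
      have "2 / 2^n / D \<le> 2 / 2^n" using 3 by (simp add: field_simps)
      then have "(2 / 2^n / D)^k \<le> (2 * (1 / 2^n))^k" using 3 by (intro power_mono) auto
      also have "\<dots> = 2^k * (1/2^n)^k" by (rule power_mult_distrib)
      finally have "C * (2 / 2^n / D)^k \<le> C * (2^k * (1/2^n)^k)" using C by (intro mult_left_mono) auto
      also have "\<dots> \<le> ?C * (1/2^n)^k" unfolding mult.assoc[symmetric] using CC by (intro mult_right_mono) auto
      finally show ?thesis using small[OF True] by linarith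
    next
      \<comment> \<open>For \<open>D > 1\<close> transversality is out of reach only at
        \<open>n = 0\<close>, where the bound is trivial.\<close>
      case False
      have "n = 0"
      proof (rule ccontr)
        assume "n \<noteq> 0"
        then have "(2::real) / 2^n \<le> 1" by (cases n) auto
        then show False using False 3 by linarith
      qed
      then show ?thesis using p C1 by simp
    qed
    also have "\<dots> \<le> ?C * (?a + ?b + ?c)" using C1 nn by (intro mult_left_mono) auto
    finally show ?thesis .
  qed
qed

text \<open>Fatou's lemma along convergent sequences; first countability turns sequential closedness
  of the sublevel set into closedness.\<close>

lemma open_integral_greater:
  fixes h :: "'w \<Rightarrow> 'y::first_countable_topology \<Rightarrow> ennreal"
  assumes meas: "\<And>y. (\<lambda>w. h w y) \<in> borel_measurable M"
    and lsc: "\<And>w a. w \<in> space M \<Longrightarrow> open {y. a < h w y}"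
  shows "open {y. c < (\<integral>\<^sup>+w. h w y \<partial>M)}"
proof -
  have "closed {y. (\<integral>\<^sup>+w. h w y \<partial>M) \<le> c}"
    unfolding closed_sequential_limits
  proof (intro allI impI, elim conjE)
    fix y l assume y: "\<forall>n. y n \<in> {y. (\<integral>\<^sup>+w. h w y \<partial>M) \<le> c}" and lim: "y \<longlonglongrightarrow> l"
    have "h w l \<le> liminf (\<lambda>n. h w (y n))" if w: "w \<in> space M" for w
      unfolding le_Liminf_iff
    proof (intro allI impI)
      fix a assume "a < h w l"
      then show "\<forall>\<^sub>F n in sequentially. a < h w (y n)"
        using topological_tendstoD[OF lim lsc[OF w, of a]] by simp
    qed
    then have "(\<integral>\<^sup>+w. h w l \<partial>M) \<le> (\<integral>\<^sup>+w. liminf (\<lambda>n. h w (y n)) \<partial>M)" by (intro nn_integral_mono)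
    also have "\<dots> \<le> liminf (\<lambda>n. \<integral>\<^sup>+w. h w (y n) \<partial>M)" by (rule nn_integral_liminf[OF meas])
    also have "\<dots> \<le> liminf (\<lambda>n. c)" by (rule Liminf_mono) (use y in simp)
    also have "\<dots> = c" by (simp add: Liminf_const)
    finally show "l \<in> {y. (\<integral>\<^sup>+w. h w y \<partial>M) \<le> c}" by simp
  qed
  moreover have "{y. c < (\<integral>\<^sup>+w. h w y \<partial>M)} = - {y. (\<integral>\<^sup>+w. h w y \<partial>M) \<le> c}" by auto
  ultimately show ?thesis by (simp add: open_Compl)
qed

lemma open_greater_add:
  fixes f g :: "'z::topological_space \<Rightarrow> ennreal"
  assumes f: "\<And>a. open {z. a < f z}" and g: "\<And>a. open {z. a < g z}"
  shows "open {z. a < f z + g z}"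
proof -
  have *: "\<exists>S. open S \<and> z \<in> S \<and> S \<subseteq> {z. a < f z + g z}" if z: "a < f z + g z" for z
  proof (cases "a < f z \<or> a < g z")
    case True
    then show ?thesis
    proof
      assume "a < f z" then show ?thesis by (intro exI[of _ "{z. a < f z}"]) (auto simp: f intro: less_le_trans)
    next
      assume "a < g z" then show ?thesis
        by (intro exI[of _ "{z. a < g z}"]) (auto simp: g intro: less_le_trans[of _ "g _"] add_increasing)
    qed
  next
    case False
    then have le: "f z \<le> a" "g z \<le> a" by auto
    have "a < \<top>" using z less_le_trans[OF z] top_greatest by (meson le_less_trans not_le top.not_eq_extremum z top.extremum_strict less_top)
    then obtain r where r: "a = ennreal r" "0 \<le> r" by (cases a) auto
    obtain x where x: "f z = ennreal x" "0 \<le> x" using le r by (cases "f z") (auto simp: top_unique)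
    obtain y where y: "g z = ennreal y" "0 \<le> y" using le r by (cases "g z") (auto simp: top_unique)
    have rxy: "r < x + y" "x \<le> r" "y \<le> r" using z le r x y by (auto simp flip: ennreal_plus simp: ennreal_less_iff)
    \<comment> \<open>The surplus over \<open>a\<close> is shared equally between the two
      summands.\<close>
    define e where "e = (x + y - r) / 2"
    have e: "0 < e" "e \<le> x" "e \<le> y" "(x - e) + (y - e) = r" using rxy x y by (auto simp: e_def field_simps)
    define S where "S = {w. ennreal (x - e) < f w} \<inter> {w. ennreal (y - e) < g w}"
    have "open S" unfolding S_def by (intro open_Int f g)
    moreover have "z \<in> S" unfolding S_def using x y e by (simp add: ennreal_less_iff)
    moreover have "a < f w + g w" if "w \<in> S" for w
    proof -
      have "a = ennreal (x - e) + ennreal (y - e)" using r e by (simp flip: ennreal_plus)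
      also have "\<dots> < f w + g w" using that unfolding S_def by (intro add_strict_mono) auto
      finally show ?thesis .
    qed
    ultimately show ?thesis by blast
  qed
  then show ?thesis by (subst open_subopen) blast
qed

text \<open>Continuity from above along the decreasing neighbourhoods, which start from a bounded
  set and hence from finite measure.\<close>

lemma emeasure_neighbourhoods:
  fixes K :: "'b::euclidean_space set"
  assumes K: "compact K" and M: "sets M = sets borel" and fin: "\<And>A. bounded A \<Longrightarrow> A \<in> sets borel \<Longrightarrow> emeasure M A < \<infinity>"
  shows "(INF n. emeasure M (\<Union>x\<in>K. ball x (1/2^n))) = emeasure M K"
proof -
  define U where "U n = (\<Union>x\<in>K. ball x (1/2^n))" for n :: nat
  have opn: "open (U n)" for n unfolding U_def by blast
  have "(INF n. emeasure M (U n)) = emeasure M (\<Inter>n. U n)"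
  proof (rule INF_emeasure_decseq')
    show "U n \<in> sets M" for n using opn M by simp
    show "decseq U"
    proof (rule decseq_SucI)
      fix n have "(1::real)/2^(Suc n) \<le> 1/2^n" by (simp add: field_simps)
      then show "U (Suc n) \<subseteq> U n" unfolding U_def by (meson UN_mono subset_ball order_refl)
    qed
    have "bounded (U 0)"
    proof -
      obtain B where B: "\<And>x. x \<in> K \<Longrightarrow> norm x \<le> B" using compact_imp_bounded[OF K] by (auto simp: bounded_iff)
      have "norm z \<le> B + 1" if z: "z \<in> U 0" for z
      proof -
        obtain x where "x \<in> K" "dist x z < 1" using z by (auto simp: U_def)
        then show ?thesis using B[of x] norm_triangle_sub[of z x] by (simp add: dist_norm norm_minus_commute)
      qed
      then show ?thesis by (auto simp: bounded_iff)
    qed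
    then have "emeasure M (U 0) < \<infinity>" using opn by (intro fin) auto
    then show "\<exists>i. emeasure M (U i) \<noteq> \<infinity>" by (intro exI[of _ 0]) simp
  qed
  also have "(\<Inter>n. U n) = K"
  proof
    show "K \<subseteq> (\<Inter>n. U n)" by (auto simp: U_def)
    show "(\<Inter>n. U n) \<subseteq> K"
    proof
      fix z assume z: "z \<in> (\<Inter>n. U n)"
      have "z \<in> closure K" unfolding closure_approachable
      proof (intro allI impI)
        fix e :: real assume "0 < e"
        then obtain n where n: "(1/2)^n < e" using real_arch_pow_inv[of e "1/2"] by auto
        from z obtain x where "x \<in> K" "dist x z < 1/2^n" by (auto simp: U_def)
        with n show "\<exists>y\<in>K. dist y z < e" by (intro bexI[of _ x]) (auto simp: power_one_over)
      qed
      then show "z \<in> K" using compact_imp_closed[OF K] by (simp add: closure_closed)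
    qed
  qed
  finally show ?thesis by (simp add: U_def)
qed

text \<open>Choquet's scheme for outer measure finds compact images of boxes with almost full
  measure. Measurability matters because \<open>emeasure\<close> assigns 0 to a non-measurable set,
  so that the value 0 alone would say nothing about subsets of the image.\<close>

lemma lebesgue_measurable_baire_image:
  fixes g :: "(nat \<Rightarrow> nat) \<Rightarrow> 'b::euclidean_space"
  assumes g: "continuous_on UNIV g"
  shows "range g \<in> sets lebesgue"
proof -
  have "range g \<inter> cball 0 (real N) \<in> sets lebesgue" for N
  proof -
    \<comment> \<open>Restriction to a ball makes the measure finite, so that measures can be
      subtracted.\<close>
    define M where "M = density lborel (indicator (cball (0::'b) N))"
    have sM: "sets M = sets borel" "space M = UNIV" by (auto simp: M_def)
    have eM: "emeasure M A = emeasure lborel (A \<inter> cball 0 N)" if "A \<in> sets borel" for A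
    proof -
      have "emeasure M A = (\<integral>\<^sup>+z. indicator (cball 0 N) z * indicator A z \<partial>lborel)"
        unfolding M_def by (rule emeasure_density) (use that in \<open>auto intro!: borel_measurable_indicator\<close>)
      also have "\<dots> = emeasure lborel (cball 0 N \<inter> A)"
        using that by (simp flip: indicator_inter_arith)
      finally show ?thesis by (simp add: Int_commute)
    qed
    have fin: "emeasure M A < \<infinity>" if "A \<in> sets borel" for A
    proof -
      have "emeasure M A \<le> emeasure lborel (cball (0::'b) N)" using that by (simp add: eM emeasure_mono)
      also have "\<dots> < \<infinity>" by (rule emeasure_bounded_finite) simp
      finally show ?thesis .
    qed
    obtain H where H: "H \<in> sets M" "range g \<subseteq> H" "outer_measure_of M (range g) = emeasure M H"
      using outer_measure_of_attain[of "range g" M] sM by auto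
    \<comment> \<open>Outer measure is continuous along increasing unions of arbitrary sets, hence
      also along images of cylinders, whose measurability is not known at this point.\<close>
    have comp: "\<exists>b. c \<le> emeasure M (g ` baire_box b)" if c: "c < outer_measure_of M (range g)" for c
    proof -
      have "\<exists>n. c < outer_measure_of M (g ` A n)"
        if "incseq A" "c < outer_measure_of M (g ` (\<Union>n. A n))" for A :: "nat \<Rightarrow> (nat \<Rightarrow> nat) set"
      proof -
        have "(SUP n. outer_measure_of M (g ` A n)) = outer_measure_of M (\<Union>n. g ` A n)"
          by (rule SUP_outer_measure_of_incseq) (use that(1) sM in \<open>auto simp: incseq_def image_mono\<close>)
        with that(2) have "c < (SUP n. outer_measure_of M (g ` A n))" by (simp add: image_UN)
        then show ?thesis by (simp add: less_SUP_iff)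
      qed
      then obtain b where b: "\<And>m. c < outer_measure_of M (g ` baire_cyl b m)"
        using baire_box_capacitable[of "\<lambda>A. c < outer_measure_of M (g ` A)"] c by metis
      define K where "K = g ` baire_box b"
      have K: "compact K" unfolding K_def
        by (rule compact_continuous_image[OF continuous_on_subset[OF g] compact_baire_box]) simp
      have "c \<le> (INF n. emeasure M (\<Union>x\<in>K. ball x (1/2^n)))"
      proof (rule INF_greatest)
        fix n :: nat
        define O' where "O' = (\<Union>x\<in>K. ball x (1/2^n))"
        have "open O'" unfolding O'_def by blast
        then have "open (g -` O')" using g by (simp add: open_vimage)
        moreover have "baire_box b \<subseteq> g -` O'" unfolding O'_def K_def by fastforce
        ultimately obtain m where "baire_cyl b m \<subseteq> g -` O'" by (rule baire_cyl_subset_open)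
        then have "outer_measure_of M (g ` baire_cyl b m) \<le> outer_measure_of M O'"
          by (intro outer_measure_of_mono) auto
        also have "\<dots> = emeasure M O'" using \<open>open O'\<close> sM by simp
        finally show "c \<le> emeasure M O'" using b[of m] by simp
      qed
      also have "\<dots> = emeasure M K" by (rule emeasure_neighbourhoods[OF K sM(1) fin])
      finally show ?thesis unfolding K_def by blast
    qed
    obtain a where a: "outer_measure_of M (range g) = ennreal a" "0 \<le> a"
      using H fin[of H] sM by (cases "emeasure M H") auto
    have "\<exists>b. ennreal (a - 1 / Suc j) \<le> emeasure M (g ` baire_box b)" for j
    proof (cases "a - 1 / Suc j < 0")
      case False
      then show ?thesis by (intro comp) (simp add: a ennreal_less_iff)
    qed (auto simp: ennreal_neg)
    then obtain b where b: "\<And>j. ennreal (a - 1 / Suc j) \<le> emeasure M (g ` baire_box (b j))" by metis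
    define K where "K = (\<Union>j. g ` baire_box (b j))"
    have K: "K \<in> sets borel" unfolding K_def
      by (intro sets.countable_UN) (auto intro!: borel_compact compact_continuous_image[OF continuous_on_subset[OF g] compact_baire_box])
    have "ennreal a \<le> emeasure M K"
    proof (rule ennreal_le_epsilon)
      fix e :: real assume "0 < e"
      then obtain j where j: "1 / Suc j < e" using nat_approx_posE by blast
      have "ennreal (a - 1 / Suc j) \<le> emeasure M K"
      proof (rule order_trans[OF b])
        show "emeasure M (g ` baire_box (b j)) \<le> emeasure M K"
          by (rule emeasure_mono) (use K sM in \<open>auto simp: K_def\<close>)
      qed
      then have "ennreal (a - 1 / Suc j) + ennreal (1 / Suc j) \<le> emeasure M K + ennreal e"
        using j by (intro add_mono ennreal_leI) auto
      moreover have "ennreal a \<le> ennreal (a - 1 / Suc j) + ennreal (1 / Suc j)"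
        by (cases "a - 1 / Suc j < 0") (auto simp flip: ennreal_plus simp: ennreal_neg intro!: ennreal_leI)
      ultimately show "ennreal a \<le> emeasure M K + ennreal e" by (rule order_trans[rotated])
    qed
    moreover have KH: "K \<subseteq> H" using H(2) by (auto simp: K_def)
    \<comment> \<open>The \<sigma>-compact \<open>K\<close> inside the image and the measurable hull
      \<open>H\<close> around it have the same measure, so within the ball the image differs from
      \<open>K\<close> by a null set.\<close>
    ultimately have "emeasure M (H - K) = 0"
      using H K sM fin[of K] a emeasure_Diff[of M K H] by (simp add: diff_eq_0_iff_ennreal)
    then have null: "(H - K) \<inter> cball 0 (real N) \<in> null_sets lborel"
      using H K sM by (simp add: eM null_sets_def)
    have "range g \<inter> cball 0 (real N) = (K \<inter> cball 0 (real N)) \<union> ((range g - K) \<inter> cball 0 (real N))"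
      by (auto simp: K_def)
    moreover have "(range g - K) \<inter> cball 0 (real N) \<in> null_sets lebesgue"
      by (rule null_sets_completion_subset[OF _ null_sets_completionI[OF null]]) (use H(2) in auto)
    moreover have "K \<inter> cball 0 (real N) \<in> sets lebesgue" using K by (intro sets_completionI_sets) auto
    ultimately show ?thesis by (metis null_setsD2 sets.Un)
  qed
  then have "(\<Union>N::nat. range g \<inter> cball 0 (real N)) \<in> sets lebesgue" by blast
  moreover have "(\<Union>N::nat. range g \<inter> cball 0 (real N)) = range g"
    using real_arch_simple by (auto simp: dist_norm)
  ultimately show ?thesis by simp
qed

text \<open>Turns a scale that depends on the parameter into one fixed \<open>n\<close> that serves
  more than half of the mass.\<close>

lemma (in finite_measure) exists_half:
  assumes A: "incseq A" "\<And>n. A n \<in> sets M" and ae: "AE x in M. x \<in> (\<Union>n. A n)" and pos: "0 < measure M (space M)"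
  obtains n :: nat where "measure M (space M) / 2 < measure M (A n)"
proof -
  have "(\<lambda>n. measure M (A n)) \<longlonglongrightarrow> measure M (\<Union>n. A n)"
    by (rule finite_Lim_measure_incseq) (use A in auto)
  also have "measure M (\<Union>n. A n) = measure M (space M)"
    by (rule finite_measure_eq_AE) (use ae A in auto)
  finally have "\<forall>\<^sub>F n in sequentially. measure M (space M) / 2 < measure M (A n)"
    using pos by (intro order_tendstoD(1)[of _ "measure M (space M)"]) auto
  then show ?thesis using that by (auto simp: eventually_sequentially)
qed

section \<open>Transversal families\<close>

text \<open>Reduces unions of open balls over an uncountable box to a countable dense subset, as
  measurability in the parameter requires.\<close>

lemma UN_ball_closure_eq:
  assumes g: "continuous_on UNIV g" and D: "D \<subseteq> B" "B \<subseteq> closure D"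
  shows "(\<Union>y\<in>B. ball (g y :: 'b::metric_space) r) = (\<Union>y\<in>D. ball (g y) r)"
proof
  show "(\<Union>y\<in>B. ball (g y) r) \<subseteq> (\<Union>y\<in>D. ball (g y) r)"
  proof
    fix z assume "z \<in> (\<Union>y\<in>B. ball (g y) r)"
    then obtain y where y: "y \<in> B" "dist (g y) z < r" by auto
    have "open (g -` ball z r)" using g by (simp add: open_vimage)
    moreover have "y \<in> g -` ball z r" using y by (simp add: dist_commute)
    moreover have "y \<in> closure D" using y D by blast
    ultimately have "D \<inter> (g -` ball z r) \<noteq> {}"
      by (metis disjoint_iff open_Int_closure_eq_empty Int_commute)
    then show "z \<in> (\<Union>y\<in>D. ball (g y) r)" by (auto simp: dist_commute)
  qed
qed (use D in auto)

lemma ennreal_less_half_iff: "a < x / 2 \<longleftrightarrow> a * 2 < (x::ennreal)"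
proof (cases x)
  case (real r)
  show ?thesis
  proof (cases a)
    case (real q)
    have "x / 2 = ennreal (r / 2)" using \<open>x = ennreal r\<close> \<open>0 \<le> r\<close> by (simp add: divide_ennreal flip: ennreal_numeral)
    moreover have "a * 2 = ennreal (q * 2)" using real by (simp add: ennreal_mult)
    ultimately show ?thesis using real \<open>x = ennreal r\<close> \<open>0 \<le> r\<close> by (simp add: ennreal_less_iff)
  qed (use real in \<open>simp add: ennreal_top_mult\<close>)
next
  case top
  show ?thesis by (cases a) (auto simp: top ennreal_top_divide ennreal_top_mult simp flip: ennreal_numeral ennreal_mult)
qed

lemma ennreal_one_less_avg: "1 < x \<Longrightarrow> 1 < y \<Longrightarrow> 1 < (x + y) / (2::ennreal)"
  unfolding ennreal_less_half_iff using add_strict_mono[of 1 x 1 y] by simp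

lemma separable_subset:
  fixes S :: "'a::second_countable_topology set"
  obtains D where "countable D" "D \<subseteq> S" "S \<subseteq> closure D"
proof -
  obtain B :: "'a set set" where B: "countable B" "topological_basis B"
    using ex_countable_basis by blast
  define D where "D = (\<lambda>U. SOME x. x \<in> U \<inter> S) ` {U \<in> B. U \<inter> S \<noteq> {}}"
  have pick: "(SOME x. x \<in> U \<inter> S) \<in> U \<inter> S" if "U \<inter> S \<noteq> {}" for U
    by (rule someI_ex) (use that in blast)
  have "countable D" using B(1) by (simp add: D_def)
  moreover have "D \<subseteq> S" using pick by (auto simp: D_def)
  moreover have "S \<subseteq> closure D"
  proof
    fix x assume x: "x \<in> S"
    show "x \<in> closure D"
      unfolding closure_iff_nhds_not_empty
    proof (intro allI impI)
      fix A T assume "T \<subseteq> A" "open T" "x \<in> T"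
      obtain U where U: "U \<in> B" "x \<in> U" "U \<subseteq> T"
        by (rule topological_basisE[OF B(2) \<open>open T\<close> \<open>x \<in> T\<close>])
      then have "U \<inter> S \<noteq> {}" using x by blast
      then have "(SOME x. x \<in> U \<inter> S) \<in> D" "(SOME x. x \<in> U \<inter> S) \<in> U"
        using U(1) pick[of U] unfolding D_def by (blast, blast)
      then show "D \<inter> A \<noteq> {}" using U(3) \<open>T \<subseteq> A\<close> by blast
    qed
  qed
  ultimately show ?thesis by (rule that)
qed

text \<open>
  The parameter \<open>k\<close> is the dimension \<open>CARD('k)\<close> as a term: constants of the locale that mention
  only the type \<open>'k\<close> would have a hidden type argument.
\<close>

locale transversal_family = finite_measure P for P :: "'l measure" +
  fixes p :: "'l \<Rightarrow> 'a::metric_space \<Rightarrow> real ^ 'k::finite" and X :: "'a set" and \<alpha> C :: real and k :: nat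
  assumes k: "k = CARD('k)"
    and mass: "measure P (space P) \<le> 1"
    and \<alpha>: "0 < \<alpha>" and C: "0 < C"
    and p_measurable: "x \<in> X \<Longrightarrow> (\<lambda>l. p l x) \<in> borel_measurable P"
    and p_continuous: "l \<in> space P \<Longrightarrow> continuous_on X (p l)"
    and transversal: "0 < \<delta> \<Longrightarrow> \<delta> < 1 \<Longrightarrow> x \<in> X \<Longrightarrow> y \<in> X \<Longrightarrow> x \<noteq> y \<Longrightarrow>
      measure P {l \<in> space P. norm (p l x - p l y) \<le> \<delta> * dist x y powr \<alpha>} \<le> C * \<delta> ^ k"
begin

lemma continuous_on_orbit:
  assumes "continuous_on UNIV f" "range f = X" "l \<in> space P"
  shows "continuous_on UNIV (\<lambda>y. p l (f y))"
  using continuous_on_compose2[OF p_continuous[OF assms(3)] assms(1)] assms(2) by simp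

section \<open>Probabilities of near coincidence of two projections\<close>

text \<open>Balls of radius \<open>1/2^n\<close> around two points can meet only if the points are
  closer than \<open>2 / 2^n\<close>.\<close>

definition near :: "nat \<Rightarrow> 'a \<Rightarrow> 'a \<Rightarrow> real" where
  "near n x y = measure P {l \<in> space P. dist (p l x) (p l y) < 2 / 2^n}"

definition K :: real where "K = 2^k * max 1 C"

lemma K_pos: "0 < K" by (simp add: K_def)

lemma near_bound:
  assumes "x \<in> X" "y \<in> X"
  shows "near n x y \<le> K * (of_bool (dist x y powr \<alpha> \<le> 1/2^n) +
     (\<Sum>l<n. (2^(l+1) / 2^n)^k * of_bool (dist x y powr \<alpha> \<le> 1/2^l)) + (1/2^n)^k)"
  unfolding K_def
proof (rule dyadic_min_bound)
  note [measurable] = p_measurable[OF assms(1)] p_measurable[OF assms(2)]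
  show "near n x y \<le> 1" unfolding near_def using bounded_measure mass by (rule order_trans)
  assume D: "2 / 2^n < dist x y powr \<alpha>"
  define \<delta> where "\<delta> = 2 / 2^n / dist x y powr \<alpha>"
  have "0 < (2::real) / 2^n" by simp
  with D have Dpos: "0 < dist x y powr \<alpha>" by linarith
  have "0 < \<delta>" using Dpos by (simp add: \<delta>_def)
  moreover have "\<delta> < 1" unfolding \<delta>_def by (subst divide_less_eq_1_pos[OF Dpos]) (rule D)
  ultimately have d: "0 < \<delta>" "\<delta> < 1" by simp_all
  have "x \<noteq> y" using Dpos by auto
  have "near n x y \<le> measure P {l \<in> space P. norm (p l x - p l y) \<le> \<delta> * dist x y powr \<alpha>}"
    unfolding near_def by (rule finite_measure_mono) (use Dpos in \<open>auto simp: \<delta>_def dist_norm\<close>)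
  also have "\<dots> \<le> C * \<delta>^k" by (rule transversal) (use d assms \<open>x \<noteq> y\<close> in auto)
  finally show "near n x y \<le> C * (2 / 2^n / dist x y powr \<alpha>)^k" by (simp add: \<delta>_def)
qed (use C in auto)

lemma half_power_eq_powr: "1/2^l = (2::real) powr - real l"
  by (simp add: powr_minus powr_realpow inverse_eq_divide)

text \<open>The volume factor \<open>2^(n*k)\<close> turns the probability bound into the kernel
  \<open>dist x y powr (- \<alpha> * k)\<close> in the form of a truncated dyadic sum. The
  truncation \<open>m\<close> may exceed \<open>n\<close>: the pair \<open>x\<close>,
  \<open>y\<close> is governed by the coarser of two scales but is to be compared with the scale of
  \<open>x\<close> alone.\<close>

lemma near_scaled:
  assumes "x \<in> X" "y \<in> X" and nm: "n \<le> m"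
  shows "2^(n*k) * near n x y \<le>
     K * 2^k * (1 + (\<Sum>l\<le>m. 2 powr (real k * real l) * of_bool (dist x y powr \<alpha> \<le> 2 powr - real l)))"
proof -
  define D where "D = dist x y powr \<alpha>"
  define b :: "nat \<Rightarrow> real" where "b l = of_bool (D \<le> 1/2^l)" for l
  have b: "0 \<le> b l" for l by (simp add: b_def)
  have "2^(n*k) * near n x y \<le> 2^(n*k) * (K * (b n + (\<Sum>l<n. (2^(l+1) / 2^n)^k * b l) + (1/2^n)^k))"
    using near_bound[OF assms(1,2), of n] by (intro mult_left_mono) (auto simp: b_def D_def)
  also have "\<dots> = K * (2^(n*k) * b n + (\<Sum>l<n. 2^(n*k) * (2^(l+1) / 2^n)^k * b l) + 2^(n*k) * (1/2^n)^k)"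
    by (simp add: algebra_simps sum_distrib_left)
  also have "2^(n*k) * (1/2^n)^k = (1::real)" by (simp add: power_mult power_mult_distrib[symmetric])
  also have "(\<Sum>l<n. 2^(n*k) * (2^(l+1) / 2^n)^k * b l) = (\<Sum>l<n. 2^k * (2^(l*k) * b l))"
  proof (rule sum.cong[OF refl])
    fix l
    have "(2::real)^(n*k) * (2^(l+1) / 2^n)^k = (2^n * (2^(l+1) / 2^n))^k" by (simp only: power_mult power_mult_distrib)
    also have "\<dots> = 2^k * 2^(l*k)" by (simp add: power_mult power_mult_distrib)
    finally show "2^(n*k) * (2^(l+1) / 2^n)^k * b l = 2^k * (2^(l*k) * b l)" by simp
  qed
  \<comment> \<open>The factor \<open>2^k\<close> is given to all three terms; then the first one is
    the summand \<open>l = n\<close> and merges with the sum.\<close>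
  also have "K * (2^(n*k) * b n + (\<Sum>l<n. 2^k * (2^(l*k) * b l)) + 1) \<le> K * (2^k * (2^(n*k) * b n) + (\<Sum>l<n. 2^k * (2^(l*k) * b l)) + 2^k * 1)"
  proof (intro mult_left_mono add_mono order_refl)
    have "1 \<le> (2::real)^k" by simp
    then show "2^(n*k) * b n \<le> 2^k * (2^(n*k) * b n)" "1 \<le> (2::real)^k * 1"
      using mult_right_mono[of 1 "2^k" "2^(n*k) * b n"] b[of n] by simp_all
  qed (use K_pos in simp)
  also have "\<dots> = K * 2^k * (1 + (\<Sum>l\<le>n. 2^(l*k) * b l))"
    by (simp add: sum_distrib_left algebra_simps flip: lessThan_Suc_atMost)
  also have "\<dots> \<le> K * 2^k * (1 + (\<Sum>l\<le>m. 2^(l*k) * b l))"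
    using K_pos b nm by (intro mult_left_mono add_left_mono sum_mono2) auto
  also have "(\<Sum>l\<le>m. 2^(l*k) * b l) = (\<Sum>l\<le>m. 2 powr (real k * real l) * of_bool (dist x y powr \<alpha> \<le> 2 powr - real l))"
  proof (rule sum.cong[OF refl])
    fix l
    have "(2::real)^(l*k) = 2 powr (real k * real l)" by (simp add: powr_realpow[symmetric] mult.commute)
    then show "2^(l*k) * b l = 2 powr (real k * real l) * of_bool (dist x y powr \<alpha> \<le> 2 powr - real l)"
      by (simp only: b_def D_def half_power_eq_powr)
  qed
  finally show ?thesis .
qed

section \<open>Tubes around the graphs of the projections\<close>

abbreviation plane :: "('l \<times> (real ^ 'k)) measure" where
  "plane \<equiv> P \<Otimes>\<^sub>M lborel"

text \<open>The indicator of the tube of radius \<open>r\<close> around the graph of \<lambda> ->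
  \<open>p \<lambda> x\<close>. Scaled tubes are the vectors whose Gram kernel gets
  estimated.\<close>

definition bump :: "real \<Rightarrow> 'a \<Rightarrow> 'l \<times> (real ^ 'k) \<Rightarrow> ennreal" where
  "bump r x w = indicator {w. dist (p (fst w) x) (snd w) < r} w"

lemma bump_measurable [measurable]: "x \<in> X \<Longrightarrow> bump r x \<in> borel_measurable plane"
proof -
  assume "x \<in> X"
  note [measurable] = p_measurable[OF this]
  have "{w \<in> space plane. dist (p (fst w) x) (snd w) < r} \<in> sets plane" by measurable
  then show "bump r x \<in> borel_measurable plane"
    unfolding bump_def[abs_def] by (subst borel_measurable_indicator_iff) (simp add: Int_def conj_commute)
qed

definition \<omega> :: real where "\<omega> = unit_ball_vol (real k)"

lemma omega_pos: "0 < \<omega>" by (simp add: \<omega>_def)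

lemma emeasure_ball': "0 \<le> r \<Longrightarrow> emeasure lborel (ball (z :: real ^ 'k) r) = ennreal (\<omega> * r^k)"
  by (simp add: \<omega>_def emeasure_ball flip: k)

lemma nn_integral_bump: "0 \<le> r \<Longrightarrow> (\<integral>\<^sup>+z. bump r x (l, z) \<partial>lborel) = ennreal (\<omega> * r^k)"
proof -
  assume "0 \<le> r"
  have "(\<integral>\<^sup>+z. bump r x (l, z) \<partial>lborel) = (\<integral>\<^sup>+z. indicator (ball (p l x) r) z \<partial>lborel)"
    by (intro nn_integral_cong) (auto simp: bump_def indicator_def)
  with \<open>0 \<le> r\<close> show ?thesis by (simp add: emeasure_ball')
qed

text \<open>For fixed \<lambda> the tubes are balls, which are disjoint unless the centres are
  closer than \<open>2 / 2^min a b\<close>, and whose overlap lies in the smaller ball. Distinct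
  radii occur because each point carries its own truncation scale.\<close>

lemma bump_overlap:
  assumes "x \<in> X" "y \<in> X"
  shows "(\<integral>\<^sup>+w. bump (1/2^a) x w * bump (1/2^b) y w \<partial>plane) \<le> ennreal (\<omega> * (1/2^max a b)^k * near (min a b) x y)"
proof -
  note [measurable] = p_measurable[OF assms(1)] p_measurable[OF assms(2)] bump_measurable[OF assms(1)] bump_measurable[OF assms(2)]
  define A where "A = {l \<in> space P. dist (p l x) (p l y) < 2 / 2^(min a b)}"
  have A[measurable]: "A \<in> sets P" unfolding A_def by measurable
  have mono: "(1::real)/2^i \<le> 1/2^j" if "j \<le> i" for i j :: nat
    using that by (intro divide_left_mono power_increasing) auto
  have pt: "(\<integral>\<^sup>+z. bump (1/2^a) x (l, z) * bump (1/2^b) y (l, z) \<partial>lborel) \<le> ennreal (\<omega> * (1/2^max a b)^k) * indicator A l"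
    if l: "l \<in> space P" for l
  proof (cases "l \<in> A")
    case True
    have "bump (1/2^a) x (l, z) * bump (1/2^b) y (l, z) \<le> bump (1/2^max a b) (if a \<le> b then y else x) (l, z)" for z
      by (auto simp: bump_def indicator_def max_def)
    then have "(\<integral>\<^sup>+z. bump (1/2^a) x (l, z) * bump (1/2^b) y (l, z) \<partial>lborel) \<le> (\<integral>\<^sup>+z. bump (1/2^max a b) (if a \<le> b then y else x) (l, z) \<partial>lborel)"
      by (intro nn_integral_mono)
    then show ?thesis using True by (subst (asm) nn_integral_bump) auto
  next
    case False
    then have far: "2 / 2^(min a b) \<le> dist (p l x) (p l y)" using l by (auto simp: A_def)
    have "bump (1/2^a) x (l, z) * bump (1/2^b) y (l, z) = 0" for z
    proof -
      have "\<not> (dist (p l x) z < 1/2^a \<and> dist (p l y) z < 1/2^b)"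
        using far mono[of "min a b" a] mono[of "min a b" b] dist_triangle2[of "p l x" "p l y" z] by auto
      then show ?thesis by (auto simp: bump_def indicator_def)
    qed
    then have "(\<integral>\<^sup>+z. bump (1/2^a) x (l, z) * bump (1/2^b) y (l, z) \<partial>lborel) = (\<integral>\<^sup>+z. 0 \<partial>(lborel :: (real ^ 'k) measure))"
      by (intro nn_integral_cong)
    then show ?thesis by simp
  qed
  have "(\<integral>\<^sup>+w. bump (1/2^a) x w * bump (1/2^b) y w \<partial>plane) =
      (\<integral>\<^sup>+l. \<integral>\<^sup>+z. bump (1/2^a) x (l, z) * bump (1/2^b) y (l, z) \<partial>lborel \<partial>P)"
    by (subst lborel.nn_integral_fst[symmetric]) auto
  also have "\<dots> \<le> (\<integral>\<^sup>+l. ennreal (\<omega> * (1/2^max a b)^k) * indicator A l \<partial>P)"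
    by (rule nn_integral_mono) (rule pt)
  also have "\<dots> = ennreal (\<omega> * (1/2^max a b)^k) * emeasure P A" by (simp add: nn_integral_cmult_indicator)
  also have "\<dots> = ennreal (\<omega> * (1/2^max a b)^k * near (min a b) x y)"
    using omega_pos by (simp add: emeasure_eq_measure near_def A_def ennreal_mult)
  finally show ?thesis .
qed

text \<open>An open neighbourhood of the image takes the place of the image: its indicator is lower
  semicontinuous, and it is determined by a countable set of points.\<close>

definition hits :: "(nat \<Rightarrow> nat) set \<Rightarrow> ((nat \<Rightarrow> nat) \<Rightarrow> 'a) \<Rightarrow> real \<Rightarrow> 'l \<Rightarrow> (real ^ 'k) set" where
  "hits B f r l = (\<Union>y\<in>B. ball (p l (f y)) r)"

lemma hits_measurable:
  assumes f: "continuous_on UNIV f" "range f = X"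
  shows "{w \<in> space plane. snd w \<in> hits B f r (fst w)} \<in> sets plane"
proof -
  obtain D where D: "countable D" "D \<subseteq> B" "B \<subseteq> closure D" by (rule separable_subset)
  have [measurable]: "(\<lambda>l. p l (f y)) \<in> borel_measurable P" for y
    by (rule p_measurable) (use f in auto)
  have "{w \<in> space plane. snd w \<in> hits B f r (fst w)} =
      (\<Union>y\<in>D. {w \<in> space plane. dist (p (fst w) (f y)) (snd w) < r})"
  proof -
    have "hits B f r l = (\<Union>y\<in>D. ball (p l (f y)) r)" if "l \<in> space P" for l
      unfolding hits_def
      by (rule UN_ball_closure_eq[OF _ D(2,3)])
         (use continuous_on_compose2[OF p_continuous[OF that] f(1)] f(2) in auto)
    then show ?thesis by (fastforce simp: space_pair_measure)
  qed
  also have "\<dots> \<in> sets plane"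
  proof (rule sets.countable_UN'[OF D(1)], rule image_subsetI)
    fix y
    show "{w \<in> space plane. dist (p (fst w) (f y)) (snd w) < r} \<in> sets plane"
      by measurable
  qed
  finally show ?thesis .
qed

lemma open_hits: "open (hits B f r l)" unfolding hits_def by blast

lemma emeasure_hits_measurable:
  assumes f: "continuous_on UNIV f" "range f = X"
  shows "(\<lambda>l. emeasure lborel (hits B f r l)) \<in> borel_measurable P"
proof -
  have "(\<lambda>l. emeasure lborel (Pair l -` {w \<in> space plane. snd w \<in> hits B f r (fst w)})) \<in> borel_measurable P"
    by (rule lborel.measurable_emeasure_Pair[OF hits_measurable[OF f]])
  then show ?thesis
    by (rule measurable_cong[THEN iffD1, rotated]) (auto simp: space_pair_measure vimage_def)
qed


section \<open>Capacity of lower semicontinuous functions and Lebesgue null images\<close>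

text \<open>The potential evaluates \<open>F\<close> on a graph, a null set of \<open>plane\<close>,
  so its values have to be controlled pointwise. Lower semicontinuity in the second variable bounds
  them by lower limits of averages over small balls, and it survives half sums and countable
  suprema.\<close>

definition lsc_class :: "('l \<times> (real ^ 'k) \<Rightarrow> ennreal) set" where
  "lsc_class = {F \<in> borel_measurable plane. \<forall>l\<in>space P. \<forall>a. open {z. a < F (l, z)}}"

lemma graph_measurable:
  assumes "F \<in> borel_measurable plane" "x \<in> X"
  shows "(\<lambda>l. F (l, p l x)) \<in> borel_measurable P"
proof -
  note [measurable] = p_measurable[OF assms(2)]
  have "(\<lambda>l. (l, p l x)) \<in> measurable P plane" by measurable
  then show ?thesis using assms(1) by (rule measurable_compose)
qed

lemma lsc_capacity:
  assumes f: "range f = X"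
  shows "l2_capacity plane lsc_class (\<lambda>F y. \<integral>\<^sup>+l. F (l, p l (f y)) \<partial>P)"
proof
  have fX: "f y \<in> X" for y using f by auto
  show "F \<in> borel_measurable plane" if "F \<in> lsc_class" for F
    using that by (simp add: lsc_class_def)
  show "(\<lambda>w. (F w + G w) / 2) \<in> lsc_class" if FG: "F \<in> lsc_class" "G \<in> lsc_class" for F G
  proof -
    have "open {z. a < (F (l, z) + G (l, z)) / 2}" if "l \<in> space P" for l a
    proof -
      have "(a < (F (l, z) + G (l, z)) / 2) = (a * 2 < F (l, z) + G (l, z))" for z
        by (rule ennreal_less_half_iff)
      then show ?thesis using FG that by (simp add: lsc_class_def open_greater_add)
    qed
    then show ?thesis using FG by (auto simp: lsc_class_def)
  qed
  show "(\<lambda>w. SUP n::nat. H n w) \<in> lsc_class" if H: "\<And>n. H n \<in> lsc_class" for H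
  proof -
    have [measurable]: "H n \<in> borel_measurable plane" for n using H by (simp add: lsc_class_def)
    have "open {z. a < (SUP n. H n (l, z))}" if "l \<in> space P" for l a
    proof -
      have "{z. a < (SUP n. H n (l, z))} = (\<Union>n. {z. a < H n (l, z)})" by (auto simp: less_SUP_iff)
      then show ?thesis using H that by (auto simp: lsc_class_def)
    qed
    then show ?thesis by (simp add: lsc_class_def)
  qed
  show "(\<integral>\<^sup>+l. F (l, p l (f y)) \<partial>P) \<le> (\<integral>\<^sup>+l. G (l, p l (f y)) \<partial>P)" if "\<And>w. F w \<le> G w" for F G y
    using that by (intro nn_integral_mono)
  show "1 < (\<integral>\<^sup>+l. (F (l, p l (f y)) + G (l, p l (f y))) / 2 \<partial>P)"
    if FG: "F \<in> lsc_class" "G \<in> lsc_class" and gt: "1 < (\<integral>\<^sup>+l. F (l, p l (f y)) \<partial>P)" "1 < (\<integral>\<^sup>+l. G (l, p l (f y)) \<partial>P)" for F G y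
  proof -
    have [measurable]: "(\<lambda>l. F (l, p l (f y))) \<in> borel_measurable P" "(\<lambda>l. G (l, p l (f y))) \<in> borel_measurable P"
      using FG graph_measurable[OF _ fX] by (auto simp: lsc_class_def)
    have "(\<integral>\<^sup>+l. (F (l, p l (f y)) + G (l, p l (f y))) / 2 \<partial>P) = ((\<integral>\<^sup>+l. F (l, p l (f y)) \<partial>P) + (\<integral>\<^sup>+l. G (l, p l (f y)) \<partial>P)) / 2"
      by (simp add: nn_integral_divide nn_integral_add)
    then show ?thesis using ennreal_one_less_avg[OF gt] by simp
  qed
qed

lemma open_lsc_potential:
  fixes f :: "(nat \<Rightarrow> nat) \<Rightarrow> 'a"
  assumes f: "continuous_on UNIV f" "range f = X" and F: "F \<in> lsc_class"
  shows "open {y. 1 < (\<integral>\<^sup>+l. F (l, p l (f y)) \<partial>P)}"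
proof (rule open_integral_greater[where h="\<lambda>l y. F (l, p l (f y))"])
  show "(\<lambda>l. F (l, p l (f y))) \<in> borel_measurable P" for y
    by (rule graph_measurable) (use F f in \<open>auto simp: lsc_class_def\<close>)
  show "open {y. a < F (l, p l (f y))}" if l: "l \<in> space P" for l a
  proof -
    have "continuous_on UNIV (\<lambda>y. p l (f y))"
      by (rule continuous_on_orbit[OF f l])
    then have "open ((\<lambda>y. p l (f y)) -` {z. a < F (l, z)})"
      using F l by (intro open_vimage) (auto simp: lsc_class_def)
    then show ?thesis by (simp add: vimage_def)
  qed
qed

text \<open>The averages of \<open>F (l, _)\<close> over balls of radius \<open>1/2^n\<close> around
  \<open>p l x\<close> have lower limit at least \<open>F (l, p l x)\<close>, so by Fatou's lemma
  the integrated averages cannot all be below 1. The truncation scale of a point arises here, with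
  no uniformity in \<open>x\<close>.\<close>

lemma lsc_truncation:
  assumes F: "F \<in> lsc_class" and x: "x \<in> X" and gt: "1 < (\<integral>\<^sup>+l. F (l, p l x) \<partial>P)"
  shows "\<exists>n. 1 \<le> (\<integral>\<^sup>+w. F w * (ennreal (2^(n*k) / \<omega>) * bump (1/2^n) x w) \<partial>plane)"
proof (rule ccontr)
  note [measurable] = bump_measurable[OF x]
  have [measurable]: "F \<in> borel_measurable plane" using F by (simp add: lsc_class_def)
  define c where "c n = ennreal (2^(n*k) / \<omega>)" for n
  define h where "h n l = (\<integral>\<^sup>+z. F (l, z) * (c n * bump (1/2^n) x (l, z)) \<partial>lborel)" for n l
  have c: "c n * ennreal (\<omega> * (1/2^n)^k) = 1" for n
  proof -
    have "2^(n*k) * (1/2^n)^k = (1::real)" by (simp add: power_mult power_mult_distrib[symmetric])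
    then show ?thesis using omega_pos by (simp add: c_def ennreal_mult[symmetric] del: power_one_over)
  qed
  have h_int: "(\<integral>\<^sup>+l. h n l \<partial>P) = (\<integral>\<^sup>+w. F w * (c n * bump (1/2^n) x w) \<partial>plane)" for n
    unfolding h_def by (rule lborel.nn_integral_fst) measurable
  have h_meas: "h n \<in> borel_measurable P" for n
    unfolding h_def[abs_def] by (rule lborel.borel_measurable_nn_integral_fst) measurable
  assume "\<not> ?thesis"
  then have le: "(\<integral>\<^sup>+l. h n l \<partial>P) \<le> 1" for n unfolding h_int c_def by (meson not_le less_imp_le)
  have lim: "F (l, p l x) \<le> liminf (\<lambda>n. h n l)" if l: "l \<in> space P" for l
    unfolding le_Liminf_iff
  proof (intro allI impI)
    fix a assume "a < F (l, p l x)"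
    then obtain a' where a': "a < a'" "a' < F (l, p l x)" using dense by blast
    have "open {z. a' < F (l, z)}" using F l by (simp add: lsc_class_def)
    then obtain e where e: "0 < e" "ball (p l x) e \<subseteq> {z. a' < F (l, z)}"
      using a'(2) unfolding open_contains_ball by blast
    obtain N where N: "(1/2)^N < e" using real_arch_pow_inv[of e "1/2"] e(1) by auto
    have "a < h n l" if n: "N \<le> n" for n
    proof -
      have "(1/2::real)^n \<le> (1/2)^N" using n by (intro power_decreasing) auto
      then have small: "1/2^n < e" using N by (simp add: power_one_over)
      have "a' = a' * (c n * (\<integral>\<^sup>+z. bump (1/2^n) x (l, z) \<partial>lborel))" by (simp add: nn_integral_bump c)
      also have "\<dots> = (\<integral>\<^sup>+z. a' * (c n * bump (1/2^n) x (l, z)) \<partial>lborel)"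
        using measurable_compose[OF measurable_Pair1'[OF l] bump_measurable[OF x]]
        by (simp add: nn_integral_cmult)
      also have "\<dots> \<le> h n l" unfolding h_def
      proof (rule nn_integral_mono)
        fix z
        show "a' * (c n * bump (1/2^n) x (l, z)) \<le> F (l, z) * (c n * bump (1/2^n) x (l, z))"
        proof (cases "z \<in> ball (p l x) (1/2^n)")
          case True
          then have "z \<in> ball (p l x) e" using small by simp
          then have "a' < F (l, z)" using e(2) by blast
          then show ?thesis by (intro mult_right_mono) auto
        qed (simp add: bump_def)
      qed
      finally show ?thesis using a'(1) by simp
    qed
    then show "\<forall>\<^sub>F n in sequentially. a < h n l" by (auto simp: eventually_sequentially)
  qed
  have "1 < (\<integral>\<^sup>+l. F (l, p l x) \<partial>P)" by (rule gt)
  also have "\<dots> \<le> (\<integral>\<^sup>+l. liminf (\<lambda>n. h n l) \<partial>P)" by (rule nn_integral_mono) (rule lim)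
  also have "\<dots> \<le> liminf (\<lambda>n. \<integral>\<^sup>+l. h n l \<partial>P)" by (rule nn_integral_liminf[OF h_meas])
  also have "\<dots> \<le> liminf (\<lambda>n. 1)" by (rule Liminf_mono) (use le in simp)
  also have "\<dots> = 1" by (simp add: Liminf_const)
  finally show False by simp
qed

text \<open>The vectors \<open>v x\<close> are tubes at the scale of \<open>x\<close>, normalized to
  integral 1 on each fibre. Their Gram kernel is bounded through \<open>near_scaled\<close>, so that
  small capacity becomes a lower bound for energies of exponent \<open>\<alpha> * k\<close>.\<close>

lemma hausdorff_measure_0_of_lebesgue_small:
  assumes f: "continuous_on UNIV f" "range f = X" and pos: "0 < measure P (space P)"
    and small: "\<And>b e. 0 < e \<Longrightarrow> AE l in P. \<exists>n. emeasure lborel (hits (baire_box b) f (1/2^n) l) \<le> ennreal e"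
    and s: "\<alpha> * real k < s"
  shows "hausdorff_measure s X = 0"
proof (rule hausdorff_measure_eq_0_of_energy[OF \<alpha> _ s])
  have fX: "f y \<in> X" for y using f by auto
  define M where "M = measure P (space P)"
  define N where "N = P \<Otimes>\<^sub>M (lborel :: (real ^ 'k) measure)"
  have box: "\<exists>F\<in>lsc_class. (\<forall>y\<in>baire_box b. 1 < (\<integral>\<^sup>+l. F (l, p l (f y)) \<partial>P)) \<and> (\<integral>\<^sup>+w. (F w)^2 \<partial>N) \<le> ennreal e"
    if e: "0 < e" for b e
  proof -
    \<comment> \<open>More than half of the mass \<open>M\<close> will lie in \<open>A n\<close>, so
      the height \<open>4 / M\<close> gives a potential above 2; \<open>e'\<close> compensates for
      the factor \<open>\<kappa>^2\<close> in the cost.\<close>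
    define \<kappa> where "\<kappa> = 4 / M"
    have kpos: "0 < \<kappa>" using pos by (simp add: \<kappa>_def M_def)
    define e' where "e' = e / \<kappa>^2"
    have e': "0 < e'" using e kpos by (simp add: e'_def)
    define A where "A n = {l \<in> space P. emeasure lborel (hits (baire_box b) f (1/2^n) l) \<le> ennreal e'}" for n :: nat
    have A[measurable]: "A n \<in> sets P" for n
      unfolding A_def using emeasure_hits_measurable[OF f] by measurable
    have "incseq A"
    proof (rule incseq_SucI)
      fix n
      have "(1::real)/2^(Suc n) \<le> 1/2^n" by (simp add: field_simps)
      then have "hits (baire_box b) f (1/2^(Suc n)) l \<subseteq> hits (baire_box b) f (1/2^n) l" for l
        unfolding hits_def by (meson UN_mono order_refl subset_ball)
      then have "emeasure lborel (hits (baire_box b) f (1/2^(Suc n)) l) \<le> emeasure lborel (hits (baire_box b) f (1/2^n) l)" for l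
        by (intro emeasure_mono) (auto simp: open_hits)
      then show "A n \<subseteq> A (Suc n)"
        unfolding A_def by (blast intro: order_trans)
    qed
    moreover have "AE l in P. l \<in> (\<Union>n. A n)"
      using small[OF e', of b] AE_space by eventually_elim (auto simp: A_def)
    ultimately obtain n where n: "M / 2 < measure P (A n)"
      unfolding M_def by (rule exists_half[of A, OF _ A _ pos])
    define Q where "Q = {w \<in> space N. snd w \<in> hits (baire_box b) f (1/2^n) (fst w)}"
    have Q[measurable]: "Q \<in> sets N" unfolding Q_def N_def by (rule hits_measurable[OF f])
    define F where "F w = ennreal \<kappa> * (indicator (A n) (fst w) * indicator (hits (baire_box b) f (1/2^n) (fst w)) (snd w))" for w
    have F_eq: "F w = ennreal \<kappa> * (indicator (A n) (fst w) * indicator Q w)" if "w \<in> space N" for w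
      using that by (auto simp: F_def Q_def indicator_def)
    have fst_meas: "fst \<in> measurable N P" unfolding N_def by measurable
    have F_meas: "F \<in> borel_measurable N"
      by (subst measurable_cong[OF F_eq]) (use fst_meas in measurable)
    have "open {z. a < F (l, z)}" for l a
    proof -
      have "{z. a < F (l, z)} \<in> {UNIV, {}, hits (baire_box b) f (1/2^n) l}"
        by (cases "a < 0"; cases "a < ennreal \<kappa>"; cases "l \<in> A n") (auto simp: F_def indicator_def split: if_splits)
      then show ?thesis using open_hits by auto
    qed
    then have "F \<in> lsc_class" using F_meas by (simp add: lsc_class_def N_def)
    moreover have "1 < (\<integral>\<^sup>+l. F (l, p l (f y)) \<partial>P)" if y: "y \<in> baire_box b" for y
    proof -
      have "1 < \<kappa> * measure P (A n)" using n pos by (simp add: \<kappa>_def M_def field_simps)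
      then have "1 < ennreal (\<kappa> * measure P (A n))" by simp
      also have "\<dots> = ennreal \<kappa> * emeasure P (A n)"
        using kpos by (simp add: emeasure_eq_measure ennreal_mult)
      also have "\<dots> = (\<integral>\<^sup>+l. ennreal \<kappa> * indicator (A n) l \<partial>P)" by (simp add: nn_integral_cmult_indicator)
      also have "\<dots> = (\<integral>\<^sup>+l. F (l, p l (f y)) \<partial>P)"
        by (intro nn_integral_cong) (use y in \<open>auto simp: F_def hits_def indicator_def\<close>)
      finally show ?thesis .
    qed
    moreover have "(\<integral>\<^sup>+w. (F w)^2 \<partial>N) \<le> ennreal e"
    proof -
      have F2: "(\<lambda>w. (F w)^2) \<in> borel_measurable plane" using F_meas unfolding N_def by measurable
      have "(\<integral>\<^sup>+w. (F w)^2 \<partial>N) = (\<integral>\<^sup>+l. \<integral>\<^sup>+z. (F (l, z))^2 \<partial>lborel \<partial>P)"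
        unfolding N_def by (rule lborel.nn_integral_fst[OF F2, symmetric])
      also have "\<dots> \<le> (\<integral>\<^sup>+l. ennreal e \<partial>P)"
      proof (rule nn_integral_mono)
        fix l assume "l \<in> space P"
        have "(\<integral>\<^sup>+z. (F (l, z))^2 \<partial>lborel) = (\<integral>\<^sup>+z. (ennreal \<kappa>^2 * indicator (A n) l) * indicator (hits (baire_box b) f (1/2^n) l) z \<partial>lborel)"
          by (intro nn_integral_cong) (auto simp: F_def indicator_def)
        also have "\<dots> = (ennreal \<kappa>^2 * indicator (A n) l) * emeasure lborel (hits (baire_box b) f (1/2^n) l)"
          by (rule nn_integral_cmult_indicator) (simp add: open_hits)
        also have "\<dots> \<le> ennreal \<kappa>^2 * ennreal e'"
          by (cases "l \<in> A n") (auto simp: A_def intro: mult_left_mono)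
        also have "\<dots> = ennreal e" using kpos e by (simp add: e'_def ennreal_power ennreal_mult[symmetric])
        finally show "(\<integral>\<^sup>+z. (F (l, z))^2 \<partial>lborel) \<le> ennreal e" .
      qed
      also have "\<dots> = ennreal (e * M)" using e by (simp add: emeasure_eq_measure M_def ennreal_mult)
      also have "\<dots> \<le> ennreal e" using e mass unfolding M_def by (intro ennreal_leI) (simp add: mult_left_le)
      finally show ?thesis .
    qed
    ultimately show ?thesis by blast
  qed
  show "0 < real k" by (simp add: k)
  show "0 < K * 2^k / \<omega>" using K_pos omega_pos by simp
  fix J :: real assume J: "0 < J"
  obtain F where F: "F \<in> lsc_class" "\<forall>y. 1 < (\<integral>\<^sup>+l. F (l, p l (f y)) \<partial>P)" "(\<integral>\<^sup>+w. (F w)^2 \<partial>N) < ennreal (1 / J)"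
    using l2_capacity_baire_null[OF lsc_capacity[OF f(2), folded N_def] open_lsc_potential[OF f] box, of "1 / J"] J by auto
  have "\<exists>n. 1 \<le> (\<integral>\<^sup>+w. F w * (ennreal (2^(n*k) / \<omega>) * bump (1/2^n) x w) \<partial>N)" if "x \<in> X" for x
  proof -
    have "x \<in> range f" using that f(2) by simp
    then obtain y where "x = f y" by blast
    then show ?thesis unfolding N_def using lsc_truncation[OF F(1) that] F(2) by simp
  qed
  then obtain n where n: "\<And>x. x \<in> X \<Longrightarrow> 1 \<le> (\<integral>\<^sup>+w. F w * (ennreal (2^(n x*k) / \<omega>) * bump (1/2^n x) x w) \<partial>N)" by metis
  define v where "v x w = ennreal (2^(n x*k) / \<omega>) * bump (1/2^n x) x w" for x w
  have v: "v x \<in> borel_measurable N" if "x \<in> X" for x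
    using bump_measurable[OF that] unfolding v_def[abs_def] N_def by measurable
  have ov: "(\<integral>\<^sup>+w. v x w * v y w \<partial>N) \<le> ennreal (2^(min (n x) (n y)*k) / \<omega> * near (min (n x) (n y)) x y)"
    if "x \<in> X" "y \<in> X" for x y
  proof -
    note [measurable] = bump_measurable[OF that(1)] bump_measurable[OF that(2)]
    have "(\<integral>\<^sup>+w. v x w * v y w \<partial>N) = (\<integral>\<^sup>+w. ennreal (2^(n x*k) / \<omega> * (2^(n y*k) / \<omega>)) * (bump (1/2^n x) x w * bump (1/2^n y) y w) \<partial>N)"
      unfolding v_def using omega_pos by (subst ennreal_mult) (simp_all only: mult_ac, simp_all)
    also have "\<dots> = ennreal (2^(n x*k) / \<omega> * (2^(n y*k) / \<omega>)) * (\<integral>\<^sup>+w. bump (1/2^n x) x w * bump (1/2^n y) y w \<partial>N)"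
      unfolding N_def by (rule nn_integral_cmult) measurable
    also have "\<dots> \<le> ennreal (2^(n x*k) / \<omega> * (2^(n y*k) / \<omega>)) * ennreal (\<omega> * (1/2^max (n x) (n y))^k * near (min (n x) (n y)) x y)"
      unfolding N_def by (intro mult_left_mono bump_overlap that) simp
    also have "\<dots> = ennreal (2^(n x*k) / \<omega> * (2^(n y*k) / \<omega>) * (\<omega> * (1/2^max (n x) (n y))^k * near (min (n x) (n y)) x y))"
      using omega_pos by (intro ennreal_mult[symmetric]) (auto simp: near_def)
    \<comment> \<open>Two normalizations against the volume of the smaller ball leave the
      normalization of the larger one.\<close>
    also have "2^(n x*k) / \<omega> * (2^(n y*k) / \<omega>) * (\<omega> * (1/2^max (n x) (n y))^k * near (min (n x) (n y)) x y)
        = 2^(min (n x) (n y)*k) / \<omega> * near (min (n x) (n y)) x y"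
      using omega_pos by (cases "n x \<le> n y") (auto simp: field_simps power_mult[symmetric] max_def min_def)
    finally show ?thesis .
  qed
  define \<phi> where "\<phi> x y = (if x \<in> X \<and> y \<in> X then enn2real (\<integral>\<^sup>+w. v x w * v y w \<partial>N) else 0)" for x y
  have \<phi>_eq: "(\<integral>\<^sup>+w. v x w * v y w \<partial>N) = ennreal (\<phi> x y)" if "x \<in> X" "y \<in> X" for x y
    using le_less_trans[OF ov[OF that]] that by (simp add: \<phi>_def)
  have \<phi>_nn: "0 \<le> \<phi> x y" for x y by (simp add: \<phi>_def)
  have "\<phi> x y = \<phi> y x" for x y by (simp add: \<phi>_def mult.commute)
  moreover have "\<phi> x y \<le> K * 2^k / \<omega> * (1 + (\<Sum>l\<le>n x. 2 powr (real k * real l) * of_bool (dist x y powr \<alpha> \<le> 2 powr - real l)))"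
    if xy: "x \<in> X" "y \<in> X" for x y
  proof -
    have "ennreal (\<phi> x y) \<le> ennreal (2^(min (n x) (n y)*k) / \<omega> * near (min (n x) (n y)) x y)"
      using ov[OF xy] \<phi>_eq[OF xy] by simp
    then have "\<phi> x y \<le> 2^(min (n x) (n y)*k) / \<omega> * near (min (n x) (n y)) x y"
      using omega_pos by (subst (asm) ennreal_le_iff) (auto simp: near_def)
    also have "\<dots> = (2^(min (n x) (n y)*k) * near (min (n x) (n y)) x y) / \<omega>" by simp
    also have "\<dots> \<le> (K * 2^k * (1 + (\<Sum>l\<le>n x. 2 powr (real k * real l) * of_bool (dist x y powr \<alpha> \<le> 2 powr - real l)))) / \<omega>"
      using omega_pos by (intro divide_right_mono near_scaled xy) auto
    finally show ?thesis by simp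
  qed
  moreover have "J \<le> (\<Sum>x\<in>S. \<Sum>y\<in>S. m x * m y * \<phi> x y)"
    if S: "finite S" "S \<subseteq> X" "\<forall>x. 0 \<le> m x" "(\<Sum>x\<in>S. m x) = 1" for S m
  proof -
    have "1 / (1 / J) \<le> (\<Sum>x\<in>S. \<Sum>y\<in>S. m x * m y * \<phi> x y)"
    proof (rule energy_ge_of_l2[where M=N and F=F and v=v])
      show "F \<in> borel_measurable N" using F(1) by (simp add: lsc_class_def N_def)
      show "(\<integral>\<^sup>+w. v x w * v y w \<partial>N) = ennreal (\<phi> x y)" if "x \<in> S" "y \<in> S" for x y
        by (rule \<phi>_eq) (use that S in auto)
      show "1 \<le> (\<integral>\<^sup>+w. F w * v x w \<partial>N)" "v x \<in> borel_measurable N" if "x \<in> S" for x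
        using n[of x] v[of x] that S(2) by (auto simp: v_def)
    qed (use S F(3) J \<phi>_nn in auto)
    then show ?thesis by simp
  qed
  ultimately show "\<exists>n \<phi>. (\<forall>x y. \<phi> x y = \<phi> y x) \<and> (\<forall>x y. 0 \<le> \<phi> x y) \<and>
      (\<forall>x\<in>X. \<forall>y\<in>X. \<phi> x y \<le> K * 2^k / \<omega> * (1 + (\<Sum>l\<le>n x. 2 powr (real k * real l) * of_bool (dist x y powr \<alpha> \<le> 2 powr - real l)))) \<and>
      (\<forall>S m. finite S \<longrightarrow> S \<subseteq> X \<longrightarrow> (\<forall>x. 0 \<le> m x) \<longrightarrow> sum m S = 1 \<longrightarrow> J \<le> (\<Sum>x\<in>S. \<Sum>y\<in>S. m x * m y * \<phi> x y))"
    using \<phi>_nn by (intro exI[of _ n] exI[of _ \<phi>] conjI allI ballI impI)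
qed

section \<open>Kernels of exponent below the dimension, assembled from all scales\<close>

text \<open>Inserting \<open>near_bound\<close> gives a double sum over scales \<open>l < i\<close>.
  After the exchange of sums the inner one is a geometric tail of ratio
  \<open>r = 2 powr (t - k)\<close>, bounded because \<open>t < k\<close>, and
  \<open>2^(l*k) * r^l = 2 powr (t * l)\<close> restores the dyadic kernel of exponent
  \<open>t\<close>.\<close>

lemma near_sum_bound:
  assumes xy: "x \<in> X" "y \<in> X" and nm: "n \<le> m" and t: "t < real k"
  shows "(\<Sum>i\<le>n. 2 powr (t * real i) * near i x y) \<le>
     K * (1 + 2^k / (1 - 2 powr (t - k))) * (1 + (\<Sum>l\<le>m. 2 powr (t * real l) * of_bool (dist x y powr \<alpha> \<le> 2 powr - real l)))"
proof -
  define b :: "nat \<Rightarrow> real" where "b l = of_bool (dist x y powr \<alpha> \<le> 1/2^l)" for l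
  define r where "r = 2 powr (t - k)"
  define G where "G = 1 / (1 - r)"
  have r: "0 < r" "r < 1" using t by (auto simp: r_def powr_less_one)
  have G: "0 < G" using r by (simp add: G_def)
  have b: "0 \<le> b l" for l by (simp add: b_def)
  have t_r: "2 powr (t * real i) * (1/2^i)^k = r^i" for i
    by (simp add: r_def powr_realpow[symmetric] powr_powr powr_diff[symmetric] power_divide power_mult[symmetric] flip: powr_mult)
       (simp add: algebra_simps)
  have geo: "(\<Sum>i | i \<in> {..n} \<and> l < i. r^i) \<le> r^l * G" for l
  proof -
    have "(\<Sum>i | i \<in> {..n} \<and> l < i. r^i) \<le> (\<Sum>i=l..n. r^i)" using r by (intro sum_mono2) auto
    also have "\<dots> \<le> r^l * G"
    proof (cases "n < l")
      case False
      then have "(\<Sum>i=l..n. r^i) = (r^l - r^Suc n) / (1 - r)" using r by (simp add: sum_gp)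
      also have "\<dots> \<le> r^l / (1 - r)" using r by (intro divide_right_mono) auto
      finally show ?thesis by (simp add: G_def)
    qed (use r G in simp)
    finally show ?thesis .
  qed
  have pt: "2 powr (t * real i) * near i x y \<le>
      K * (2 powr (t * real i) * b i + (\<Sum>l | l \<in> {..n} \<and> l < i. 2^k * (2^(l*k) * b l) * r^i) + r^i)" if "i \<le> n" for i
  proof -
    have "2 powr (t * real i) * near i x y \<le> 2 powr (t * real i) * (K * (b i + (\<Sum>l<i. (2^(l+1) / 2^i)^k * b l) + (1/2^i)^k))"
      using near_bound[OF xy, of i] by (intro mult_left_mono) (auto simp: b_def)
    also have "\<dots> = K * (2 powr (t * real i) * b i + (\<Sum>l<i. 2 powr (t * real i) * ((2^(l+1) / 2^i)^k * b l)) + 2 powr (t * real i) * (1/2^i)^k)"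
      by (simp only: sum_distrib_left[symmetric] distrib_left mult.assoc mult.left_commute[of _ K])
    also have "(\<Sum>l<i. 2 powr (t * real i) * ((2^(l+1) / 2^i)^k * b l)) = (\<Sum>l | l \<in> {..n} \<and> l < i. 2^k * (2^(l*k) * b l) * r^i)"
    proof (rule sum.cong)
      show "{..<i} = {l. l \<in> {..n} \<and> l < i}" using that by auto
      fix l
      have "(2^(l+1) / 2^i)^k = ((2 * 2^l) * (1/2^i) :: real)^k" by simp
      also have "\<dots> = 2^k * 2^(l*k) * (1/2^i)^k" by (simp only: power_mult_distrib power_mult)
      finally have "2 powr (t * real i) * ((2^(l+1) / 2^i)^k * b l) = 2^k * (2^(l*k) * b l) * (2 powr (t * real i) * (1/2^i)^k)"
        by (simp only: mult_ac)
      then show "2 powr (t * real i) * ((2^(l+1) / 2^i)^k * b l) = 2^k * (2^(l*k) * b l) * r^i" by (simp only: t_r)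
    qed
    finally show ?thesis by (simp only: t_r)
  qed
  have "(\<Sum>i\<le>n. 2 powr (t * real i) * near i x y) \<le>
      (\<Sum>i\<le>n. K * (2 powr (t * real i) * b i + (\<Sum>l | l \<in> {..n} \<and> l < i. 2^k * (2^(l*k) * b l) * r^i) + r^i))"
    by (intro sum_mono pt) simp
  also have "\<dots> = K * ((\<Sum>i\<le>n. 2 powr (t * real i) * b i) + (\<Sum>i\<le>n. \<Sum>l | l \<in> {..n} \<and> l < i. 2^k * (2^(l*k) * b l) * r^i) + (\<Sum>i\<le>n. r^i))"
    by (simp only: sum_distrib_left[symmetric] sum.distrib)
  also have "(\<Sum>i\<le>n. \<Sum>l | l \<in> {..n} \<and> l < i. 2^k * (2^(l*k) * b l) * r^i) = (\<Sum>l\<le>n. \<Sum>i | i \<in> {..n} \<and> l < i. 2^k * (2^(l*k) * b l) * r^i)"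
    by (rule sum.swap_restrict) auto
  also have "\<dots> = (\<Sum>l\<le>n. 2^k * (2^(l*k) * b l) * (\<Sum>i | i \<in> {..n} \<and> l < i. r^i))"
    by (simp only: sum_distrib_left)
  also have "\<dots> \<le> (\<Sum>l\<le>n. 2^k * (2^(l*k) * b l) * (r^l * G))"
    using b by (intro sum_mono mult_left_mono geo) auto
  also have "\<dots> = (\<Sum>l\<le>n. 2^k * G * (2 powr (t * real l) * b l))"
  proof (rule sum.cong[OF refl])
    fix l
    have "2^(l*k) * r^l = 2 powr (t * real l)"
      unfolding r_def by (simp add: powr_realpow[symmetric] powr_powr powr_add[symmetric] algebra_simps)
    then show "2^k * (2^(l*k) * b l) * (r^l * G) = 2^k * G * (2 powr (t * real l) * b l)"
      by (simp add: mult_ac)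
  qed
  also have "\<dots> = 2^k * G * (\<Sum>l\<le>n. 2 powr (t * real l) * b l)" by (simp only: sum_distrib_left)
  also have "(\<Sum>i\<le>n. r^i) \<le> 2^k * G"
  proof -
    have "(\<Sum>i\<le>n. r^i) \<le> 1 * G" using r by (auto simp: sum_gp0 G_def field_simps)
    also have "\<dots> \<le> 2^k * G" using G by (intro mult_right_mono) auto
    finally show ?thesis .
  qed
  finally have "(\<Sum>i\<le>n. 2 powr (t * real i) * near i x y) \<le>
      K * ((\<Sum>i\<le>n. 2 powr (t * real i) * b i) + 2^k * G * (\<Sum>l\<le>n. 2 powr (t * real l) * b l) + 2^k * G)"
    using K_pos by simp
  also have "\<dots> \<le> K * ((1 + 2^k * G) * (1 + (\<Sum>l\<le>n. 2 powr (t * real l) * b l)))"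
    using K_pos by (intro mult_left_mono) (auto simp: algebra_simps)
  also have "\<dots> \<le> K * ((1 + 2^k * G) * (1 + (\<Sum>l\<le>m. 2 powr (t * real l) * b l)))"
    using K_pos G b nm by (intro mult_left_mono add_left_mono sum_mono2) auto
  finally show ?thesis unfolding b_def G_def r_def half_power_eq_powr by (simp add: mult.assoc)
qed

text \<open>Its square is \<open>2 powr (i * k)\<close>, the volume normalization at radius
  \<open>1/2^i\<close>, times \<open>2 powr (t * i)\<close>, the weight of scale \<open>i\<close> in
  the dyadic kernel of exponent \<open>t\<close>.\<close>

definition weight :: "real \<Rightarrow> nat \<Rightarrow> real" where "weight t i = 2 powr (real i * (real k + t) / 2)"

lemma weight_pos: "0 < weight t i" by (simp add: weight_def)

text \<open>All scales together form a square root of the kernel: up to truncation, the product of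
  the pulses of \<open>x\<close> and \<open>y\<close> integrates to at most \<open>\<omega>\<close>
  times the sum of \<open>2 powr (t * i) * near i x y\<close>.\<close>

definition pulse :: "real \<Rightarrow> 'a \<Rightarrow> nat \<times> 'l \<times> (real ^ 'k) \<Rightarrow> ennreal" where
  "pulse t x u = ennreal (weight t (fst u)) * bump (1/2^fst u) x (snd u)"

definition scales :: "(nat \<times> 'l \<times> (real ^ 'k)) measure" where
  "scales = count_space UNIV \<Otimes>\<^sub>M plane"

lemma measurable_scalesI: "(\<And>i. (\<lambda>w. F (i, w)) \<in> borel_measurable plane) \<Longrightarrow> F \<in> borel_measurable scales"
  unfolding scales_def by (rule measurable_pair_measure_countable1) auto

lemma measurable_scalesD: "F \<in> borel_measurable scales \<Longrightarrow> (\<lambda>w. F (i, w)) \<in> borel_measurable plane"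
  unfolding scales_def by (rule measurable_compose[OF measurable_Pair1']) auto

lemma nn_integral_scales:
  assumes "F \<in> borel_measurable scales"
  shows "(\<integral>\<^sup>+u. F u \<partial>scales) = (\<Sum>i. \<integral>\<^sup>+w. F (i, w) \<partial>plane)"
proof -
  interpret N: sigma_finite_measure "P \<Otimes>\<^sub>M (lborel :: (real ^ 'k) measure)" 
    by (rule sigma_finite_pair_measure[OF sigma_finite_measure_axioms lborel.sigma_finite_measure_axioms])
  have "(\<integral>\<^sup>+u. F u \<partial>scales) = (\<integral>\<^sup>+i. \<integral>\<^sup>+w. F (i, w) \<partial>plane \<partial>count_space UNIV)"
    using assms unfolding scales_def by (rule N.nn_integral_fst[symmetric])
  then show ?thesis by (simp add: nn_integral_count_space_nat)
qed

lemma nn_integral_scales_fst: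
  assumes F: "F \<in> borel_measurable scales"
  shows "(\<integral>\<^sup>+u. F u \<partial>scales) = (\<integral>\<^sup>+l. (\<Sum>i. \<integral>\<^sup>+z. F (i, l, z) \<partial>lborel) \<partial>P)"
proof -
  note F' = measurable_scalesD[OF F]
  have "(\<integral>\<^sup>+w. F (i, w) \<partial>plane) = (\<integral>\<^sup>+l. \<integral>\<^sup>+z. F (i, l, z) \<partial>lborel \<partial>P)" for i
    by (rule lborel.nn_integral_fst[OF F', symmetric])
  then have "(\<integral>\<^sup>+u. F u \<partial>scales) = (\<Sum>i. \<integral>\<^sup>+l. \<integral>\<^sup>+z. F (i, l, z) \<partial>lborel \<partial>P)"
    by (simp add: nn_integral_scales[OF F])
  also have "\<dots> = (\<integral>\<^sup>+l. (\<Sum>i. \<integral>\<^sup>+z. F (i, l, z) \<partial>lborel) \<partial>P)"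
    by (rule nn_integral_suminf[symmetric]) (rule lborel.borel_measurable_nn_integral_fst[OF F'])
  finally show ?thesis .
qed

lemma pulse_measurable: "x \<in> X \<Longrightarrow> pulse t x \<in> borel_measurable scales"
  by (rule measurable_scalesI) (use bump_measurable in \<open>simp add: pulse_def\<close>)

text \<open>The potential is an integral against a function and thus insensitive to null sets, so
  all measurable functions are admissible. Semicontinuity in \<open>y\<close> will come from the
  pulse instead.\<close>

lemma pulse_capacity:
  assumes f: "range f = X"
  shows "l2_capacity scales (borel_measurable scales) (\<lambda>F y. \<integral>\<^sup>+u. F u * pulse t (f y) u \<partial>scales)"
proof
  have fX: "f y \<in> X" for y using f by auto
  fix F G :: "nat \<times> 'l \<times> (real ^ 'k) \<Rightarrow> ennreal" and y
  assume FG[measurable]: "F \<in> borel_measurable scales" "G \<in> borel_measurable scales"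
  show "(\<lambda>w. (F w + G w) / 2) \<in> borel_measurable scales" by measurable
  note [measurable] = pulse_measurable[OF fX]
  show "(\<integral>\<^sup>+u. F u * pulse t (f y) u \<partial>scales) \<le> (\<integral>\<^sup>+u. G u * pulse t (f y) u \<partial>scales)" if "\<And>w. F w \<le> G w"
    using that by (intro nn_integral_mono mult_right_mono) auto
  assume gt: "1 < (\<integral>\<^sup>+u. F u * pulse t (f y) u \<partial>scales)" "1 < (\<integral>\<^sup>+u. G u * pulse t (f y) u \<partial>scales)"
  have "(\<integral>\<^sup>+u. (F u + G u) / 2 * pulse t (f y) u \<partial>scales) = (\<integral>\<^sup>+u. (F u * pulse t (f y) u + G u * pulse t (f y) u) / 2 \<partial>scales)"
    by (intro nn_integral_cong) (simp add: divide_ennreal_def distrib_right distrib_left mult_ac)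
  also have "\<dots> = ((\<integral>\<^sup>+u. F u * pulse t (f y) u \<partial>scales) + (\<integral>\<^sup>+u. G u * pulse t (f y) u \<partial>scales)) / 2"
    by (simp add: nn_integral_divide nn_integral_add)
  finally show "1 < (\<integral>\<^sup>+u. (F u + G u) / 2 * pulse t (f y) u \<partial>scales)" using ennreal_one_less_avg[OF gt] by simp
next
  fix H :: "nat \<Rightarrow> nat \<times> 'l \<times> (real ^ 'k) \<Rightarrow> ennreal"
  assume "\<And>n. H n \<in> borel_measurable scales"
  then show "(\<lambda>w. SUP n. H n w) \<in> borel_measurable scales" by simp
qed simp

lemma open_pulse_potential:
  fixes f :: "(nat \<Rightarrow> nat) \<Rightarrow> 'a"
  assumes f: "continuous_on UNIV f" "range f = X" and F[measurable]: "F \<in> borel_measurable scales"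
  shows "open {y. 1 < (\<integral>\<^sup>+u. F u * pulse t (f y) u \<partial>scales)}"
proof (rule open_integral_greater[where h="\<lambda>u y. F u * pulse t (f y) u"])
  have [measurable]: "pulse t (f y) \<in> borel_measurable scales" for y
    by (rule pulse_measurable) (use f in auto)
  show "(\<lambda>u. F u * pulse t (f y) u) \<in> borel_measurable scales" for y by measurable
  show "open {y. a < F u * pulse t (f y) u}" if u: "u \<in> space scales" for u a
  proof -
    obtain i l z where u_eq: "u = (i, l, z)" by (cases u)
    then have l: "l \<in> space P" using u by (simp add: scales_def space_pair_measure)
    have "continuous_on UNIV (\<lambda>y. p l (f y))"
      by (rule continuous_on_orbit[OF f l])
    then have "open ((\<lambda>y. p l (f y)) -` ball z (1/2^i))" by (simp add: open_vimage)
    \<comment> \<open>For fixed \<open>u\<close> the pulse takes two values, and the positive one is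
      attained on an open set of \<open>y\<close>.\<close>
    moreover have "{y. a < F u * pulse t (f y) u} \<in> {{}, (\<lambda>y. p l (f y)) -` ball z (1/2^i)}"
      by (cases "a < F u * ennreal (weight t i)")
         (auto simp: u_eq pulse_def bump_def indicator_def dist_commute split: if_splits)
    ultimately show ?thesis by auto
  qed
qed

text \<open>Monotone convergence in the number of scales: finitely many of them already carry a
  pairing above 1, and how many depends on \<open>x\<close>.\<close>

lemma pulse_truncation:
  assumes F[measurable]: "F \<in> borel_measurable scales" and x: "x \<in> X" and gt: "1 < (\<integral>\<^sup>+u. F u * pulse t x u \<partial>scales)"
  shows "\<exists>n::nat. 1 \<le> (\<integral>\<^sup>+u. F u * (indicator {..n} (fst u) * pulse t x u) \<partial>scales)"
proof -
  note [measurable] = pulse_measurable[OF x]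
  have [measurable]: "(\<lambda>u. indicator {..n::nat} (fst u) * pulse t x u) \<in> borel_measurable scales" for n
    by (rule measurable_scalesI) (use measurable_scalesD[OF pulse_measurable[OF x]] in simp)
  have "(SUP n. F u * (indicator {..n} (fst u) * pulse t x u)) = F u * pulse t x u" for u
  proof (rule antisym)
    show "(SUP n. F u * (indicator {..n} (fst u) * pulse t x u)) \<le> F u * pulse t x u"
      by (rule SUP_least) (simp add: indicator_def)
    have "F u * (indicator {..fst u} (fst u) * pulse t x u) \<le> (SUP n. F u * (indicator {..n} (fst u) * pulse t x u))"
      by (rule SUP_upper) simp
    then show "F u * pulse t x u \<le> (SUP n. F u * (indicator {..n} (fst u) * pulse t x u))" by simp
  qed
  then have "(\<integral>\<^sup>+u. F u * pulse t x u \<partial>scales) = (\<integral>\<^sup>+u. (SUP n. F u * (indicator {..n} (fst u) * pulse t x u)) \<partial>scales)"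
    by simp
  also have "\<dots> = (SUP n. \<integral>\<^sup>+u. F u * (indicator {..n} (fst u) * pulse t x u) \<partial>scales)"
    by (rule nn_integral_monotone_convergence_SUP)
       (auto simp: incseq_def le_fun_def intro!: mult_left_mono mult_right_mono split: split_indicator)
  finally obtain n where "1 < (\<integral>\<^sup>+u. F u * (indicator {..n} (fst u) * pulse t x u) \<partial>scales)"
    using gt by (auto simp: less_SUP_iff)
  then show ?thesis by (intro exI[of _ n]) simp
qed

text \<open>A compact image inside \<open>Q\<close> keeps some margin \<open>1/2^n\<close> from the
  complement, and containment with a margin can be tested on a countable dense subset of
  \<open>B\<close>.\<close>

lemma image_in_open_measurable:
  fixes f :: "(nat \<Rightarrow> nat) \<Rightarrow> 'a"
  assumes f: "continuous_on UNIV f" "range f = X" and "open Q" "compact B"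
  shows "{l \<in> space P. \<forall>y\<in>B. p l (f y) \<in> Q} \<in> sets P"
proof -
  obtain D where D: "countable D" "D \<subseteq> B" "B \<subseteq> closure D" by (rule separable_subset)
  have [measurable]: "(\<lambda>l. p l (f y)) \<in> borel_measurable P" for y
    by (rule p_measurable) (use f in auto)
  have cl: "closed {z. ball z r \<subseteq> Q}" for r
  proof -
    have "{z. ball z r \<subseteq> Q} = - (\<Union>w\<in>-Q. ball w r)" by (auto simp: dist_commute)
    then show ?thesis by (simp add: closed_def open_UN)
  qed
  have "{l \<in> space P. \<forall>y\<in>B. p l (f y) \<in> Q} = (\<Union>n::nat. {l \<in> space P. \<forall>y\<in>D. p l (f y) \<in> {z. ball z (1/2^n) \<subseteq> Q}})"
  proof (intro set_eqI iffI)
    fix l assume "l \<in> {l \<in> space P. \<forall>y\<in>B. p l (f y) \<in> Q}"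
    then have l: "l \<in> space P" "\<And>y. y \<in> B \<Longrightarrow> p l (f y) \<in> Q" by auto
    have "continuous_on UNIV (\<lambda>y. p l (f y))"
      by (rule continuous_on_orbit[OF f l(1)])
    then have "compact ((\<lambda>y. p l (f y)) ` B)" by (intro compact_continuous_image assms) (auto intro: continuous_on_subset)
    moreover have "(\<lambda>y. p l (f y)) ` B \<subseteq> Q" using l by auto
    ultimately obtain e where e: "0 < e" "(\<Union>z\<in>(\<lambda>y. p l (f y)) ` B. ball z e) \<subseteq> Q"
      using compact_subset_open_imp_ball_epsilon_subset[OF _ \<open>open Q\<close>] by metis
    obtain n where n: "(1/2)^n < e" using real_arch_pow_inv[of e "1/2"] e(1) by auto
    have "ball (p l (f y)) (1/2^n) \<subseteq> Q" if "y \<in> D" for y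
    proof -
      have "ball (p l (f y)) (1/2^n) \<subseteq> ball (p l (f y)) e" using n by (intro subset_ball) (simp add: power_one_over)
      then show ?thesis using e(2) that D(2) by blast
    qed
    then show "l \<in> (\<Union>n::nat. {l \<in> space P. \<forall>y\<in>D. p l (f y) \<in> {z. ball z (1/2^n) \<subseteq> Q}})" using l by auto
  next
    fix l assume "l \<in> (\<Union>n::nat. {l \<in> space P. \<forall>y\<in>D. p l (f y) \<in> {z. ball z (1/2^n) \<subseteq> Q}})"
    then obtain n :: nat where l: "l \<in> space P" and n: "\<And>y. y \<in> D \<Longrightarrow> ball (p l (f y)) (1/2^n) \<subseteq> Q" by auto
    have "continuous_on UNIV (\<lambda>y. p l (f y))"
      by (rule continuous_on_orbit[OF f l])
    then have "(\<Union>y\<in>B. ball (p l (f y)) (1/2^n)) = (\<Union>y\<in>D. ball (p l (f y)) (1/2^n))"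
      by (rule UN_ball_closure_eq[OF _ D(2,3)])
    then have "(\<Union>y\<in>B. ball (p l (f y)) (1/2^n)) \<subseteq> Q" using n by auto
    moreover have "p l (f y) \<in> ball (p l (f y)) (1/2^n)" for y by simp
    ultimately show "l \<in> {l \<in> space P. \<forall>y\<in>B. p l (f y) \<in> Q}" using l by blast
  qed
  also have "\<dots> \<in> sets P"
  proof (rule sets.countable_UN, rule image_subsetI)
    fix n :: nat
    have "{l \<in> space P. p l (f y) \<in> {z. ball z (1/2^n) \<subseteq> Q}} \<in> sets P" for y
      using borel_closed[OF cl, of "1/2^n"] by measurable
    then have "space P - (\<Union>y\<in>D. space P - {l \<in> space P. p l (f y) \<in> {z. ball z (1/2^n) \<subseteq> Q}}) \<in> sets P"
      by (intro sets.Diff sets.top sets.countable_UN'[OF D(1)]) auto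
    also have "space P - (\<Union>y\<in>D. space P - {l \<in> space P. p l (f y) \<in> {z. ball z (1/2^n) \<subseteq> Q}})
        = {l \<in> space P. \<forall>y\<in>D. p l (f y) \<in> {z. ball z (1/2^n) \<subseteq> Q}}" by blast
    finally show "{l \<in> space P. \<forall>y\<in>D. p l (f y) \<in> {z. ball z (1/2^n) \<subseteq> Q}} \<in> sets P" .
  qed
  finally show ?thesis .
qed



section \<open>Finite families of dyadic balls and images of small Hausdorff measure\<close>

text \<open>A pair \<open>(q, i)\<close> codes the ball with centre \<open>q\<close> and radius
  \<open>1/2^i\<close>. With centres from a countable set there are only countably many finite
  families, so a cover can be chosen measurably in the parameter.\<close>

definition ball_family :: "((real ^ 'k) \<times> nat) set \<Rightarrow> real \<Rightarrow> real \<Rightarrow> ((real ^ 'k) \<times> nat) set set" where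
  "ball_family D t e = {S. finite S \<and> S \<subseteq> D \<and> (\<Sum>(q, i)\<in>S. 2 powr (- t * real i)) \<le> e}"

definition family_union :: "((real ^ 'k) \<times> nat) set \<Rightarrow> (real ^ 'k) set" where
  "family_union S = (\<Union>(q, i)\<in>S. ball q (1/2^i))"

text \<open>On the slice of scale \<open>i\<close>, \<open>F\<close> lives on the doubled balls of
  that scale from a cover chosen for \<lambda>. Each image point lies in a ball of some scale, and
  that slice alone contributes \<open>\<kappa> * \<omega>\<close> at \<lambda>. The cost is
  controlled by the sum of \<open>2 powr (- t * i)\<close> over the cover.\<close>

lemma pulse_potential_of_ball_family:
  fixes f :: "(nat \<Rightarrow> nat) \<Rightarrow> 'a"
  assumes f: "continuous_on UNIV f" "range f = X" and pos: "0 < measure P (space P)" and D: "countable D"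
    and small: "\<And>e. 0 < e \<Longrightarrow> AE l in P. \<exists>S\<in>ball_family D t e. \<forall>y\<in>baire_box b. p l (f y) \<in> family_union S"
    and e: "0 < e"
  shows "\<exists>F\<in>borel_measurable scales. (\<forall>y\<in>baire_box b. 1 < (\<integral>\<^sup>+u. F u * pulse t (f y) u \<partial>scales)) \<and>
     (\<integral>\<^sup>+u. (F u)^2 \<partial>scales) \<le> ennreal e"
proof -
  have fX: "f y \<in> X" for y using f by auto
  define M where "M = measure P (space P)"
  \<comment> \<open>The potential will be at least \<open>\<kappa> * \<omega>\<close> times a mass
    above \<open>M / 2\<close>, hence above 2; \<open>e'\<close> cancels the constant
    \<open>\<kappa>^2 * \<omega> * 2^k\<close> of the cost.\<close>
  define \<kappa> where "\<kappa> = 4 / (\<omega> * M)"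
  have kpos: "0 < \<kappa>" using pos omega_pos by (simp add: \<kappa>_def M_def)
  define e' where "e' = e / (\<kappa>^2 * \<omega> * 2^k)"
  have e': "0 < e'" using e kpos omega_pos by (simp add: e'_def)
  have count: "countable (ball_family D t e')"
    unfolding ball_family_def by (rule countable_subset[OF _ countable_Collect_finite_subset[OF D]]) auto
  have nonempty: "{} \<in> ball_family D t e'" using e' by (simp add: ball_family_def)
  define c where "c = from_nat_into (ball_family D t e')"
  have c: "c j \<in> ball_family D t e'" for j unfolding c_def by (rule from_nat_into) (use nonempty in auto)
  have c_surj: "\<exists>j. c j = S" if "S \<in> ball_family D t e'" for S
    unfolding c_def using from_nat_into_surj[OF count that] .
  have fin: "finite (c j)" and c_sum: "(\<Sum>(q, i)\<in>c j. 2 powr (- t * real i)) \<le> e'" for j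
    using c[of j] by (auto simp: ball_family_def)
  define A where "A j = {l \<in> space P. \<forall>y\<in>baire_box b. p l (f y) \<in> family_union (c j)}" for j
  have A: "A j \<in> sets P" for j
    unfolding A_def by (rule image_in_open_measurable[OF f _ compact_baire_box]) (auto simp: family_union_def intro!: open_UN)
  \<comment> \<open>Each parameter uses the first family of the enumeration that covers its image,
    so that the costs of different families do not add up at one parameter.\<close>
  define A' where "A' = disjointed A"
  have A'[measurable]: "A' j \<in> sets P" for j
    unfolding A'_def using sets.range_disjointed_sets[of A P] A by blast
  define \<Lambda> where "\<Lambda> n = (\<Union>j<n. A' j)" for n
  have Lam: "\<Lambda> n = (\<Union>j<n. A j)" for n
    unfolding \<Lambda>_def A'_def using finite_UN_disjointed_eq[of A n] by (simp add: atLeast0LessThan)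
  have "incseq \<Lambda>" unfolding \<Lambda>_def incseq_def by (intro allI impI UN_mono) auto
  moreover have Lam_sets[measurable]: "\<Lambda> n \<in> sets P" for n unfolding \<Lambda>_def by measurable
  moreover have "AE l in P. l \<in> (\<Union>n. \<Lambda> n)"
    using small[OF e'] AE_space
  proof eventually_elim
    fix l assume "\<exists>S\<in>ball_family D t e'. \<forall>y\<in>baire_box b. p l (f y) \<in> family_union S" and l: "l \<in> space P"
    then obtain j where "l \<in> A j" using c_surj unfolding A_def by blast
    then have "l \<in> \<Lambda> (Suc j)" unfolding Lam by blast
    then show "l \<in> (\<Union>n. \<Lambda> n)" by blast
  qed
  ultimately obtain n where n: "M / 2 < measure P (\<Lambda> n)"
    using exists_half[of \<Lambda>, OF _ Lam_sets _ pos] unfolding M_def by blast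
  \<comment> \<open>Complementary to \<open>weight\<close>:
    \<open>s i * weight t i = \<kappa> * 2 powr (i * k)\<close> cancels the volume of the tube,
    while \<open>(s i)^2 * (1/2^i)^k = \<kappa>^2 * 2 powr (- t * i)\<close> is the cost of one
    ball.\<close>
  define s where "s i = \<kappa> * 2 powr (real i * (real k - t) / 2)" for i
  have s: "0 < s i" for i using kpos by (simp add: s_def)
  \<comment> \<open>Doubled radius, so that the ball of radius \<open>1/2^i\<close> around a point
    of the original ball stays inside.\<close>
  define Q where "Q j i = (\<Union>q\<in>{q. (q, i) \<in> c j}. ball q (2/2^i))" for j i
  have Q_open: "open (Q j i)" for j i unfolding Q_def by blast
  define F where "F u = ennreal (s (fst u)) * indicator {(l, z). \<exists>j<n. l \<in> A' j \<and> z \<in> Q j (fst u)} (snd u)" for u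
  have F: "F \<in> borel_measurable scales"
  proof (rule measurable_scalesI)
    fix i
    have "{(l, z). \<exists>j<n. l \<in> A' j \<and> z \<in> Q j i} = (\<Union>j<n. A' j \<times> Q j i)" by auto
    also have "\<dots> \<in> sets plane"
      using Q_open by (intro sets.finite_UN pair_measureI A') auto
    finally have "(\<lambda>w. indicator {(l, z). \<exists>j<n. l \<in> A' j \<and> z \<in> Q j i} w :: ennreal) \<in> borel_measurable plane"
      by (rule borel_measurable_indicator)
    then have "(\<lambda>w. ennreal (s i) * indicator {(l, z). \<exists>j<n. l \<in> A' j \<and> z \<in> Q j i} w) \<in> borel_measurable plane"
      by (intro borel_measurable_times_ennreal borel_measurable_const)
    then show "(\<lambda>w. F (i, w)) \<in> borel_measurable plane" by (simp only: F_def fst_conv snd_conv)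
  qed
  have F_on: "F (i, l, z) = ennreal (s i) * indicator (Q j i) z" if "j < n" "l \<in> A' j" for i l z j
  proof -
    have uniq: "j' = j" if "l \<in> A' j'" for j'
    proof (rule ccontr)
      assume "j' \<noteq> j"
      then have "A' j' \<inter> A' j = {}"
        unfolding A'_def by (intro disjoint_family_onD[OF disjoint_family_disjointed]) auto
      then show False using \<open>l \<in> A' j\<close> that by blast
    qed
    have "(\<exists>j'<n. l \<in> A' j' \<and> z \<in> Q j' i) \<longleftrightarrow> z \<in> Q j i"
      using uniq that by metis
    then show ?thesis by (simp add: F_def indicator_def)
  qed
  have F_off: "F (i, l, z) = 0" if "l \<notin> \<Lambda> n" for i l z
    using that by (auto simp: F_def indicator_def \<Lambda>_def)
  have "1 < (\<integral>\<^sup>+u. F u * pulse t (f y) u \<partial>scales)" if y: "y \<in> baire_box b" for y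
  proof -
    have meas: "(\<lambda>u. F u * pulse t (f y) u) \<in> borel_measurable scales"
      using F pulse_measurable[OF fX] by measurable
    have "1 < \<kappa> * \<omega> * measure P (\<Lambda> n)" using n pos omega_pos by (simp add: \<kappa>_def M_def field_simps)
    then have "1 < ennreal (\<kappa> * \<omega> * measure P (\<Lambda> n))" by simp
    also have "\<dots> = (\<integral>\<^sup>+l. ennreal (\<kappa> * \<omega>) * indicator (\<Lambda> n) l \<partial>P)"
      using kpos omega_pos by (simp add: nn_integral_cmult_indicator emeasure_eq_measure ennreal_mult)
    also have "\<dots> \<le> (\<integral>\<^sup>+l. (\<Sum>i. \<integral>\<^sup>+z. F (i, l, z) * pulse t (f y) (i, l, z) \<partial>lborel) \<partial>P)"
    proof (rule nn_integral_mono)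
      fix l assume l: "l \<in> space P"
      show "ennreal (\<kappa> * \<omega>) * indicator (\<Lambda> n) l \<le> (\<Sum>i. \<integral>\<^sup>+z. F (i, l, z) * pulse t (f y) (i, l, z) \<partial>lborel)"
      proof (cases "l \<in> \<Lambda> n")
        case True
        then obtain j where j: "j < n" "l \<in> A' j" by (auto simp: \<Lambda>_def)
        then have "l \<in> A j" using disjointed_subset[of A j] by (auto simp: A'_def)
        then obtain q i where q: "(q, i) \<in> c j" "p l (f y) \<in> ball q (1/2^i)"
          using y by (auto simp: A_def family_union_def)
        have "ball (p l (f y)) (1/2^i) \<subseteq> ball q (2/2^i)"
        proof
          fix z assume "z \<in> ball (p l (f y)) (1/2^i)"
          then show "z \<in> ball q (2/2^i)" using q(2) dist_triangle[of q z "p l (f y)"] by simp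
        qed
        then have sub: "ball (p l (f y)) (1/2^i) \<subseteq> Q j i" using q(1) unfolding Q_def by blast
        have "s i * weight t i * (1/2^i)^k = \<kappa>"
        proof -
          have "s i * weight t i = \<kappa> * 2 powr (real i * real k)"
            by (simp add: s_def weight_def powr_add[symmetric] mult.assoc) (simp add: field_simps)
          also have "2 powr (real i * real k) = 2^(i*k)" by (simp add: powr_realpow[symmetric])
          finally show ?thesis by (simp add: power_mult power_mult_distrib[symmetric])
        qed
        then have "ennreal (\<kappa> * \<omega>) = ennreal (s i * weight t i) * (\<integral>\<^sup>+z. bump (1/2^i) (f y) (l, z) \<partial>lborel)"
          using s weight_pos omega_pos by (subst nn_integral_bump) (auto simp: ennreal_mult[symmetric] less_imp_le mult_ac)
        also have "\<dots> = (\<integral>\<^sup>+z. ennreal (s i * weight t i) * bump (1/2^i) (f y) (l, z) \<partial>lborel)"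
          using measurable_compose[OF measurable_Pair1'[OF l] bump_measurable[OF fX]]
          by (simp add: nn_integral_cmult)
        also have "\<dots> \<le> (\<integral>\<^sup>+z. F (i, l, z) * pulse t (f y) (i, l, z) \<partial>lborel)"
        proof (rule nn_integral_mono)
          fix z
          show "ennreal (s i * weight t i) * bump (1/2^i) (f y) (l, z) \<le> F (i, l, z) * pulse t (f y) (i, l, z)"
          proof (cases "z \<in> ball (p l (f y)) (1/2^i)")
            case True
            then have "z \<in> Q j i" using sub by blast
            then show ?thesis using s weight_pos
              by (simp add: F_on[OF j] pulse_def ennreal_mult less_imp_le mult.assoc)
          qed (simp add: bump_def)
        qed
        also have "\<dots> \<le> (\<Sum>i. \<integral>\<^sup>+z. F (i, l, z) * pulse t (f y) (i, l, z) \<partial>lborel)"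
          by (rule sum_le_suminf[where I="{i}", simplified]) auto
        finally show ?thesis using True by simp
      qed simp
    qed
    also have "\<dots> = (\<integral>\<^sup>+u. F u * pulse t (f y) u \<partial>scales)" by (rule nn_integral_scales_fst[OF meas, symmetric])
    finally show ?thesis .
  qed
  moreover have "(\<integral>\<^sup>+u. (F u)^2 \<partial>scales) \<le> ennreal e"
  proof -
    have "(\<integral>\<^sup>+u. (F u)^2 \<partial>scales) = (\<integral>\<^sup>+l. (\<Sum>i. \<integral>\<^sup>+z. (F (i, l, z))^2 \<partial>lborel) \<partial>P)"
      by (rule nn_integral_scales_fst) (use F in measurable)
    also have "\<dots> \<le> (\<integral>\<^sup>+l. ennreal e \<partial>P)"
    proof (rule nn_integral_mono)
      fix l assume l: "l \<in> space P"
      show "(\<Sum>i. \<integral>\<^sup>+z. (F (i, l, z))^2 \<partial>lborel) \<le> ennreal e"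
      proof (cases "l \<in> \<Lambda> n")
        case True
        then obtain j where j: "j < n" "l \<in> A' j" by (auto simp: \<Lambda>_def)
        define g where "g q i = (if (q, i) \<in> c j then ennreal (\<kappa>^2 * \<omega> * 2^k * 2 powr (- t * real i)) else 0)" for q i
        \<comment> \<open>The family is sorted by scale: slice \<open>i\<close> is charged for the
          members of scale \<open>i\<close>, and the sum over all slices becomes the sum over the
          family.\<close>
        have "(\<Sum>i. \<integral>\<^sup>+z. (F (i, l, z))^2 \<partial>lborel) \<le> (\<Sum>i. \<Sum>(q, i')\<in>c j. if i' = i then g q i else 0)"
        proof (rule suminf_le)
          fix i
          have "(\<integral>\<^sup>+z. (F (i, l, z))^2 \<partial>lborel) = (\<integral>\<^sup>+z. ennreal ((s i)^2) * indicator (Q j i) z \<partial>lborel)"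
            using s[of i] by (intro nn_integral_cong) (simp add: F_on[OF j] power_mult_distrib ennreal_power less_imp_le split: split_indicator)
          also have "\<dots> = ennreal ((s i)^2) * emeasure lborel (Q j i)"
            by (rule nn_integral_cmult_indicator) (simp add: Q_open)
          also have "\<dots> \<le> ennreal ((s i)^2) * (\<Sum>q\<in>{q. (q, i) \<in> c j}. emeasure lborel (ball q (2/2^i)))"
          proof (intro mult_left_mono)
            have "finite {q. (q, i) \<in> c j}" using finite_vimageI[OF fin[of j], of "\<lambda>q. (q, i)"] by (simp add: inj_on_def vimage_def)
            then show "emeasure lborel (Q j i) \<le> (\<Sum>q\<in>{q. (q, i) \<in> c j}. emeasure lborel (ball q (2/2^i)))"
              unfolding Q_def by (intro emeasure_subadditive_finite) auto
          qed simp
          also have "\<dots> = (\<Sum>q\<in>{q. (q, i) \<in> c j}. ennreal ((s i)^2 * (\<omega> * (2/2^i)^k)))"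
            unfolding sum_distrib_left using omega_pos by (intro sum.cong refl) (simp add: emeasure_ball' ennreal_mult)
          also have "(s i)^2 * (\<omega> * (2/2^i)^k) = \<kappa>^2 * \<omega> * 2^k * 2 powr (- t * real i)"
          proof -
            have "(s i)^2 = \<kappa>^2 * 2 powr (real i * (real k - t))"
              by (simp add: s_def power_mult_distrib powr_power) 
            moreover have "(2/2^i)^k = (2^k * 2 powr (- (real i * real k)) :: real)"
            proof -
              have "2 powr (- (real i * real k)) = 1 / (2::real)^(i*k)"
                by (simp add: powr_minus_divide powr_realpow[symmetric])
              then show ?thesis by (simp add: power_divide power_mult)
            qed
            moreover have "2 powr (real i * (real k - t)) * 2 powr (- (real i * real k)) = 2 powr (- t * real i)"
              by (simp add: powr_add[symmetric] algebra_simps)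
            ultimately show ?thesis by (simp add: mult_ac)
          qed
          also have "(\<Sum>q\<in>{q. (q, i) \<in> c j}. ennreal (\<kappa>^2 * \<omega> * 2^k * 2 powr (- t * real i))) = (\<Sum>(q, i')\<in>{x \<in> c j. snd x = i}. g q i)"
            by (rule sum.reindex_bij_witness[where i=fst and j="\<lambda>q. (q, i)"]) (auto simp: g_def)
          also have "\<dots> = (\<Sum>(q, i')\<in>c j. if i' = i then g q i else 0)"
            using fin[of j] by (subst sum.inter_filter) (auto intro!: sum.cong)
          finally show "(\<integral>\<^sup>+z. (F (i, l, z))^2 \<partial>lborel) \<le> (\<Sum>(q, i')\<in>c j. if i' = i then g q i else 0)" .
        qed auto
        also have "\<dots> = (\<Sum>x\<in>c j. \<Sum>i. case x of (q, i') \<Rightarrow> if i' = i then g q i else 0)"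
          by (rule suminf_sum) auto
        also have "\<dots> = (\<Sum>(q, i)\<in>c j. g q i)"
        proof (rule sum.cong[OF refl], clarify)
          fix q i
          have "(\<Sum>i'. if i = i' then g q i' else 0) = (\<Sum>i'\<in>{i}. if i = i' then g q i' else 0)"
            by (rule suminf_finite) auto
          then show "(\<Sum>i'. if i = i' then g q i' else 0) = g q i" by simp
        qed
        also have "\<dots> = (\<Sum>(q, i)\<in>c j. ennreal (\<kappa>^2 * \<omega> * 2^k * 2 powr (- t * real i)))"
          by (rule sum.cong) (auto simp: g_def)
        also have "\<dots> = ennreal (\<kappa>^2 * \<omega> * 2^k * (\<Sum>(q, i)\<in>c j. 2 powr (- t * real i)))"
          using omega_pos by (simp add: case_prod_unfold sum_ennreal sum_distrib_left)
        also have "\<dots> \<le> ennreal (\<kappa>^2 * \<omega> * 2^k * e')"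
          using omega_pos c_sum[of j] by (intro ennreal_leI mult_left_mono) auto
        also have "\<kappa>^2 * \<omega> * 2^k * e' = e" using kpos omega_pos by (simp add: e'_def)
        finally show ?thesis .
      qed (simp add: F_off)
    qed
    also have "\<dots> = ennreal (e * M)" using e by (simp add: emeasure_eq_measure M_def ennreal_mult)
    also have "\<dots> \<le> ennreal e" using e mass unfolding M_def by (intro ennreal_leI) (simp add: mult_left_le)
    finally show ?thesis .
  qed
  ultimately show ?thesis using F by blast
qed

text \<open>The vectors \<open>v x\<close> are pulses cut off after scale \<open>n x\<close>. Only
  the common scales up to \<open>min (n x) (n y)\<close> contribute to the Gram kernel, and
  \<open>near_sum_bound\<close> compares them with the truncation of \<open>x\<close>.\<close>

lemma hausdorff_measure_0_of_ball_family:
  fixes f :: "(nat \<Rightarrow> nat) \<Rightarrow> 'a"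
  assumes f: "continuous_on UNIV f" "range f = X" and pos: "0 < measure P (space P)" and D: "countable D"
    and t: "0 < t" "t < real k"
    and small: "\<And>b e. 0 < e \<Longrightarrow> AE l in P. \<exists>S\<in>ball_family D t e. \<forall>y\<in>baire_box b. p l (f y) \<in> family_union S"
    and s: "\<alpha> * t < s"
  shows "hausdorff_measure s X = 0"
proof (rule hausdorff_measure_eq_0_of_energy[OF \<alpha> t(1) s])
  define B where "B = \<omega> * (K * (1 + 2^k / (1 - 2 powr (t - k))))"
  have "2 powr (t - k) < 1" using t by (simp add: powr_less_one)
  then show "0 < B" unfolding B_def using omega_pos K_pos by (intro mult_pos_pos add_pos_pos divide_pos_pos) auto
  fix J :: real assume J: "0 < J"
  have "\<exists>F\<in>borel_measurable scales. (\<forall>y. 1 < (\<integral>\<^sup>+u. F u * pulse t (f y) u \<partial>scales)) \<and>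
      (\<integral>\<^sup>+u. (F u)^2 \<partial>scales) < ennreal (1 / J)"
  proof (rule l2_capacity_baire_null[OF pulse_capacity[OF f(2)] open_pulse_potential[OF f]])
    show "\<exists>F\<in>borel_measurable scales. (\<forall>y\<in>baire_box b. 1 < (\<integral>\<^sup>+u. F u * pulse t (f y) u \<partial>scales)) \<and>
        (\<integral>\<^sup>+u. (F u)^2 \<partial>scales) \<le> ennreal e" if "0 < e" for b e
      by (rule pulse_potential_of_ball_family[OF f pos D small that])
  qed (use J in auto)
  then obtain F where F[measurable]: "F \<in> borel_measurable scales"
    and F1: "\<forall>y. 1 < (\<integral>\<^sup>+u. F u * pulse t (f y) u \<partial>scales)"
    and F2: "(\<integral>\<^sup>+u. (F u)^2 \<partial>scales) < ennreal (1 / J)" by blast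
  have "\<exists>n::nat. 1 \<le> (\<integral>\<^sup>+u. F u * (indicator {..n} (fst u) * pulse t x u) \<partial>scales)" if "x \<in> X" for x
  proof -
    have "x \<in> range f" using that f(2) by simp
    then obtain y where "x = f y" by blast
    then show ?thesis using pulse_truncation[OF F that] F1 by simp
  qed
  then have "\<forall>x\<in>X. \<exists>n::nat. 1 \<le> (\<integral>\<^sup>+u. F u * (indicator {..n} (fst u) * pulse t x u) \<partial>scales)" by simp
  from bchoice[OF this] obtain n :: "'a \<Rightarrow> nat"
    where n: "\<forall>x\<in>X. 1 \<le> (\<integral>\<^sup>+u. F u * (indicator {..n x} (fst u) * pulse t x u) \<partial>scales)" by (rule exE)
  define v where "v x u = indicator {..n x} (fst u) * pulse t x u" for x u
  have v: "v x \<in> borel_measurable scales" if "x \<in> X" for x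
    unfolding v_def[abs_def] by (rule measurable_scalesI) (use measurable_scalesD[OF pulse_measurable[OF that]] in simp)
  have ov: "(\<integral>\<^sup>+u. v x u * v y u \<partial>scales) \<le> ennreal (\<omega> * (\<Sum>i\<le>min (n x) (n y). 2 powr (t * real i) * near i x y))"
    if "x \<in> X" "y \<in> X" for x y
  proof -
    note [measurable] = bump_measurable[OF that(1)] bump_measurable[OF that(2)]
    define m where "m = min (n x) (n y)"
    have "(\<integral>\<^sup>+u. v x u * v y u \<partial>scales) = (\<Sum>i. \<integral>\<^sup>+w. v x (i, w) * v y (i, w) \<partial>plane)"
      by (rule nn_integral_scales) (use v[OF that(1)] v[OF that(2)] in measurable)
    also have "\<dots> = (\<Sum>i\<le>m. \<integral>\<^sup>+w. v x (i, w) * v y (i, w) \<partial>plane)"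
      by (rule suminf_finite) (auto simp: v_def m_def)
    also have "\<dots> \<le> (\<Sum>i\<le>m. ennreal (\<omega> * (2 powr (t * real i) * near i x y)))"
    proof (rule sum_mono)
      fix i assume i: "i \<in> {..m}"
      have "(\<integral>\<^sup>+w. v x (i, w) * v y (i, w) \<partial>plane) = (\<integral>\<^sup>+w. ennreal ((weight t i)^2) * (bump (1/2^i) x w * bump (1/2^i) y w) \<partial>plane)"
        using i weight_pos[of t i] by (intro nn_integral_cong) (simp add: v_def m_def pulse_def power2_eq_square ennreal_mult less_imp_le mult_ac)
      also have "\<dots> = ennreal ((weight t i)^2) * (\<integral>\<^sup>+w. bump (1/2^i) x w * bump (1/2^i) y w \<partial>plane)"
        by (rule nn_integral_cmult) measurable
      also have "\<dots> \<le> ennreal ((weight t i)^2) * ennreal (\<omega> * (1/2^i)^k * near i x y)"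
        using bump_overlap[OF that, of i i] by (intro mult_left_mono) auto
      also have "\<dots> = ennreal ((weight t i)^2 * (\<omega> * (1/2^i)^k * near i x y))"
        using omega_pos by (intro ennreal_mult[symmetric]) (auto simp: near_def)
      also have "(weight t i)^2 * (\<omega> * (1/2^i)^k * near i x y) = \<omega> * (2 powr (t * real i) * near i x y)"
      proof -
        have "(weight t i)^2 = 2 powr (real i * real k + t * real i)"
          unfolding weight_def power2_eq_square powr_add[symmetric] by (rule arg_cong[where f="\<lambda>r. 2 powr r"]) (simp add: algebra_simps)
        then have "(weight t i)^2 = 2 powr (real i * real k) * 2 powr (t * real i)"
          by (simp only: powr_add)
        moreover have "2 powr (real i * real k) * (1/2^i)^k = (1::real)"
        proof -
          have "2 powr (real i * real k) = (2::real)^(i*k)" by (simp add: powr_realpow[symmetric])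
          then show ?thesis by (simp add: power_mult power_mult_distrib[symmetric])
        qed
        ultimately show ?thesis by (simp add: mult_ac del: power_one_over)
      qed
      finally show "(\<integral>\<^sup>+w. v x (i, w) * v y (i, w) \<partial>plane) \<le> ennreal (\<omega> * (2 powr (t * real i) * near i x y))" .
    qed
    also have "\<dots> = ennreal (\<omega> * (\<Sum>i\<le>m. 2 powr (t * real i) * near i x y))"
      using omega_pos by (subst sum_ennreal) (auto simp: near_def sum_distrib_left)
    finally show ?thesis by (simp add: m_def)
  qed
  define \<phi> where "\<phi> x y = (if x \<in> X \<and> y \<in> X then enn2real (\<integral>\<^sup>+u. v x u * v y u \<partial>scales) else 0)" for x y
  have \<phi>_eq: "(\<integral>\<^sup>+u. v x u * v y u \<partial>scales) = ennreal (\<phi> x y)" if "x \<in> X" "y \<in> X" for x y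
    using le_less_trans[OF ov[OF that]] that by (simp add: \<phi>_def)
  have \<phi>_nn: "0 \<le> \<phi> x y" for x y by (simp add: \<phi>_def)
  have "\<phi> x y = \<phi> y x" for x y by (simp add: \<phi>_def mult.commute)
  moreover have "\<phi> x y \<le> B * (1 + (\<Sum>l\<le>n x. 2 powr (t * real l) * of_bool (dist x y powr \<alpha> \<le> 2 powr - real l)))"
    if xy: "x \<in> X" "y \<in> X" for x y
  proof -
    have "ennreal (\<phi> x y) \<le> ennreal (\<omega> * (\<Sum>i\<le>min (n x) (n y). 2 powr (t * real i) * near i x y))"
      using ov[OF xy] \<phi>_eq[OF xy] by simp
    then have "\<phi> x y \<le> \<omega> * (\<Sum>i\<le>min (n x) (n y). 2 powr (t * real i) * near i x y)"
      using omega_pos by (subst (asm) ennreal_le_iff) (auto simp: near_def intro!: mult_nonneg_nonneg sum_nonneg)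
    also have "\<dots> \<le> \<omega> * (K * (1 + 2^k / (1 - 2 powr (t - k))) * (1 + (\<Sum>l\<le>n x. 2 powr (t * real l) * of_bool (dist x y powr \<alpha> \<le> 2 powr - real l))))"
      using omega_pos by (intro mult_left_mono near_sum_bound xy t) auto
    finally show ?thesis by (simp only: B_def mult.assoc)
  qed
  moreover have "J \<le> (\<Sum>x\<in>S. \<Sum>y\<in>S. m x * m y * \<phi> x y)"
    if S: "finite S" "S \<subseteq> X" "\<forall>x. 0 \<le> m x" "(\<Sum>x\<in>S. m x) = 1" for S m
  proof -
    have "1 / (1 / J) \<le> (\<Sum>x\<in>S. \<Sum>y\<in>S. m x * m y * \<phi> x y)"
    proof (rule energy_ge_of_l2[where M=scales and F=F and v=v])
      show "(\<integral>\<^sup>+u. v x u * v y u \<partial>scales) = ennreal (\<phi> x y)" if "x \<in> S" "y \<in> S" for x y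
        by (rule \<phi>_eq) (use that S in auto)
      show "1 \<le> (\<integral>\<^sup>+u. F u * v x u \<partial>scales)" "v x \<in> borel_measurable scales" if "x \<in> S" for x
        using n v[of x] that S(2) by (auto simp: v_def)
    qed (use S F2 J \<phi>_nn F in auto)
    then show ?thesis by simp
  qed
  ultimately show "\<exists>n \<phi>. (\<forall>x y. \<phi> x y = \<phi> y x) \<and> (\<forall>x y. 0 \<le> \<phi> x y) \<and>
      (\<forall>x\<in>X. \<forall>y\<in>X. \<phi> x y \<le> B * (1 + (\<Sum>l\<le>n x. 2 powr (t * real l) * of_bool (dist x y powr \<alpha> \<le> 2 powr - real l)))) \<and>
      (\<forall>S m. finite S \<longrightarrow> S \<subseteq> X \<longrightarrow> (\<forall>x. 0 \<le> m x) \<longrightarrow> sum m S = 1 \<longrightarrow> J \<le> (\<Sum>x\<in>S. \<Sum>y\<in>S. m x * m y * \<phi> x y))"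
    using \<phi>_nn by (intro exI[of _ n] exI[of _ \<phi>] conjI allI ballI impI)
qed

end

section \<open>From positive probability to almost every parameter\<close>

text \<open>Exhaustion: a countable intersection of least possible measure cannot be cut down
  essentially by any further \<open>B i\<close>.\<close>

lemma (in finite_measure) essential_intersection:
  fixes B :: "'i \<Rightarrow> 'a set"
  assumes B: "\<And>i. B i \<in> sets M"
  obtains G where "G \<in> sets M" "(\<Inter>i. B i) \<subseteq> G" "\<And>i. AE x in M. x \<in> G \<longrightarrow> x \<in> B i"
proof -
  define c where "c = (INF \<phi> :: nat \<Rightarrow> 'i. measure M (\<Inter>j. B (\<phi> j)))"
  have sets: "(\<Inter>j. B (\<phi> j)) \<in> sets M" for \<phi> :: "nat \<Rightarrow> 'i" using B by auto
  have bdd: "bdd_below (range (\<lambda>\<phi> :: nat \<Rightarrow> 'i. measure M (\<Inter>j. B (\<phi> j))))"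
    by (rule bdd_belowI[of _ 0]) auto
  have lower: "c \<le> measure M (\<Inter>j. B (\<phi> j))" for \<phi> :: "nat \<Rightarrow> 'i"
    unfolding c_def by (rule cINF_lower[OF bdd]) simp
  have "\<exists>\<phi> :: nat \<Rightarrow> 'i. measure M (\<Inter>j. B (\<phi> j)) < c + 1 / Suc n" for n
  proof -
    have "c < c + 1 / Suc n" by simp
    then show ?thesis unfolding c_def by (subst (asm) cINF_less_iff[OF _ bdd]) auto
  qed
  then have "\<forall>n. \<exists>\<phi> :: nat \<Rightarrow> 'i. measure M (\<Inter>j. B (\<phi> j)) < c + 1 / Suc n" by blast
  from choice[OF this] obtain \<phi> :: "nat \<Rightarrow> nat \<Rightarrow> 'i"
    where \<phi>: "\<forall>n. measure M (\<Inter>j. B (\<phi> n j)) < c + 1 / Suc n" by (rule exE)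
  \<comment> \<open>Countably many index sequences are merged into one, so that \<open>G\<close>
    lies inside all the near-optimal intersections.\<close>
  define \<psi> where "\<psi> m = (case prod_decode m of (n, j) \<Rightarrow> \<phi> n j)" for m
  define G where "G = (\<Inter>m. B (\<psi> m))"
  have G: "G \<in> sets M" unfolding G_def by (rule sets)
  have "G \<subseteq> (\<Inter>j. B (\<phi> n j))" for n
  proof
    fix x assume x: "x \<in> G"
    have "x \<in> B (\<phi> n j)" for j
    proof -
      have "x \<in> B (\<psi> (prod_encode (n, j)))" using x unfolding G_def by blast
      then show ?thesis by (simp add: \<psi>_def)
    qed
    then show "x \<in> (\<Inter>j. B (\<phi> n j))" by blast
  qed
  then have Gn: "measure M G < c + 1 / Suc n" for n
    using \<phi> finite_measure_mono[OF _ sets] by (meson le_less_trans)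
  have Gc: "measure M G \<le> c"
  proof (rule field_le_epsilon)
    fix e :: real assume "0 < e"
    then obtain n where "1 / Suc n < e" using nat_approx_posE by blast
    with Gn[of n] show "measure M G \<le> c + e" by linarith
  qed
  have "AE x in M. x \<in> G \<longrightarrow> x \<in> B i" for i
  proof -
    \<comment> \<open>Prepending \<open>i\<close> to the sequence gives a competitor for the infimum
      \<open>c\<close>, so \<open>G \<inter> B i\<close> has no smaller measure than
      \<open>G\<close>.\<close>
    have "(\<Inter>j. B (case j of 0 \<Rightarrow> i | Suc m \<Rightarrow> \<psi> m)) = G \<inter> B i"
      unfolding G_def by (auto split: nat.splits)
    then have "c \<le> measure M (G \<inter> B i)" using lower[of "\<lambda>j. case j of 0 \<Rightarrow> i | Suc m \<Rightarrow> \<psi> m"] by simp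
    moreover have "measure M (G - B i) = measure M G - measure M (G \<inter> B i)"
      using finite_measure_Diff'[OF G B] by simp
    ultimately have "measure M (G - B i) = 0" using Gc measure_nonneg[of M "G - B i"] by linarith
    then have "G - B i \<in> null_sets M" using G B by (simp add: null_sets_def emeasure_eq_measure)
    then show ?thesis by (rule AE_I') blast
  qed
  moreover have "(\<Inter>i. B i) \<subseteq> G" unfolding G_def by blast
  ultimately show ?thesis using G that by blast
qed

context transversal_family begin

text \<open>Restriction to \<open>G\<close> can only decrease measures, so the transversality bound
  survives with the same \<open>C\<close>. For this purpose the locale asks for mass at most 1
  instead of a probability.\<close>

lemma transversal_family_density:
  assumes G: "G \<in> sets P"
  shows "transversal_family (density P (indicator G)) p X \<alpha> C k"
proof -
  have em: "emeasure (density P (indicator G)) A = emeasure P (G \<inter> A)" if "A \<in> sets P" for A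
    using that G by (simp add: emeasure_density flip: indicator_inter_arith)
  have m: "measure (density P (indicator G)) A \<le> measure P A" if "A \<in> sets P" for A
    using em[OF that] that by (simp add: measure_def) (metis Int_lower2 finite_measure_mono measure_def)
  show ?thesis
  proof (intro transversal_family.intro transversal_family_axioms.intro)
    show "finite_measure (density P (indicator G))"
      by (rule finite_measureI) (simp add: em)
    show "measure (density P (indicator G)) (space (density P (indicator G))) \<le> 1"
      using m[OF sets.top] mass by simp
    show "measure (density P (indicator G)) {l \<in> space (density P (indicator G)). norm (p l x - p l y) \<le> \<delta> * dist x y powr \<alpha>} \<le> C * \<delta> ^ k"
      if "0 < \<delta>" "\<delta> < 1" "x \<in> X" "y \<in> X" "x \<noteq> y" for \<delta> x y
    proof -
      note [measurable] = p_measurable[OF that(3)] p_measurable[OF that(4)]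
      have "{l \<in> space P. norm (p l x - p l y) \<le> \<delta> * dist x y powr \<alpha>} \<in> sets P" by measurable
      from m[OF this] transversal[OF that] show ?thesis by simp
    qed
  qed (use k \<alpha> C p_measurable p_continuous in auto)
qed

lemma measure_density_space:
  "G \<in> sets P \<Longrightarrow> measure (density P (indicator G)) (space (density P (indicator G))) = measure P G"
  by (simp add: measure_def emeasure_density)

text \<open>
  The index \<open>b\<close> ranges over uncountably many boxes, so the intersection of the \<open>B b\<close> need not be
  measurable; \<open>G\<close> is its essential version.
\<close>

lemma AE_not_in_all:
  assumes B: "\<And>b :: nat \<Rightarrow> nat. B b \<in> sets P"
    and null: "\<And>G. G \<in> sets P \<Longrightarrow> (\<And>b. AE l in density P (indicator G). l \<in> B b) \<Longrightarrow> measure P G = 0"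
  shows "AE l in P. \<exists>b. l \<notin> B b"
proof -
  obtain G where G: "G \<in> sets P" "(\<Inter>b. B b) \<subseteq> G" "\<And>b. AE x in P. x \<in> G \<longrightarrow> x \<in> B b"
    using essential_intersection[of B, OF B] by blast
  have "AE l in density P (indicator G). l \<in> B b" for b
    using G(1) G(3)[of b] by (subst AE_density) (auto simp: indicator_def elim: AE_mp)
  then have "measure P G = 0" by (rule null[OF G(1)])
  then have "G \<in> null_sets P" using G(1) by (simp add: null_sets_def emeasure_eq_measure)
  then show ?thesis by (rule AE_I') (use G(2) in blast)
qed

text \<open>If the parameters at which every box has arbitrarily small neighbourhoods of its image
  were not negligible, the null theorem would apply to the restriction of \<open>P\<close> to their
  essential hull. Testing with \<open>1 / Suc j\<close> keeps the condition on a single box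
  measurable.\<close>

lemma AE_not_lebesgue_small:
  assumes f: "continuous_on UNIV f" "range f = X"
    and s: "\<alpha> * real k < s" and X: "hausdorff_measure s X \<noteq> 0"
  shows "AE l in P. \<exists>b. \<not> (\<forall>j. \<exists>n. emeasure lborel (hits (baire_box b) f (1/2^n) l) \<le> ennreal (1 / Suc j))"
proof -
  define B where "B b = {l \<in> space P. \<forall>j. \<exists>n. emeasure lborel (hits (baire_box b) f (1/2^n) l) \<le> ennreal (1 / Suc j)}" for b
  have "AE l in P. \<exists>b. l \<notin> B b"
  proof (rule AE_not_in_all)
    have [measurable]: "(\<lambda>l. emeasure lborel (hits (baire_box b) f r l)) \<in> borel_measurable P" for b r
      by (rule emeasure_hits_measurable[OF f])
    show "B b \<in> sets P" for b unfolding B_def by measurable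
    fix G assume G: "G \<in> sets P" and AE: "\<And>b. AE l in density P (indicator G). l \<in> B b"
    interpret Q: transversal_family "density P (indicator G)" p X \<alpha> C k
      by (rule transversal_family_density[OF G])
    show "measure P G = 0"
    proof (rule ccontr)
      assume "measure P G \<noteq> 0"
      then have "0 < measure (density P (indicator G)) (space (density P (indicator G)))"
        unfolding measure_density_space[OF G] by (simp add: zero_less_measure_iff)
      then have "hausdorff_measure s X = 0"
      proof (rule Q.hausdorff_measure_0_of_lebesgue_small[OF f _ _ s])
        fix b and e :: real assume "0 < e"
        then obtain j where j: "1 / Suc j < e" using nat_approx_posE by blast
        from AE[of b] show "AE l in density P (indicator G). \<exists>n. emeasure lborel (hits (baire_box b) f (1/2^n) l) \<le> ennreal e"
        proof eventually_elim
          fix l assume "l \<in> B b"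
          then obtain n where "emeasure lborel (hits (baire_box b) f (1/2^n) l) \<le> ennreal (1 / Suc j)" unfolding B_def by blast
          also have "\<dots> \<le> ennreal e" using j by (intro ennreal_leI) simp
          finally show "\<exists>n. emeasure lborel (hits (baire_box b) f (1/2^n) l) \<le> ennreal e" by blast
        qed
      qed
      with X show False by simp
    qed
  qed
  then show ?thesis using AE_space by eventually_elim (auto simp: B_def)
qed

text \<open>Measurability rests on the countability of the ball families; the restriction argument
  is the one of the Lebesgue case.\<close>

lemma AE_not_hausdorff_small:
  fixes f :: "(nat \<Rightarrow> nat) \<Rightarrow> 'a"
  assumes f: "continuous_on UNIV f" "range f = X" and D: "countable D" and t: "0 < t" "t < real k"
    and s: "\<alpha> * t < s" and X: "hausdorff_measure s X \<noteq> 0"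
  shows "AE l in P. \<exists>b. \<not> (\<forall>j. \<exists>S\<in>ball_family D t (1 / Suc j). \<forall>y\<in>baire_box b. p l (f y) \<in> family_union S)"
proof -
  define B where "B b = {l \<in> space P. \<forall>j. \<exists>S\<in>ball_family D t (1 / Suc j). \<forall>y\<in>baire_box b. p l (f y) \<in> family_union S}" for b
  have "AE l in P. \<exists>b. l \<notin> B b"
  proof (rule AE_not_in_all)
    show "B b \<in> sets P" for b
    proof -
      have "B b = (\<Inter>j. \<Union>S\<in>ball_family D t (1 / Suc j). {l \<in> space P. \<forall>y\<in>baire_box b. p l (f y) \<in> family_union S})"
        by (auto simp: B_def)
      also have "\<dots> \<in> sets P"
      proof (intro sets.countable_INT' sets.countable_UN' image_subsetI)
        show "countable (ball_family D t (1 / Suc j))" for j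
          unfolding ball_family_def by (rule countable_subset[OF _ countable_Collect_finite_subset[OF D]]) auto
        show "{l \<in> space P. \<forall>y\<in>baire_box b. p l (f y) \<in> family_union S} \<in> sets P" for S
          by (rule image_in_open_measurable[OF f _ compact_baire_box]) (auto simp: family_union_def intro!: open_UN)
      qed auto
      finally show ?thesis .
    qed
    fix G assume G: "G \<in> sets P" and AE: "\<And>b. AE l in density P (indicator G). l \<in> B b"
    interpret Q: transversal_family "density P (indicator G)" p X \<alpha> C k
      by (rule transversal_family_density[OF G])
    show "measure P G = 0"
    proof (rule ccontr)
      assume "measure P G \<noteq> 0"
      then have pos: "0 < measure (density P (indicator G)) (space (density P (indicator G)))"
        unfolding measure_density_space[OF G] by (simp add: zero_less_measure_iff)
      have "hausdorff_measure s X = 0"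
      proof (rule Q.hausdorff_measure_0_of_ball_family[OF f pos D t _ s])
        fix b and e :: real assume "0 < e"
        then obtain j where j: "1 / Suc j < e" using nat_approx_posE by blast
        from AE[of b] show "AE l in density P (indicator G). \<exists>S\<in>ball_family D t e. \<forall>y\<in>baire_box b. p l (f y) \<in> family_union S"
        proof eventually_elim
          fix l assume "l \<in> B b"
          then obtain S where "S \<in> ball_family D t (1 / Suc j)" "\<forall>y\<in>baire_box b. p l (f y) \<in> family_union S" unfolding B_def by blast
          then show "\<exists>S\<in>ball_family D t e. \<forall>y\<in>baire_box b. p l (f y) \<in> family_union S"
            using j by (intro bexI[of _ S]) (auto simp: ball_family_def)
        qed
      qed
      with X show False by simp
    qed
  qed
  then show ?thesis using AE_space by eventually_elim (auto simp: B_def)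
qed

text \<open>Three adjustments turn a cover of small sum into an admissible family: small sets are
  thickened at an extra cost of at most \<open>\<eta> / 2^(Suc i)\<close>, each set is enclosed in a
  ball of dyadic radius centred in \<open>D\<close> at the price of a factor
  \<open>4 powr t\<close>, and compactness leaves finitely many balls.\<close>

lemma ball_family_of_hausdorff_null:
  fixes Z :: "(real ^ 'k) set"
  assumes Z: "compact Z" "hausdorff_measure t Z = 0" and t: "0 < t" and e: "0 < e"
    and D: "closure D = UNIV"
  shows "\<exists>S\<in>ball_family (D \<times> UNIV) t e. Z \<subseteq> family_union S"
proof -
  \<comment> \<open>One half of \<open>e\<close> is for the diameters and one half for the
    thickening, each before the factor \<open>4 powr t\<close>.\<close>
  define \<eta> where "\<eta> = e / (2 * 4 powr t)"
  have eta: "0 < \<eta>" using e by (simp add: \<eta>_def)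
  have "\<exists>U :: nat \<Rightarrow> (real ^ 'k) set. Z \<subseteq> (\<Union>i. U i) \<and> (\<forall>i. bounded (U i) \<and> diameter (U i) \<le> 1/8) \<and>
      (\<Sum>i. diam_pow t (U i)) < ennreal \<eta>"
    by (rule hausdorff_measure_0_cover[OF Z(2) _ eta]) simp
  then obtain U :: "nat \<Rightarrow> (real ^ 'k) set" where "Z \<subseteq> (\<Union>i. U i) \<and> (\<forall>i. bounded (U i) \<and> diameter (U i) \<le> 1/8) \<and>
      (\<Sum>i. diam_pow t (U i)) < ennreal \<eta>" by (rule exE)
  then have U: "Z \<subseteq> (\<Union>i. U i)" "\<And>i. bounded (U i)" "\<And>i. diameter (U i) \<le> 1/8"
    and sumU: "(\<Sum>i. diam_pow t (U i)) < ennreal \<eta>" by simp_all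
  define \<rho> where "\<rho> i = max (diameter (U i)) (min (1/8) ((\<eta> / 2^(Suc i)) powr (1/t)))" for i
  have dnn: "0 \<le> diameter (U i)" for i by (rule diameter_ge_0[OF U(2)])
  have rho: "0 < \<rho> i" "\<rho> i \<le> 1/8" "diameter (U i) \<le> \<rho> i" for i
    using eta U(3)[of i] by (auto simp: \<rho>_def less_max_iff_disj)
  have rho_t: "\<rho> i powr t \<le> diameter (U i) powr t + \<eta> / 2^(Suc i)" for i
  proof (cases "\<rho> i = diameter (U i)")
    case False
    then have "\<rho> i \<le> (\<eta> / 2^(Suc i)) powr (1/t)" by (auto simp: \<rho>_def max_def split: if_splits)
    then have "\<rho> i powr t \<le> ((\<eta> / 2^(Suc i)) powr (1/t)) powr t" using rho[of i] t by (intro powr_mono2) auto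
    also have "\<dots> = \<eta> / 2^(Suc i)" using t eta by (simp add: powr_powr)
    finally show ?thesis by (simp add: add_increasing)
  qed (use eta in simp)
  \<comment> \<open>A radius above \<open>2 * \<rho> i\<close> leaves room for moving the centre
    into \<open>D\<close>. The bound \<open>\<rho> i \<le> 1/8\<close> excludes
    \<open>m = 0\<close>, so that the predecessor of the least index exists.\<close>
  have "\<exists>n::nat. 2 * \<rho> i < 1/2^n \<and> 1/2^n \<le> 4 * \<rho> i" for i
  proof -
    have "\<exists>n. (1/2)^n < 2 * \<rho> i" using rho(1)[of i] by (intro real_arch_pow_inv) auto
    then have ex: "\<exists>n. 1/2^n \<le> 2 * \<rho> i" by (auto simp: power_one_over intro: less_imp_le)
    define m where "m = (LEAST n. 1/2^n \<le> 2 * \<rho> i)"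
    have m: "1/2^m \<le> 2 * \<rho> i" unfolding m_def using ex by (rule LeastI_ex)
    have "m \<noteq> 0" using m rho(2)[of i] by (intro notI) simp
    then obtain n where n: "m = Suc n" by (cases m) auto
    have "\<not> 1/2^n \<le> 2 * \<rho> i" using not_less_Least[of n "\<lambda>n. 1/2^n \<le> 2 * \<rho> i"] n by (simp add: m_def)
    moreover have "1/2^n \<le> 4 * \<rho> i" using m n by (simp add: field_simps)
    ultimately show ?thesis by (intro exI[of _ n]) simp
  qed
  then obtain n where n: "\<And>i. 2 * \<rho> i < 1/2^(n i)" "\<And>i. 1/2^(n i) \<le> 4 * \<rho> i" by metis
  have "\<exists>q\<in>D. U i \<subseteq> ball q (1/2^(n i))" for i
  proof (cases "U i = {}")
    case False
    then obtain x where x: "x \<in> U i" by blast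
    obtain q where q: "q \<in> D" "dist q x < \<rho> i"
      using D closure_approachable[of x D] rho(1)[of i] by auto
    have "dist q u < 1/2^(n i)" if "u \<in> U i" for u
    proof -
      have "dist x u \<le> diameter (U i)" by (rule diameter_bounded_bound[OF U(2) x that])
      then show ?thesis using q(2) dist_triangle[of q u x] rho(3)[of i] n(1)[of i] by linarith
    qed
    then have "U i \<subseteq> ball q (1/2^(n i))" by auto
    then show ?thesis using q(1) by (rule bexI)
  next
    case True
    have "D \<noteq> {}" using D by auto
    then show ?thesis using True by auto
  qed
  then obtain q where q: "\<And>i. q i \<in> D" "\<And>i. U i \<subseteq> ball (q i) (1/2^(n i))" by metis
  have "Z \<subseteq> (\<Union>i. ball (q i) (1/2^(n i)))" using U(1) q(2) by blast
  then obtain I where I: "finite I" "Z \<subseteq> (\<Union>i\<in>I. ball (q i) (1/2^(n i)))"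
    using compactE_image[OF Z(1), of UNIV "\<lambda>i. ball (q i) (1/2^(n i))"] by auto
  define S where "S = (\<lambda>i. (q i, n i)) ` I"
  have "Z \<subseteq> family_union S" using I(2) by (auto simp: family_union_def S_def)
  moreover have "(\<Sum>(q, i)\<in>S. 2 powr (- t * real i)) \<le> e"
  proof -
    have "(\<Sum>(q, i)\<in>S. 2 powr (- t * real i)) \<le> (\<Sum>i\<in>I. 2 powr (- t * real (n i)))"
      unfolding S_def by (rule order_trans[OF sum_image_le[OF I(1)]]) auto
    also have "\<dots> \<le> (\<Sum>i\<in>I. 4 powr t * (diameter (U i) powr t + \<eta> / 2^(Suc i)))"
    proof (rule sum_mono)
      fix i
      have "2 powr (- t * real (n i)) = (1/2^(n i)) powr t"
        by (simp add: half_power_eq_powr powr_powr mult.commute)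
      also have "\<dots> \<le> (4 * \<rho> i) powr t" using n(2)[of i] t by (intro powr_mono2) auto
      also have "\<dots> = 4 powr t * \<rho> i powr t" using rho(1)[of i] by (simp add: powr_mult)
      also have "\<dots> \<le> 4 powr t * (diameter (U i) powr t + \<eta> / 2^(Suc i))" by (intro mult_left_mono rho_t) simp
      finally show "2 powr (- t * real (n i)) \<le> 4 powr t * (diameter (U i) powr t + \<eta> / 2^(Suc i))" .
    qed
    also have "\<dots> = 4 powr t * ((\<Sum>i\<in>I. diameter (U i) powr t) + (\<Sum>i\<in>I. \<eta> / 2^(Suc i)))"
      by (simp add: sum_distrib_left sum.distrib distrib_left)
    also have "\<dots> \<le> 4 powr t * (\<eta> + \<eta>)"
    proof (intro mult_left_mono add_mono)
      have "ennreal (\<Sum>i\<in>I. diameter (U i) powr t) = (\<Sum>i\<in>I. diam_pow t (U i))"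
        by (subst sum_ennreal[symmetric]) (auto simp: diam_pow_pos[OF t])
      also have "\<dots> \<le> (\<Sum>i. diam_pow t (U i))" using I(1) by (intro sum_le_suminf) auto
      also have "\<dots> \<le> ennreal \<eta>" using sumU by simp
      finally show "(\<Sum>i\<in>I. diameter (U i) powr t) \<le> \<eta>" using eta by (simp add: ennreal_le_iff)
      have "(\<Sum>i\<in>I. \<eta> / 2^(Suc i)) = (\<Sum>i\<in>I. \<eta> * (1/2)^(Suc i))"
        by (simp only: power_one_over times_divide_eq_right mult_1_right)
      also have "\<dots> \<le> (\<Sum>i. \<eta> * (1/2)^(Suc i))"
      proof (rule sum_le_suminf[OF sums_summable[OF sums_mult[OF power_half_series]] I(1)])
        show "0 \<le> \<eta> * (1/2)^(Suc i)" for i using eta by (intro mult_nonneg_nonneg) auto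
      qed
      also have "\<dots> = \<eta>" using sums_unique[OF sums_mult[OF power_half_series, of \<eta>]] by simp
      finally show "(\<Sum>i\<in>I. \<eta> / 2^(Suc i)) \<le> \<eta>" .
    qed simp
    also have "\<dots> = e" by (simp add: \<eta>_def)
    finally show ?thesis .
  qed
  moreover have "finite S" "S \<subseteq> D \<times> UNIV" using I(1) q(1) by (auto simp: S_def)
  ultimately show ?thesis by (auto simp: ball_family_def)
qed

theorem AE_lebesgue_pos:
  fixes f :: "(nat \<Rightarrow> nat) \<Rightarrow> 'a"
  assumes f: "continuous_on UNIV f" "range f = X"
    and s: "\<alpha> * real k < s" and X: "hausdorff_measure s X \<noteq> 0"
  shows "AE l in P. 0 < emeasure lebesgue (p l ` X)"
  using AE_not_lebesgue_small[OF assms] AE_space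
proof eventually_elim
  fix l assume not: "\<exists>b. \<not> (\<forall>j. \<exists>n. emeasure lborel (hits (baire_box b) f (1/2^n) l) \<le> ennreal (1 / Suc j))"
    and l: "l \<in> space P"
  define g where "g y = p l (f y)" for y
  have g: "continuous_on UNIV g"
    unfolding g_def by (rule continuous_on_orbit[OF f l])
  have img: "p l ` X = range g" unfolding g_def f(2)[symmetric] by auto
  show "0 < emeasure lebesgue (p l ` X)"
  proof (rule ccontr)
    assume "\<not> ?thesis"
    then have 0: "emeasure lebesgue (range g) = 0" by (simp add: img)
    have "\<exists>n. emeasure lborel (hits (baire_box b) f (1/2^n) l) \<le> ennreal (1 / Suc j)" for b j
    proof -
      have K: "compact (g ` baire_box b)"
        by (rule compact_continuous_image[OF continuous_on_subset[OF g] compact_baire_box]) simp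
      have "emeasure lborel (g ` baire_box b) = emeasure lebesgue (g ` baire_box b)"
        using borel_compact[OF K] by simp
      \<comment> \<open>Measurability of the whole analytic image is what allows its measure 0 to be
        passed on to the box.\<close>
      also have "\<dots> \<le> emeasure lebesgue (range g)"
        by (rule emeasure_mono[OF _ lebesgue_measurable_baire_image[OF g]]) auto
      finally have "emeasure lborel (g ` baire_box b) = 0" using 0 by simp
      moreover have "(INF n. emeasure lborel (\<Union>x\<in>g ` baire_box b. ball x (1/2^n))) = emeasure lborel (g ` baire_box b)"
        by (rule emeasure_neighbourhoods[OF K sets_lborel emeasure_bounded_finite])
      ultimately have "(INF n. emeasure lborel (\<Union>x\<in>g ` baire_box b. ball x (1/2^n))) = 0" by simp
      also have "(0::ennreal) < ennreal (1 / Suc j)" by simp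
      finally obtain n where "emeasure lborel (\<Union>x\<in>g ` baire_box b. ball x (1/2^n)) < ennreal (1 / Suc j)"
        unfolding INF_less_iff by blast
      then show ?thesis by (intro exI[of _ n]) (simp add: hits_def g_def)
    qed
    with not show False by blast
  qed
qed

theorem AE_hausdorff_measure_pos:
  fixes f :: "(nat \<Rightarrow> nat) \<Rightarrow> 'a"
  assumes f: "continuous_on UNIV f" "range f = X" and t: "0 < t" "t < real k"
    and s: "\<alpha> * t < s" and X: "hausdorff_measure s X \<noteq> 0"
  shows "AE l in P. hausdorff_measure t (p l ` X) \<noteq> 0"
proof -
  obtain D :: "(real ^ 'k) set" where D: "countable D" "UNIV \<subseteq> closure D" by (rule separable_subset)
  have "countable (D \<times> (UNIV :: nat set))" using D(1) by simp
  from AE_not_hausdorff_small[OF f this t s X] AE_space show ?thesis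
  proof eventually_elim
    fix l assume not: "\<exists>b. \<not> (\<forall>j. \<exists>S\<in>ball_family (D \<times> UNIV) t (1 / Suc j). \<forall>y\<in>baire_box b. p l (f y) \<in> family_union S)"
      and l: "l \<in> space P"
    define g where "g y = p l (f y)" for y
    have g: "continuous_on UNIV g"
      unfolding g_def by (rule continuous_on_orbit[OF f l])
    show "hausdorff_measure t (p l ` X) \<noteq> 0"
    proof
      assume 0: "hausdorff_measure t (p l ` X) = 0"
      have "\<exists>S\<in>ball_family (D \<times> UNIV) t (1 / Suc j). \<forall>y\<in>baire_box b. p l (f y) \<in> family_union S" for b j
      proof -
        have K: "compact (g ` baire_box b)"
          by (rule compact_continuous_image[OF continuous_on_subset[OF g] compact_baire_box]) simp
        have "g ` baire_box b \<subseteq> p l ` X" using f(2) by (auto simp: g_def)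
        then have "hausdorff_measure t (g ` baire_box b) = 0"
          using hausdorff_measure_mono[of "g ` baire_box b" "p l ` X" t] 0 by simp
        then have "\<exists>S\<in>ball_family (D \<times> UNIV) t (1 / Suc j). g ` baire_box b \<subseteq> family_union S"
          by (intro ball_family_of_hausdorff_null K t) (use D(2) in auto)
        then show ?thesis by (auto simp: g_def image_subset_iff)
      qed
      with not show False by blast
    qed
  qed
qed

end

theorem theorem1p1:
  fixes X :: "'a::complete_space set"
    and P :: "'l measure"
    and \<pi> :: "'l \<times> 'a \<Rightarrow> real ^ 'k::finite"
    and \<alpha> C :: real
  assumes "analytic_set X"
    and "prob_space P"
    and "\<pi> \<in> borel_measurable (P \<Otimes>\<^sub>M restrict_space borel X)"
    and "\<And>l. l \<in> space P \<Longrightarrow> continuous_on X (\<lambda>x. \<pi> (l, x))"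
    and "0 < \<alpha>"
    and "0 < C"
    and "\<And>\<delta> x1 x2. 0 < \<delta> \<Longrightarrow> \<delta> < 1 \<Longrightarrow> x1 \<in> X \<Longrightarrow> x2 \<in> X \<Longrightarrow> x1 \<noteq> x2 \<Longrightarrow>
           measure P {l \<in> space P. norm (\<pi> (l, x1) - \<pi> (l, x2)) \<le> \<delta> * dist x1 x2 powr \<alpha>}
             \<le> C * \<delta> ^ CARD('k)"
  shows "(hausdorff_dim X > ennreal (\<alpha> * real CARD('k)) \<longrightarrow>
            (AE l in P. emeasure lebesgue ((\<lambda>x. \<pi> (l, x)) ` X) > 0)) \<and>
         (hausdorff_dim X \<le> ennreal (\<alpha> * real CARD('k)) \<longrightarrow>
            (AE l in P. hausdorff_dim ((\<lambda>x. \<pi> (l, x)) ` X) \<ge> hausdorff_dim X / ennreal \<alpha>))"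
proof (cases "X = {}")
  case True
  \<comment> \<open>The empty set is not an image of the Baire space. It has dimension 0, so the
    first implication is vacuous and the second trivial.\<close>
  have "hausdorff_content 0 \<delta> X = 0" if "0 < \<delta>" for \<delta>
  proof -
    have "hausdorff_content 0 \<delta> X \<le> (\<Sum>i::nat. diam_pow 0 ({} :: 'a set))"
      unfolding hausdorff_content_def by (rule INF_lower) (use True that in auto)
    then show ?thesis by (simp add: diam_pow_def)
  qed
  then have "hausdorff_measure 0 X \<le> 0" unfolding hausdorff_measure_def by (intro SUP_least) simp
  then have "hausdorff_dim X \<le> 0" using hausdorff_dim_le[of 0 X] by simp
  then show ?thesis by simp
next
  case False
  then obtain f :: "(nat \<Rightarrow> nat) \<Rightarrow> 'a" where f: "continuous_on UNIV f" "range f = X"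
    using assms(1) unfolding analytic_set_def by blast
  interpret P: prob_space P by fact
  interpret T: transversal_family P "\<lambda>l x. \<pi> (l, x)" X \<alpha> C "CARD('k)"
  proof
    show "(\<lambda>l. \<pi> (l, x)) \<in> borel_measurable P" if "x \<in> X" for x
    proof -
      have "(\<lambda>l. (l, x)) \<in> measurable P (P \<Otimes>\<^sub>M restrict_space borel X)"
        by (rule measurable_Pair2') (use that in \<open>simp add: space_restrict_space\<close>)
      then show ?thesis using assms(3) by (rule measurable_compose)
    qed
  qed (use assms P.prob_space in auto)
  show ?thesis
  proof (intro conjI impI)
    assume "ennreal (\<alpha> * real CARD('k)) < hausdorff_dim X"
    \<comment> \<open>An exponent strictly between the two values has nonzero measure on
      \<open>X\<close> and still exceeds \<open>\<alpha> * CARD('k)\<close>.\<close>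
    then obtain u where u: "ennreal (\<alpha> * real CARD('k)) < u" "u < hausdorff_dim X" using dense by blast
    then obtain s where s: "u = ennreal s" "0 \<le> s" using less_top by (cases u) auto
    have "\<alpha> * real CARD('k) < s" using u(1) s assms(5) by (simp add: ennreal_less_iff)
    moreover have "hausdorff_measure s X \<noteq> 0" using hausdorff_dim_le[of s X] s u(2) by auto
    ultimately show "AE l in P. 0 < emeasure lebesgue ((\<lambda>x. \<pi> (l, x)) ` X)"
      by (rule T.AE_lebesgue_pos[OF f])
  next
    assume le: "hausdorff_dim X \<le> ennreal (\<alpha> * real CARD('k))"
    then obtain d where d: "hausdorff_dim X = ennreal d" "0 \<le> d" by (cases "hausdorff_dim X") (auto simp: top_unique)
    have dk: "d / \<alpha> \<le> real CARD('k)" using le d assms(5) by (simp add: ennreal_le_iff field_simps)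
    \<comment> \<open>Countably many exponents approach \<open>d / \<alpha>\<close>, so their null
      sets can be united; each of them is strictly below \<open>d / \<alpha>\<close> and therefore
      below the dimension of the target.\<close>
    have "AE l in P. ennreal (d / \<alpha> - 1 / Suc n) \<le> hausdorff_dim ((\<lambda>x. \<pi> (l, x)) ` X)" for n
    proof (cases "0 < d / \<alpha> - 1 / Suc n")
      case True
      define t where "t = d / \<alpha> - 1 / Suc n"
      \<comment> \<open>Midway between \<open>\<alpha> * t\<close> and \<open>d\<close>: above the
        first as the projection argument requires, below the second so that \<open>X\<close> has
        nonzero measure of exponent \<open>s\<close>.\<close>
      define s where "s = (\<alpha> * t + d) / 2"
      have t: "0 < t" "t < d / \<alpha>" using True by (auto simp: t_def)
      then have td: "\<alpha> * t < d" using assms(5) by (simp add: field_simps)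
      then have s: "\<alpha> * t < s" "s < d" by (auto simp: s_def)
      have "0 < \<alpha> * t" using t assms(5) by simp
      then have "0 \<le> s" using s by linarith
      then have "hausdorff_measure s X \<noteq> 0" using hausdorff_dim_le[of s X] s d by (auto simp: ennreal_le_iff)
      then have "AE l in P. hausdorff_measure t ((\<lambda>x. \<pi> (l, x)) ` X) \<noteq> 0"
        using t dk by (intro T.AE_hausdorff_measure_pos[OF f _ _ s(1)]) auto
      then show ?thesis by eventually_elim (simp add: hausdorff_dim_ge t_def)
    qed (simp add: ennreal_neg)
    then have "AE l in P. \<forall>n. ennreal (d / \<alpha> - 1 / Suc n) \<le> hausdorff_dim ((\<lambda>x. \<pi> (l, x)) ` X)"
      by (simp add: AE_all_countable)
    then show "AE l in P. hausdorff_dim X / ennreal \<alpha> \<le> hausdorff_dim ((\<lambda>x. \<pi> (l, x)) ` X)"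
    proof eventually_elim
      fix l assume ge: "\<forall>n. ennreal (d / \<alpha> - 1 / Suc n) \<le> hausdorff_dim ((\<lambda>x. \<pi> (l, x)) ` X)"
      have "hausdorff_dim X / ennreal \<alpha> = ennreal (d / \<alpha>)" using d assms(5) by (simp add: divide_ennreal)
      also have "\<dots> \<le> hausdorff_dim ((\<lambda>x. \<pi> (l, x)) ` X)"
      proof (rule ennreal_le_epsilon)
        fix e :: real assume "0 < e"
        then obtain n where n: "1 / Suc n < e" using nat_approx_posE by blast
        have "ennreal (d / \<alpha>) \<le> ennreal (d / \<alpha> - 1 / Suc n) + ennreal (1 / Suc n)"
          by (cases "d / \<alpha> - 1 / Suc n < 0") (auto simp flip: ennreal_plus simp: ennreal_neg intro!: ennreal_leI)
        also have "\<dots> \<le> hausdorff_dim ((\<lambda>x. \<pi> (l, x)) ` X) + ennreal e"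
          using ge n by (intro add_mono ennreal_leI) auto
        finally show "ennreal (d / \<alpha>) \<le> hausdorff_dim ((\<lambda>x. \<pi> (l, x)) ` X) + ennreal e" .
      qed
      finally show "hausdorff_dim X / ennreal \<alpha> \<le> hausdorff_dim ((\<lambda>x. \<pi> (l, x)) ` X)" .
    qed
  qed
qed

end
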